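(* Let $T>0$, let $\psi_{\hbar,\varepsilon}$, $0<\hbar,\varepsilon\le1$, be the solutions of the nonlinear Schrödinger equation described in the context, let $f_{\hbar,\varepsilon}$ be the Wigner transform of $\psi_{\hbar,\varepsilon}$, $\rho_{\hbar,\varepsilon}=|\psi_{\hbar,\varepsilon}|^2$ and $E_{\hbar,\varepsilon}=\partial_xV_\varepsilon*\rho_{\hbar,\varepsilon}$. For $t\in[0,T]$ we have $$\Big\|\langle x\rangle\hbar^{\alpha+1}\partial_x^\alpha\int_{\mathbb{R}}\xi^kf_{\hbar,\varepsilon}(t,x,\xi)\,d\xi\Big\|_{L^\infty_x}\le C(k,\alpha,t)\qquad\text{for all integers }k\ge0,\ \alpha\ge0,$$ $$\Big\|\langle x\rangle\hbar^{\alpha}\partial_x^\alpha\int_{\mathbb{R}}\xi^kf_{\hbar,\varepsilon}(t,x,\xi)\,d\xi\Big\|_{L^1_x}\le C(k,\alpha,t)\qquad\text{for all integers }k\ge0,\ \alpha\ge0,$$ $$\|\hbar^k\partial_x^kE_{\hbar,\varepsilon}(t)\|_{L^\infty_x}\le C(k,t)\qquad\text{for all integers }k\ge0,$$ with finite constants independent of $\hbar,\varepsilon\in(0,1]$.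
   Context: $\langle x\rangle=\sqrt{1+x^2}$. For a fixed sign $\kappa\in\{+1,-1\}$, $V_\varepsilon(x)=\kappa\frac12|x|e^{-\varepsilon|x|}$ on $\mathbb{R}$. $\psi_{\hbar,\varepsilon}(t,x)$ solves $i\hbar\partial_t\psi_{\hbar,\varepsilon}=-\frac12\hbar^2\partial_x^2\psi_{\hbar,\varepsilon}+(V_\varepsilon*|\psi_{\hbar,\varepsilon}|^2)\psi_{\hbar,\varepsilon}$ on $\mathbb{R}$, $\psi_{\hbar,\varepsilon}(0)=\psi_\hbar^{\mathrm{in}}$, where $\|\psi_\hbar^{\mathrm{in}}\|_{L^2}=1$ and, with a constant $C_0$ independent of $\hbar$, $\||x|\psi_\hbar^{\mathrm{in}}\|_{L^2}\le C_0$ and $\|\hbar^k\partial_x^k\psi_\hbar^{\mathrm{in}}\|_{L^2}\le C_0^kk^k$ for all integers $k\ge0$ (with $0^0=1$). The Wigner transform is $f_{\hbar,\varepsilon}(t,x,\xi)=\frac1{2\pi}\int_{\mathbb{R}}e^{-i\xi y}\psi_{\hbar,\varepsilon}(t,x+\frac{\hbar y}2)\overline{\psi_{\hbar,\varepsilon}(t,x-\frac{\hbar y}2)}\,dy$, and its moments are understood as $\int_{\mathbb{R}}\xi^kf_{\hbar,\varepsilon}\,d\xi=(-i\partial_y)^k\big[\psi_{\hbar,\varepsilon}(t,x+\frac{\hbar y}2)\overline{\psi_{\hbar,\varepsilon}(t,x-\frac{\hbar y}2)}\big]\big|_{y=0}$. *)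

theory Defs
  imports "HOL-Probability.Probability"
begin

text \<open>Iterated derivatives of functions of one real variable. The iterates are only meaningful
  where the derivatives exist, so they are used together with \<open>smooth\<close>.\<close>

definition Dn :: "nat \<Rightarrow> (real \<Rightarrow> 'a::real_normed_vector) \<Rightarrow> real \<Rightarrow> 'a" where
  "Dn k f = ((\<lambda>g x. vector_derivative g (at x)) ^^ k) f"

definition smooth :: "(real \<Rightarrow> 'a::real_normed_vector) \<Rightarrow> bool" where
  "smooth f \<longleftrightarrow> (\<forall>k x. Dn k f differentiable (at x))"

text \<open>Norms on the real line with values in \<open>[0,\<infinity>]\<close>; they are infinite for functions outside the
  respective space. For non-measurable functions \<open>esssup\<close> is already infinite by definition.\<close>

definition L1_norm :: "(real \<Rightarrow> 'a::{banach, second_countable_topology}) \<Rightarrow> ennreal" where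
  "L1_norm f = (if integrable lborel f then ennreal (LINT x|lborel. norm (f x)) else \<infinity>)"

definition L2_norm :: "(real \<Rightarrow> 'a::{banach, second_countable_topology}) \<Rightarrow> ennreal" where
  "L2_norm f =
     (if f \<in> borel_measurable lborel \<and> integrable lborel (\<lambda>x. (norm (f x))\<^sup>2)
      then ennreal (sqrt (LINT x|lborel. (norm (f x))\<^sup>2)) else \<infinity>)"

definition Linf_norm :: "(real \<Rightarrow> 'a::{banach, second_countable_topology}) \<Rightarrow> ennreal" where
  "Linf_norm f = esssup lborel (\<lambda>x. ennreal (norm (f x)))"

definition japanese :: "real \<Rightarrow> real" where
  "japanese x = sqrt (1 + x\<^sup>2)"

definition conv :: "(real \<Rightarrow> real) \<Rightarrow> (real \<Rightarrow> real) \<Rightarrow> real \<Rightarrow> real" where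
  "conv f g x = (LINT y|lborel. f (x - y) * g y)"

definition V :: "real \<Rightarrow> real \<Rightarrow> real \<Rightarrow> real" where
  "V \<kappa> \<epsilon> x = \<kappa> * (1/2) * \<bar>x\<bar> * exp (- \<epsilon> * \<bar>x\<bar>)"

definition density_of :: "(real \<Rightarrow> complex) \<Rightarrow> real \<Rightarrow> real" where
  "density_of \<phi> x = (cmod (\<phi> x))\<^sup>2"

text \<open>The potential is Lipschitz and differentiable away from the origin, so its weak derivative is
  its pointwise derivative; the unspecified value of \<open>deriv\<close> at \<open>0\<close> does not affect the integral.\<close>

definition E_field :: "real \<Rightarrow> real \<Rightarrow> (real \<Rightarrow> complex) \<Rightarrow> real \<Rightarrow> real" where
  "E_field \<kappa> \<epsilon> \<phi> = conv (deriv (V \<kappa> \<epsilon>)) (density_of \<phi>)"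

text \<open>Conditions on the initial datum for one value \<open>h\<close> of the semiclassical parameter. All
  derivatives are square integrable, so the datum is represented by its smooth representative and
  its derivatives are classical. For \<open>k = 0\<close> the bound uses \<open>0 ^ 0 = 1\<close>.\<close>

definition admissible_datum :: "real \<Rightarrow> real \<Rightarrow> (real \<Rightarrow> complex) \<Rightarrow> bool" where
  "admissible_datum C\<^sub>0 h \<phi> \<longleftrightarrow>
     smooth \<phi> \<and>
     L2_norm \<phi> = 1 \<and>
     L2_norm (\<lambda>x. \<bar>x\<bar> *\<^sub>R \<phi> x) \<le> ennreal C\<^sub>0 \<and>
     (\<forall>k. L2_norm (\<lambda>x. h ^ k *\<^sub>R Dn k \<phi> x) \<le> ennreal (C\<^sub>0 ^ k * real k ^ k))"

text \<open>Solutions on \<open>[0,T]\<close> of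
    \<open>i h \<partial>\<^sub>t\<psi> = - h\<^sup>2/2 \<partial>\<^sub>x\<^sup>2\<psi> + (V * |\<psi>|\<^sup>2) \<psi>\<close>, \<open>\<psi>(0) = \<phi>\<close>,
  in the class \<open>C([0,T]; H\<^sup>k)\<close> for every \<open>k\<close>, the regularity of the data. Functions in
  this class are smooth in \<open>x\<close>, and the equation then holds pointwise (with one-sided time
  derivatives at the end points).\<close>

definition nls_solution ::
  "real \<Rightarrow> real \<Rightarrow> real \<Rightarrow> real \<Rightarrow> (real \<Rightarrow> complex) \<Rightarrow> (real \<Rightarrow> real \<Rightarrow> complex) \<Rightarrow> bool" where
  "nls_solution \<kappa> h \<epsilon> T \<phi> \<psi> \<longleftrightarrow>
     \<psi> 0 = \<phi> \<and>
     (\<forall>t\<in>{0..T}. smooth (\<psi> t)) \<and>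
     (\<forall>k. \<forall>t\<in>{0..T}. L2_norm (Dn k (\<psi> t)) < \<infinity>) \<and>
     (\<forall>k. \<forall>t\<in>{0..T}.
        ((\<lambda>s. L2_norm (\<lambda>x. Dn k (\<psi> s) x - Dn k (\<psi> t) x)) \<longlongrightarrow> 0) (at t within {0..T})) \<and>
     (\<forall>t\<in>{0..T}. \<forall>x. \<exists>d.
        ((\<lambda>s. \<psi> s x) has_vector_derivative d) (at t within {0..T}) \<and>
        \<i> * complex_of_real h * d =
          - complex_of_real (h\<^sup>2 / 2) * Dn 2 (\<psi> t) x
          + complex_of_real (conv (V \<kappa> \<epsilon>) (density_of (\<psi> t)) x) * \<psi> t x)"

definition wigner_kernel :: "real \<Rightarrow> (real \<Rightarrow> complex) \<Rightarrow> real \<Rightarrow> real \<Rightarrow> complex" where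
  "wigner_kernel h \<phi> x y = \<phi> (x + h * y / 2) * cnj (\<phi> (x - h * y / 2))"

definition wigner :: "real \<Rightarrow> (real \<Rightarrow> complex) \<Rightarrow> real \<Rightarrow> real \<Rightarrow> complex" where
  "wigner h \<phi> x \<xi> =
     complex_of_real (1 / (2 * pi)) *
       (LINT y|lborel. exp (- \<i> * complex_of_real (\<xi> * y)) * wigner_kernel h \<phi> x y)"

text \<open>The moment \<open>\<integral> \<xi>\<^sup>k wigner h \<phi> x \<xi> d\<xi>\<close> need not converge absolutely. It is understood
  through Fourier inversion, as \<open>(-i \<partial>\<^sub>y)\<^sup>k\<close> of the kernel at \<open>y = 0\<close>.\<close>

definition wigner_moment :: "nat \<Rightarrow> real \<Rightarrow> (real \<Rightarrow> complex) \<Rightarrow> real \<Rightarrow> complex" where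
  "wigner_moment k h \<phi> x = (- \<i>) ^ k * Dn k (wigner_kernel h \<phi> x) 0"

end

theory Submission
  imports Defs
begin

text \<open>Let \<open>D k = h ^ k * Dn k (\<psi> t)\<close>. In the energy identity for \<open>D k\<close> the term of the Leibniz rule
  containing the undifferentiated potential \<open>W\<close> cancels, and every other one contains
  \<open>(1 / h) * h ^ j * Dn j W = h ^ (j - 1) * Dn (j - 1) E\<close> with \<open>j \<ge> 1\<close>, so the singular factor
  \<open>1 / h\<close> is absorbed. Since the derivative of the interaction potential is bounded by \<open>1\<close> uniformly
  in \<open>\<epsilon>\<close>, Young's inequality bounds this factor by the \<open>L\<^sup>2\<close> norms of \<open>D 0, \<dots>, D (j - 1)\<close>. The norm of
  \<open>D k\<close> therefore grows at most linearly in time, with a rate given by the lower norms, and induction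
  on \<open>k\<close> closes without a Gronwall argument. The norm of \<open>x \<psi>\<close> grows at a rate given by \<open>D 1\<close>.
  A full weight on each derivative is not available, but only half of \<open>\<langle>x\<rangle>\<close> is needed on each factor of
  \<open>D a * cnj (D b)\<close>: integrating by parts moves all derivatives in \<open>\<integral> \<langle>x\<rangle> |D a|\<^sup>2\<close> to one factor, which
  leaves the whole weight on \<open>\<psi>\<close>. The weighted \<open>L\<^sup>\<infinity>\<close> bounds follow from the \<open>L\<^sup>1\<close> bounds for
  \<open>\<alpha>\<close> and \<open>\<alpha> + 1\<close>.\<close>

section \<open>Smooth functions and iterated derivatives\<close>

text \<open>Two kinds of bounds have to be kept apart. Qualitative ones come from compactness of
  \<open>[0,T]\<close> or from \<open>|V| \<le> 1/\<epsilon>\<close>. They may blow up as h or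
  \<epsilon> tends to 0 and serve only to justify differentiation under an integral, exchange of
  derivatives and removal of cutoffs. Quantitative ones, which alone survive in the final constants,
  rest on the data, T and \<open>|V'| \<le> 1\<close>. The cancellation of W matters twice: W comes
  with an uncompensated factor 1/h, and its size is not controlled uniformly in \<epsilon>. It
  cancels because W is real, so that its contribution is the imaginary part of a real number. The
  full weight on derivatives is missing because the datum has a moment bound for the function itself
  and none for its derivatives. Finiteness of weighted integrals is part of the claim, so every
  weight is first replaced by a bounded one; estimates independent of the truncation then pass to
  the limit by Fatou's lemma. Growth linear in t is estimated by its value at T, so the constants
  obtained are the same for all t.\<close>

lemma Dn_0 [simp]: "Dn 0 f = f"
  by (simp add: Dn_def)

lemma Dn_Suc: "Dn (Suc k) f = (\<lambda>x. vector_derivative (Dn k f) (at x))"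
  by (simp add: Dn_def)

lemma Dn_Dn: "Dn i (Dn j f) = Dn (i + j) f"
  by (simp add: Dn_def funpow_add)

lemma smooth_Dn: "smooth f \<Longrightarrow> smooth (Dn j f)"
  by (simp add: smooth_def Dn_Dn)

lemma smooth_deriv: "smooth f \<Longrightarrow> (Dn k f has_vector_derivative Dn (Suc k) f x) (at x)"
  by (simp add: smooth_def Dn_Suc vector_derivative_works)

text \<open>\<open>Dn\<close> iterates a total operator, so a formula for \<open>Dn k f\<close>
  means little without existence of the derivatives. A candidate sequence closed under
  differentiation gives both at once; the calculus rules below all exhibit such a sequence
  \<open>F\<close>.\<close>

lemma smooth_iterates:
  assumes "F 0 = f" and "\<And>k x. (F k has_vector_derivative F (Suc k) x) (at x)"
  shows "smooth f" and "Dn k f = F k"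
proof -
  have *: "Dn k f = F k" for k
  proof (induction k)
    case (Suc k)
    then show ?case using assms(2)[of k] by (auto simp: Dn_Suc vector_derivative_at)
  qed (use assms in simp)
  then show "Dn k f = F k" .
  show "smooth f"
    unfolding smooth_def * using assms(2) by (blast intro: differentiableI_vector)
qed

lemma smooth_continuous: "smooth f \<Longrightarrow> continuous_on S (Dn k f)"
  using smooth_deriv[of f k] continuous_on_subset[of UNIV]
  by (metis continuous_at_imp_continuous_on has_vector_derivative_continuous top_greatest)

lemma smooth_measurable [measurable_dest]: "smooth f \<Longrightarrow> Dn k f \<in> borel_measurable borel"
  by (intro borel_measurable_continuous_onI smooth_continuous)

lemma smooth_measurable0: "smooth f \<Longrightarrow> f \<in> borel_measurable borel"
  using smooth_measurable[of f 0] by simp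

lemma
  assumes "bounded_linear L" and "smooth f"
  shows smooth_bounded_linear: "smooth (\<lambda>x. L (f x))"
    and Dn_bounded_linear: "Dn k (\<lambda>x. L (f x)) = (\<lambda>x. L (Dn k f x))"
proof -
  have "((\<lambda>x. L (Dn k f x)) has_vector_derivative L (Dn (Suc k) f x)) (at x)" for k x
    using bounded_linear.has_vector_derivative[OF assms(1) smooth_deriv[OF assms(2)]] .
  from smooth_iterates[where F = "\<lambda>k x. L (Dn k f x)", OF _ this]
  show "smooth (\<lambda>x. L (f x))" "Dn k (\<lambda>x. L (f x)) = (\<lambda>x. L (Dn k f x))" by simp_all
qed

lemma smooth_cnj:
  assumes "smooth f"
  shows "smooth (\<lambda>x. cnj (f x))" "Dn k (\<lambda>x. cnj (f x)) = (\<lambda>x. cnj (Dn k f x))"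
  using smooth_bounded_linear[OF bounded_linear_cnj assms] Dn_bounded_linear[OF bounded_linear_cnj assms] by auto

lemma
  assumes "\<And>i. i \<in> I \<Longrightarrow> smooth (f i)"
  shows smooth_sum: "smooth (\<lambda>x. \<Sum>i\<in>I. f i x)"
    and Dn_sum: "Dn k (\<lambda>x. \<Sum>i\<in>I. f i x) = (\<lambda>x. \<Sum>i\<in>I. Dn k (f i) x)"
proof -
  have "((\<lambda>x. \<Sum>i\<in>I. Dn k (f i) x) has_vector_derivative (\<Sum>i\<in>I. Dn (Suc k) (f i) x)) (at x)" for k x
    by (intro has_vector_derivative_sum smooth_deriv assms)
  from smooth_iterates[where F = "\<lambda>k x. \<Sum>i\<in>I. Dn k (f i) x", OF _ this]
  show "smooth (\<lambda>x. \<Sum>i\<in>I. f i x)"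
    "Dn k (\<lambda>x. \<Sum>i\<in>I. f i x) = (\<lambda>x. \<Sum>i\<in>I. Dn k (f i) x)" by simp_all
qed

lemma
  assumes "smooth f" "smooth g"
  shows smooth_add: "smooth (\<lambda>x. f x + g x)"
    and Dn_add: "Dn k (\<lambda>x. f x + g x) = (\<lambda>x. Dn k f x + Dn k g x)"
proof -
  have "((\<lambda>x. Dn k f x + Dn k g x) has_vector_derivative (Dn (Suc k) f x + Dn (Suc k) g x)) (at x)" for k x
    by (intro has_vector_derivative_add smooth_deriv assms)
  from smooth_iterates[where F = "\<lambda>k x. Dn k f x + Dn k g x", OF _ this]
  show "smooth (\<lambda>x. f x + g x)" "Dn k (\<lambda>x. f x + g x) = (\<lambda>x. Dn k f x + Dn k g x)" by simp_all
qed

text \<open>Pascal's rule for an abstract two-index family. With \<open>a i j\<close> the product of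
  the i-th and j-th derivatives, it is the induction step of the Leibniz formula.\<close>

lemma sum_choose_Suc:
  fixes a :: "nat \<Rightarrow> nat \<Rightarrow> 'a::real_vector"
  shows "(\<Sum>j\<le>k. real (k choose j) *\<^sub>R (a (Suc j) (k - j) + a j (Suc (k - j)))) =
    (\<Sum>j\<le>Suc k. real (Suc k choose j) *\<^sub>R a j (Suc k - j))"
proof -
  have "(\<Sum>j\<le>Suc k. real (Suc k choose j) *\<^sub>R a j (Suc k - j)) =
     a 0 (Suc k) + (\<Sum>j\<le>k. real (Suc k choose Suc j) *\<^sub>R a (Suc j) (k - j))"
    by (subst sum.atMost_Suc_shift) simp
  also have "\<dots> = a 0 (Suc k) + (\<Sum>j\<le>k. real (k choose Suc j) *\<^sub>R a (Suc j) (k - j)) +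
      (\<Sum>j\<le>k. real (k choose j) *\<^sub>R a (Suc j) (k - j))"
    by (simp add: sum.distrib algebra_simps)
  also have "a 0 (Suc k) + (\<Sum>j\<le>k. real (k choose Suc j) *\<^sub>R a (Suc j) (k - j)) =
      (\<Sum>j\<le>Suc k. real (k choose j) *\<^sub>R a j (Suc k - j))"
    by (subst sum.atMost_Suc_shift) simp
  also have "\<dots> = (\<Sum>j\<le>k. real (k choose j) *\<^sub>R a j (Suc (k - j)))"
    by (simp add: Suc_diff_le)
  finally show ?thesis by (simp add: sum.distrib algebra_simps)
qed

lemma
  fixes f g :: "real \<Rightarrow> 'a::real_normed_algebra"
  assumes "smooth f" "smooth g"
  shows smooth_mult: "smooth (\<lambda>x. f x * g x)"
    and Dn_mult: "Dn k (\<lambda>x. f x * g x) =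
      (\<lambda>x. \<Sum>j\<le>k. real (k choose j) *\<^sub>R (Dn j f x * Dn (k - j) g x))"
proof -
  let ?F = "\<lambda>k x. \<Sum>j\<le>k. real (k choose j) *\<^sub>R (Dn j f x * Dn (k - j) g x)"
  have "(?F k has_vector_derivative ?F (Suc k) x) (at x)" for k x
  proof -
    have "(?F k has_vector_derivative
      (\<Sum>j\<le>k. real (k choose j) *\<^sub>R (Dn j f x * Dn (Suc (k - j)) g x + Dn (Suc j) f x * Dn (k - j) g x))) (at x)"
      by (intro has_vector_derivative_sum has_vector_derivative_mult smooth_deriv assms
          bounded_linear.has_vector_derivative[OF bounded_linear_scaleR_right])
    then show ?thesis
      using sum_choose_Suc[of k "\<lambda>i j. Dn i f x * Dn j g x"] by (simp add: add.commute)
  qed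
  from smooth_iterates[where F = ?F, OF _ this]
  show "smooth (\<lambda>x. f x * g x)" "Dn k (\<lambda>x. f x * g x) = ?F k" by simp_all
qed

lemma
  assumes "smooth f"
  shows smooth_affine: "smooth (\<lambda>y. f (x + c * y))"
    and Dn_affine: "Dn k (\<lambda>y. f (x + c * y)) = (\<lambda>y. c ^ k *\<^sub>R Dn k f (x + c * y))"
proof -
  have "((\<lambda>y. c ^ k *\<^sub>R Dn k f (x + c * y)) has_vector_derivative c ^ Suc k *\<^sub>R Dn (Suc k) f (x + c * y)) (at y)" for k y
  proof -
    have "((\<lambda>y. x + c * y) has_vector_derivative c) (at y)"
      by (auto intro!: derivative_eq_intros simp: has_vector_derivative_def mult.commute)
    from vector_diff_chain_at[OF this smooth_deriv[OF assms, of k "x + c * y"]]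
    have "((\<lambda>y. Dn k f (x + c * y)) has_vector_derivative c *\<^sub>R Dn (Suc k) f (x + c * y)) (at y)"
      by (simp add: o_def)
    from bounded_linear.has_vector_derivative[OF bounded_linear_scaleR_right this, of "c ^ k"]
    show ?thesis by (simp add: mult.commute)
  qed
  from smooth_iterates[where F = "\<lambda>k y. c ^ k *\<^sub>R Dn k f (x + c * y)", OF _ this]
  show "smooth (\<lambda>y. f (x + c * y))" "Dn k (\<lambda>y. f (x + c * y)) = (\<lambda>y. c ^ k *\<^sub>R Dn k f (x + c * y))"
    by simp_all
qed

section \<open>Square-integrable functions\<close>

text \<open>Membership and value of \<open>L2_norm\<close> are separated so that estimates take
  place in real arithmetic. Since a Bochner integral defaults to 0, the number \<open>l2 f\<close>
  carries information only together with this predicate.\<close>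

definition square_integrable :: "(real \<Rightarrow> 'a::{banach, second_countable_topology}) \<Rightarrow> bool" where
  "square_integrable f \<longleftrightarrow>
     f \<in> borel_measurable lborel \<and> integrable lborel (\<lambda>x. (norm (f x))\<^sup>2)"

definition l2 :: "(real \<Rightarrow> 'a::{banach, second_countable_topology}) \<Rightarrow> real" where
  "l2 f = sqrt (LINT x|lborel. (norm (f x))\<^sup>2)"

lemma l2_nonneg [simp]: "0 \<le> l2 f"
  by (simp add: l2_def)

lemma l2_power2: "(l2 f)\<^sup>2 = (LINT x|lborel. (norm (f x))\<^sup>2)"
  by (simp add: l2_def)

lemma square_integrable_measurable [measurable_dest]:
  "square_integrable f \<Longrightarrow> f \<in> borel_measurable borel"
  by (simp add: square_integrable_def)

lemma
  assumes "square_integrable g" "f \<in> borel_measurable borel" "0 \<le> c"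
    and "\<And>x. norm (f x) \<le> c * norm (g x)"
  shows square_integrable_mono: "square_integrable f" and l2_mono: "l2 f \<le> c * l2 g"
proof -
  have le: "(norm (f x))\<^sup>2 \<le> c\<^sup>2 * (norm (g x))\<^sup>2" for x
    using power_mono[OF assms(4), of x 2] by (simp add: power_mult_distrib)
  have g: "integrable lborel (\<lambda>x. c\<^sup>2 * (norm (g x))\<^sup>2)"
    using assms(1) by (simp add: square_integrable_def)
  have f: "integrable lborel (\<lambda>x. (norm (f x))\<^sup>2)"
    by (rule Bochner_Integration.integrable_bound[OF g]) (use assms(2) le in \<open>auto intro: order_trans\<close>)
  then show "square_integrable f" using assms(2) by (simp add: square_integrable_def)
  have "(l2 f)\<^sup>2 \<le> (LINT x|lborel. c\<^sup>2 * (norm (g x))\<^sup>2)"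
    unfolding l2_power2 using f g le by (intro integral_mono)
  also have "\<dots> = (c * l2 g)\<^sup>2" by (simp add: power_mult_distrib l2_power2)
  finally show "l2 f \<le> c * l2 g" by (rule power2_le_imp_le) (simp add: assms(3))
qed

text \<open>The quadratic polynomial s \<mapsto> \<integral> (s |f| - |g|)^2 is nonnegative, and its
  values at suitable points give the discriminant inequality.\<close>

lemma
  fixes f :: "real \<Rightarrow> 'a::{banach, second_countable_topology}"
    and g :: "real \<Rightarrow> 'b::{banach, second_countable_topology}"
  assumes f: "square_integrable f" and g: "square_integrable g"
  shows integrable_norm_mult: "integrable lborel (\<lambda>x. norm (f x) * norm (g x))"
    and Cauchy_Schwarz_integral: "(LINT x|lborel. norm (f x) * norm (g x)) \<le> l2 f * l2 g"
proof -
  have [measurable]: "f \<in> borel_measurable borel" "g \<in> borel_measurable borel"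
    using f g by (auto simp: square_integrable_def)
  have ff: "integrable lborel (\<lambda>x. (norm (f x))\<^sup>2)" and gg: "integrable lborel (\<lambda>x. (norm (g x))\<^sup>2)"
    using f g by (auto simp: square_integrable_def)
  show fg: "integrable lborel (\<lambda>x. norm (f x) * norm (g x))"
  proof (rule Bochner_Integration.integrable_bound[OF Bochner_Integration.integrable_add[OF ff gg]])
    have "norm (f x) * norm (g x) \<le> (norm (f x))\<^sup>2 + (norm (g x))\<^sup>2" for x
    proof -
      have "0 \<le> norm (f x) * norm (g x)" by simp
      then show ?thesis using sum_squares_bound[of "norm (f x)" "norm (g x)"] by linarith
    qed
    then show "AE x in lborel. norm (norm (f x) * norm (g x)) \<le> norm ((norm (f x))\<^sup>2 + (norm (g x))\<^sup>2)"
      by (simp add: abs_mult)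
  qed auto
  define I where "I = (LINT x|lborel. norm (f x) * norm (g x))"
  have I0: "0 \<le> I" by (simp add: I_def)
  have quad: "0 \<le> (l2 f)\<^sup>2 * s\<^sup>2 - 2 * I * s + (l2 g)\<^sup>2" for s
  proof -
    have "0 \<le> (LINT x|lborel. (s * norm (f x) - norm (g x))\<^sup>2)" by simp
    also have "(LINT x|lborel. (s * norm (f x) - norm (g x))\<^sup>2) =
      (LINT x|lborel. s\<^sup>2 * (norm (f x))\<^sup>2 - 2 * s * (norm (f x) * norm (g x)) + (norm (g x))\<^sup>2)"
      by (simp add: power2_diff power_mult_distrib algebra_simps)
    also have "\<dots> = s\<^sup>2 * (l2 f)\<^sup>2 - 2 * s * I + (l2 g)\<^sup>2"
      using ff gg fg by (simp add: l2_power2 I_def)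
    finally show ?thesis by (simp add: algebra_simps)
  qed
  have "I\<^sup>2 \<le> (l2 f * l2 g)\<^sup>2"
  proof (cases "l2 f = 0")
    case True
    have "I = 0"
    proof (rule ccontr)
      assume "I \<noteq> 0"
      \<comment> \<open>For \<open>l2 f = 0\<close> the polynomial is affine, and at this point it
        would equal -1.\<close>
      with quad[of "((l2 g)\<^sup>2 + 1) / (2 * I)"] True show False by simp
    qed
    then show ?thesis by simp
  next
    case False
    \<comment> \<open>\<open>I / (l2 f)\<^sup>2\<close> is the minimizer of the quadratic.\<close>
    have "(l2 f)\<^sup>2 * (I / (l2 f)\<^sup>2)\<^sup>2 = I\<^sup>2 / (l2 f)\<^sup>2"
      using False by (simp add: power2_eq_square)
    then have "I\<^sup>2 / (l2 f)\<^sup>2 \<le> (l2 g)\<^sup>2"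
      using quad[of "I / (l2 f)\<^sup>2"] by (simp add: power2_eq_square)
    then show ?thesis
      using False by (simp add: pos_divide_le_eq power_mult_distrib mult.commute)
  qed
  then show "(LINT x|lborel. norm (f x) * norm (g x)) \<le> l2 f * l2 g"
    unfolding I_def[symmetric] by (rule power2_le_imp_le) simp
qed

lemma
  fixes f g :: "real \<Rightarrow> 'a::{banach, second_countable_topology}"
  assumes f: "square_integrable f" and g: "square_integrable g"
  shows square_integrable_add: "square_integrable (\<lambda>x. f x + g x)"
    and l2_triangle: "l2 (\<lambda>x. f x + g x) \<le> l2 f + l2 g"
proof -
  have [measurable]: "f \<in> borel_measurable borel" "g \<in> borel_measurable borel"
    using f g by (auto simp: square_integrable_def)
  have ff: "integrable lborel (\<lambda>x. (norm (f x))\<^sup>2)" and gg: "integrable lborel (\<lambda>x. (norm (g x))\<^sup>2)"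
    using f g by (auto simp: square_integrable_def)
  let ?b = "\<lambda>x. (norm (f x))\<^sup>2 + 2 * (norm (f x) * norm (g x)) + (norm (g x))\<^sup>2"
  have b: "integrable lborel ?b"
    using ff gg integrable_norm_mult[OF f g] by simp
  have le: "(norm (f x + g x))\<^sup>2 \<le> ?b x" for x
    using power_mono[OF norm_triangle_ineq[of "f x" "g x"], of 2] by (simp add: power2_sum algebra_simps)
  have fg: "integrable lborel (\<lambda>x. (norm (f x + g x))\<^sup>2)"
    by (rule Bochner_Integration.integrable_bound[OF b]) (use le in \<open>auto intro: order_trans\<close>)
  then show "square_integrable (\<lambda>x. f x + g x)" by (simp add: square_integrable_def)
  have "(l2 (\<lambda>x. f x + g x))\<^sup>2 \<le> (LINT x|lborel. ?b x)"
    unfolding l2_power2 using fg b le by (intro integral_mono)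
  also have "\<dots> = (l2 f)\<^sup>2 + 2 * (LINT x|lborel. norm (f x) * norm (g x)) + (l2 g)\<^sup>2"
    using ff gg integrable_norm_mult[OF f g] by (simp add: l2_power2)
  also have "\<dots> \<le> (l2 f + l2 g)\<^sup>2"
    using Cauchy_Schwarz_integral[OF f g] by (simp add: power2_sum)
  finally show "l2 (\<lambda>x. f x + g x) \<le> l2 f + l2 g" by (rule power2_le_imp_le) simp
qed

lemma
  assumes "square_integrable f"
  shows square_integrable_scaleR: "square_integrable (\<lambda>x. c *\<^sub>R f x)"
    and l2_scaleR: "l2 (\<lambda>x. c *\<^sub>R f x) = \<bar>c\<bar> * l2 f"
proof -
  show "square_integrable (\<lambda>x. c *\<^sub>R f x)"
    using assms by (auto simp: square_integrable_def power_mult_distrib)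
  have "l2 (\<lambda>x. c *\<^sub>R f x) = sqrt (c\<^sup>2 * (LINT x|lborel. (norm (f x))\<^sup>2))"
    by (simp add: l2_def power_mult_distrib)
  then show "l2 (\<lambda>x. c *\<^sub>R f x) = \<bar>c\<bar> * l2 f"
    by (simp add: l2_def real_sqrt_mult)
qed

lemma
  assumes "L2_norm f \<le> ennreal c"
  shows L2_norm_le_square_integrable: "square_integrable f"
    and L2_norm_le_l2: "0 \<le> c \<Longrightarrow> l2 f \<le> c"
  using assms by (auto simp: L2_norm_def square_integrable_def l2_def top_unique split: if_splits)

lemma L2_norm_eq: "square_integrable f \<Longrightarrow> L2_norm f = ennreal (l2 f)"
  by (auto simp: L2_norm_def square_integrable_def l2_def)

lemma L2_norm_finite: "L2_norm f < \<infinity> \<Longrightarrow> square_integrable f"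
  by (auto simp: L2_norm_def square_integrable_def split: if_splits)

section \<open>Integration of derivatives over the whole line\<close>

lemma lborel_integral_FTC:
  fixes F :: "real \<Rightarrow> 'a::euclidean_space"
  assumes "a \<le> b" "integrable lborel F'"
    and "\<And>x. (F has_vector_derivative F' x) (at x)"
  shows "(LINT x:{a..b}|lborel. F' x) = F b - F a"
proof -
  have "set_integrable lborel {a..b} F'"
    unfolding set_integrable_def using assms(2) by (intro integrable_mult_indicator) auto
  then have "(LINT x:{a..b}|lborel. F' x) = integral {a..b} F'"
    by (rule set_borel_integral_eq_integral)
  also have "\<dots> = F b - F a"
    using fundamental_theorem_of_calculus[OF assms(1), of F F'] assms(3)
    by (intro integral_unique) (auto intro: has_vector_derivative_at_within)
  finally show ?thesis .
qed

text \<open>An integrable function need not tend to 0 at infinity, but it cannot stay above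
  \<open>e\<close> on an interval of length (\<integral> |F| + 1) / e. Small values arbitrarily far
  out are enough to discard boundary terms.\<close>

lemma integrable_small_values:
  fixes F :: "real \<Rightarrow> 'a::{banach, second_countable_topology}"
  assumes F: "integrable lborel F" and "0 < e"
  shows "\<exists>x\<ge>a. norm (F x) < e" "\<exists>x\<le>a. norm (F x) < e"
proof -
  have *: False if "\<And>x. x \<in> {c..c + m} \<Longrightarrow> e \<le> norm (F x)"
    and m: "m = ((LINT x|lborel. norm (F x)) + 1) / e" for c m
  proof -
    have "0 \<le> m" unfolding m using \<open>0 < e\<close> by (intro divide_nonneg_pos add_nonneg_nonneg) auto
    have "e * m = (LINT x|lborel. e * indicator {c..c + m} x)"
      using \<open>0 \<le> m\<close> by simp
    also have "\<dots> \<le> (LINT x|lborel. norm (F x))"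
    proof (rule integral_mono)
      show "integrable lborel (\<lambda>x. e * indicator {c..c + m} x)"
        by (intro integrable_mult_right integrable_real_indicator) (auto simp: emeasure_lborel_Icc_eq)
    qed (use F that(1) in \<open>auto simp: indicator_def\<close>)
    also have "\<dots> < e * m" using \<open>0 < e\<close> by (simp add: m)
    finally show False by simp
  qed
  show "\<exists>x\<ge>a. norm (F x) < e" using *[of a] by (force simp: not_less)
  show "\<exists>x\<le>a. norm (F x) < e" using *[of "a - ((LINT x|lborel. norm (F x)) + 1) / e"] by (force simp: not_less)
qed

text \<open>Boundary terms vanish along points running to both infinities at which \<open>F\<close>
  is small, so integrability of \<open>F\<close> and \<open>F'\<close> replaces any decay
  hypothesis. The pointwise bound arises in the same way from a single far left end point.\<close>

lemma
  fixes F :: "real \<Rightarrow> 'a::euclidean_space"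
  assumes F: "integrable lborel F" and F': "integrable lborel F'"
    and deriv: "\<And>x. (F has_vector_derivative F' x) (at x)"
  shows integral_derivative_eq_0: "(LINT x|lborel. F' x) = 0"
    and norm_le_integral_derivative: "norm (F x) \<le> (LINT x|lborel. norm (F' x))"
proof -
  show "norm (F x) \<le> (LINT x|lborel. norm (F' x))"
  proof (rule field_le_epsilon)
    fix e :: real assume "0 < e"
    then obtain y where y: "y \<le> x" "norm (F y) < e" using integrable_small_values(2)[OF F] by blast
    have "norm (F x - F y) = norm (LINT u:{y..x}|lborel. F' u)"
      using lborel_integral_FTC[OF y(1) F' deriv] by simp
    also have "\<dots> \<le> (LINT u|lborel. norm (indicator {y..x} u *\<^sub>R F' u))"
      unfolding set_lebesgue_integral_def by (rule integral_norm_bound)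
    also have "\<dots> \<le> (LINT u|lborel. norm (F' u))"
    proof (rule integral_mono)
      show "integrable lborel (\<lambda>u. norm (indicator {y..x} u *\<^sub>R F' u))"
        using F' by (intro integrable_norm integrable_mult_indicator) auto
    qed (use F' in \<open>auto simp: indicator_def\<close>)
    finally show "norm (F x) \<le> (LINT x|lborel. norm (F' x)) + e"
      using y(2) norm_triangle_ineq2[of "F x" "F y"] by linarith
  qed
  have "\<forall>n. \<exists>y. y \<ge> real n \<and> norm (F y) < inverse (real (Suc n))"
    using integrable_small_values(1)[OF F] by (metis inverse_positive_iff_positive of_nat_0_less_iff zero_less_Suc)
  then obtain b where b: "\<And>n. b n \<ge> real n" "\<And>n. norm (F (b n)) < inverse (real (Suc n))" by metis
  have "\<forall>n. \<exists>y. y \<le> - real n \<and> norm (F y) < inverse (real (Suc n))"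
    using integrable_small_values(2)[OF F] by (metis inverse_positive_iff_positive of_nat_0_less_iff zero_less_Suc)
  then obtain a where a: "\<And>n. a n \<le> - real n" "\<And>n. norm (F (a n)) < inverse (real (Suc n))" by metis
  have ab: "a n \<le> b n" for n using a(1)[of n] b(1)[of n] by linarith
  have "(\<lambda>n. F (b n)) \<longlonglongrightarrow> 0"
    using b(2) by (intro Lim_null_comparison[OF _ LIMSEQ_inverse_real_of_nat]) (auto intro: less_imp_le always_eventually)
  moreover have "(\<lambda>n. F (a n)) \<longlonglongrightarrow> 0"
    using a(2) by (intro Lim_null_comparison[OF _ LIMSEQ_inverse_real_of_nat]) (auto intro: less_imp_le always_eventually)
  ultimately have "(\<lambda>n. F (b n) - F (a n)) \<longlonglongrightarrow> 0"
    using tendsto_diff[of "\<lambda>n. F (b n)" 0 sequentially "\<lambda>n. F (a n)" 0] by simp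
  \<comment> \<open>The intervals exhaust the line since \<open>a n\<close> is at most -n and
    \<open>b n\<close> at least n.\<close>
  moreover have "(\<lambda>n. LINT u|lborel. indicator {a n..b n} u *\<^sub>R F' u) \<longlonglongrightarrow> (LINT u|lborel. F' u)"
  proof (rule integral_dominated_convergence[where w = "\<lambda>u. norm (F' u)"])
    show "AE x in lborel. (\<lambda>n. indicator {a n..b n} x *\<^sub>R F' x) \<longlonglongrightarrow> F' x"
    proof (rule AE_I2, rule tendsto_eventually)
      fix x
      show "\<forall>\<^sub>F n in sequentially. indicator {a n..b n} x *\<^sub>R F' x = F' x"
        using eventually_ge_at_top[of "nat \<lceil>\<bar>x\<bar>\<rceil>"]
      proof eventually_elim
        case (elim n)
        then have "a n \<le> x" "x \<le> b n" using a(1)[of n] b(1)[of n] by linarith+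
        then show ?case by simp
      qed
    qed
  qed (use F' in \<open>auto simp: indicator_def\<close>)
  ultimately show "(LINT x|lborel. F' x) = 0"
    using lborel_integral_FTC[OF ab F' deriv] LIMSEQ_unique
    unfolding set_lebesgue_integral_def by (metis (no_types, lifting) LIMSEQ_unique ext)
qed

section \<open>Differentiation under the integral sign\<close>

lemma has_vector_derivative_iff_quotient:
  fixes f :: "real \<Rightarrow> 'a::real_normed_vector"
  shows "(f has_vector_derivative D) (at t within S) \<longleftrightarrow>
    ((\<lambda>s. (1 / (s - t)) *\<^sub>R (f s - f t)) \<longlongrightarrow> D) (at t within S)"
proof -
  have *: "norm (f s - (f t + (s - t) *\<^sub>R D)) / \<bar>s - t\<bar> =
      norm ((1 / (s - t)) *\<^sub>R (f s - f t) - D)" if "s \<noteq> t" for s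
  proof -
    have "(1 / (s - t)) *\<^sub>R (f s - f t) - D = (1 / (s - t)) *\<^sub>R (f s - (f t + (s - t) *\<^sub>R D))"
      using that by (simp add: scaleR_diff_right scaleR_add_right)
    then show ?thesis by simp
  qed
  have "(f has_vector_derivative D) (at t within S) \<longleftrightarrow>
    ((\<lambda>s. norm (f s - (f t + (s - t) *\<^sub>R D)) / \<bar>s - t\<bar>) \<longlongrightarrow> 0) (at t within S)"
    unfolding has_vector_derivative_def has_derivative_within
    by (subst tendsto_norm_zero_iff[symmetric]) (simp add: bounded_linear_scaleR_left)
  also have "\<dots> \<longleftrightarrow> ((\<lambda>s. norm ((1 / (s - t)) *\<^sub>R (f s - f t) - D)) \<longlongrightarrow> 0) (at t within S)"
    by (rule filterlim_cong) (auto simp: eventually_at_filter * intro!: always_eventually)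
  finally show ?thesis by (simp add: tendsto_norm_zero_iff LIM_zero_iff)
qed

text \<open>Dominated convergence for difference quotients, with \<open>g\<close> as majorant by the
  Lipschitz hypothesis. The form within a set \<open>S\<close> covers the end points of the time
  interval, and the almost-everywhere derivative covers the kink of the potential.\<close>

lemma has_vector_derivative_integral:
  fixes f :: "real \<Rightarrow> real \<Rightarrow> 'a::{banach, second_countable_topology}"
  assumes f: "\<And>s. s \<in> S \<Longrightarrow> integrable lborel (f s)" and "t \<in> S"
    and g: "integrable lborel g" and [measurable]: "f' \<in> borel_measurable lborel"
    and deriv: "AE y in lborel. ((\<lambda>s. f s y) has_vector_derivative f' y) (at t within S)"
    and lip: "\<And>s y. s \<in> S \<Longrightarrow> norm (f s y - f t y) \<le> \<bar>s - t\<bar> * g y"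
  shows "((\<lambda>s. LINT y|lborel. f s y) has_vector_derivative (LINT y|lborel. f' y)) (at t within S)"
  unfolding has_vector_derivative_iff_quotient tendsto_at_iff_sequentially
proof (intro allI impI)
  fix X assume X: "\<forall>i. X i \<in> S - {t}" "X \<longlonglongrightarrow> t"
  have "(\<lambda>i. LINT y|lborel. (1 / (X i - t)) *\<^sub>R (f (X i) y - f t y)) \<longlonglongrightarrow> (LINT y|lborel. f' y)"
  proof (rule integral_dominated_convergence[where w = g])
    show "AE y in lborel. (\<lambda>i. (1 / (X i - t)) *\<^sub>R (f (X i) y - f t y)) \<longlonglongrightarrow> f' y"
      using deriv
    proof eventually_elim
      case (elim y)
      then show ?case
        using X unfolding has_vector_derivative_iff_quotient tendsto_at_iff_sequentially by (simp add: o_def)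
    qed
    show "AE y in lborel. norm ((1 / (X i - t)) *\<^sub>R (f (X i) y - f t y)) \<le> g y" for i
    proof (rule AE_I2)
      fix y
      have "X i \<noteq> t" "X i \<in> S" using X(1) by auto
      then show "norm ((1 / (X i - t)) *\<^sub>R (f (X i) y - f t y)) \<le> g y"
        using lip[of "X i" y] by (simp add: divide_le_eq mult.commute)
    qed
    show "(\<lambda>y. (1 / (X i - t)) *\<^sub>R (f (X i) y - f t y)) \<in> borel_measurable lborel" for i
      using f[of "X i"] f[OF \<open>t \<in> S\<close>] X(1) by auto
  qed (use g in auto)
  moreover have "(LINT y|lborel. f (X i) y - f t y) = (LINT y|lborel. f (X i) y) - (LINT y|lborel. f t y)" for i
    using f[of "X i"] f[OF \<open>t \<in> S\<close>] X(1) by simp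
  ultimately show "((\<lambda>s. (1 / (s - t)) *\<^sub>R ((LINT y|lborel. f s y) - (LINT y|lborel. f t y))) \<circ> X)
      \<longlonglongrightarrow> (LINT y|lborel. f' y)"
    by (simp add: o_def del: real_scaleR_def)
qed

section \<open>Convolution with the potential and its derivative\<close>

text \<open>The translation moves from the kernel to \<open>g\<close>, so that derivatives in x fall
  on the smooth factor while the kernel is merely bounded and measurable.\<close>

lemma conv_alt: "conv K g x = (LINT z|lborel. K z * g (x - z))"
  unfolding conv_def by (subst lborel_integral_real_affine[where c = "-1" and t = x]) auto

lemma integrable_reflect:
  fixes g :: "real \<Rightarrow> real"
  shows "integrable lborel g \<Longrightarrow> integrable lborel (\<lambda>z. g (x - z))"
  using lborel_integrable_real_affine[of g "-1" x] by simp

lemma integral_reflect: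
  fixes g :: "real \<Rightarrow> real"
  shows "(LINT z|lborel. g (x - z)) = (LINT z|lborel. g z)"
  using lborel_integral_real_affine[of "-1" g x] by simp

section \<open>Convolution of integrable functions with a bounded kernel\<close>

context
  fixes K :: "real \<Rightarrow> real" and M :: real
  assumes K [measurable]: "K \<in> borel_measurable borel" and K_bound: "\<And>x. \<bar>K x\<bar> \<le> M"
begin

lemma kernel_bound_nonneg: "0 \<le> M"
  using K_bound[of 0] by linarith

lemma integrable_conv:
  assumes "integrable lborel g"
  shows "integrable lborel (\<lambda>z. K z * g (x - z))"
proof (rule Bochner_Integration.integrable_bound)
  show "integrable lborel (\<lambda>z. M * \<bar>g (x - z)\<bar>)"
    using integrable_reflect[OF assms, of x] by simp
  have [measurable]: "(\<lambda>z. g (x - z)) \<in> borel_measurable borel"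
    using borel_measurable_integrable[OF integrable_reflect[OF assms, of x]] by simp
  show "(\<lambda>z. K z * g (x - z)) \<in> borel_measurable lborel" by simp
  show "AE z in lborel. norm (K z * g (x - z)) \<le> norm (M * \<bar>g (x - z)\<bar>)"
    using kernel_bound_nonneg K_bound by (auto simp: abs_mult intro!: mult_right_mono)
qed

lemma integral_abs_conv_le:
  assumes "integrable lborel g"
  shows "(LINT z|lborel. \<bar>K z * g (x - z)\<bar>) \<le> M * (LINT y|lborel. \<bar>g y\<bar>)"
proof -
  have "(LINT z|lborel. \<bar>K z * g (x - z)\<bar>) \<le> (LINT z|lborel. M * \<bar>g (x - z)\<bar>)"
  proof (rule integral_mono)
    show "integrable lborel (\<lambda>z. \<bar>K z * g (x - z)\<bar>)"
      using integrable_conv[OF assms] by (rule integrable_abs)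
  qed (use integrable_reflect[OF assms, of x] K_bound in \<open>auto simp: abs_mult intro!: mult_right_mono\<close>)
  also have "\<dots> = M * (LINT y|lborel. \<bar>g y\<bar>)"
    using integral_reflect[of "\<lambda>z. \<bar>g z\<bar>" x] by simp
  finally show ?thesis .
qed

lemma conv_bound:
  assumes "integrable lborel g"
  shows "\<bar>conv K g x\<bar> \<le> M * (LINT y|lborel. \<bar>g y\<bar>)"
  unfolding conv_alt
  using order_trans[OF integral_abs_bound integral_abs_conv_le[OF assms, of x]] .

lemma conv_diff:
  assumes "integrable lborel f" "integrable lborel g"
  shows "conv K f x - conv K g x = conv K (\<lambda>y. f y - g y) x"
  unfolding conv_alt using integrable_conv[OF assms(1), of x] integrable_conv[OF assms(2), of x]
  by (simp add: right_diff_distrib)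

text \<open>Integrability of \<open>g'\<close> gives no integrable majorant for the difference
  quotients of \<open>g\<close>, so the derivative is first treated in integrated form: Fubini
  exchanges the integral over [a,b] with the convolution, and the inner integral is evaluated by the
  fundamental theorem.\<close>

lemma conv_FTC:
  assumes "a \<le> b" and g: "integrable lborel g" and g': "integrable lborel g'"
    and deriv: "\<And>x. (g has_vector_derivative g' x) (at x)"
  shows "conv K g b - conv K g a = (LINT r:{a..b}|lborel. conv K g' r)"
proof -
  have [measurable]: "g' \<in> borel_measurable borel"
    using borel_measurable_integrable[OF g'] by simp
  define f where "f = (\<lambda>r z. indicator {a..b} r * (K z * g' (r - z)))"
  have f_meas [measurable]: "(\<lambda>(r, z). f r z) \<in> borel_measurable (lborel \<Otimes>\<^sub>M lborel)"
    unfolding f_def by measurable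
  have fr: "integrable lborel (f r)" for r
    unfolding f_def using integrable_conv[OF g'] by simp
  have "integrable lborel (\<lambda>r. LINT z|lborel. norm (f r z))"
  proof (rule Bochner_Integration.integrable_bound)
    show "integrable lborel (\<lambda>r. indicator {a..b} r * (M * (LINT y|lborel. \<bar>g' y\<bar>)))"
      by (intro integrable_mult_left integrable_real_indicator) (auto simp: emeasure_lborel_Icc_eq)
    show "AE r in lborel. norm (LINT z|lborel. norm (f r z)) \<le>
        norm (indicator {a..b} r * (M * (LINT y|lborel. \<bar>g' y\<bar>)))"
    proof (rule AE_I2)
      fix r
      have "norm (LINT z|lborel. norm (f r z)) = indicator {a..b} r * (LINT z|lborel. \<bar>K z * g' (r - z)\<bar>)"
        by (simp add: f_def abs_mult)
      also have "\<dots> \<le> indicator {a..b} r * (M * (LINT y|lborel. \<bar>g' y\<bar>))"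
        by (intro mult_left_mono integral_abs_conv_le g') auto
      finally show "norm (LINT z|lborel. norm (f r z)) \<le> norm (indicator {a..b} r * (M * (LINT y|lborel. \<bar>g' y\<bar>)))"
        by simp
    qed
  qed measurable
  then have "integrable (lborel \<Otimes>\<^sub>M lborel) (\<lambda>(r, z). f r z)"
    using fr by (intro lborel_pair.Fubini_integrable) auto
  from lborel_pair.Fubini_integral[OF this]
  have "(LINT r|lborel. LINT z|lborel. f r z) = (LINT z|lborel. LINT r|lborel. f r z)" by simp
  moreover have "(LINT z|lborel. f r z) = indicator {a..b} r *\<^sub>R conv K g' r" for r
    by (simp add: f_def conv_alt)
  moreover have "(LINT r|lborel. f r z) = K z * g (b - z) - K z * g (a - z)" for z
  proof -
    have "((\<lambda>r. g (r - z)) has_vector_derivative g' (r - z)) (at r)" for r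
    proof -
      have "((\<lambda>r. r - z) has_vector_derivative 1) (at r)"
        by (auto intro!: derivative_eq_intros)
      from vector_diff_chain_at[OF this deriv] show ?thesis by (simp add: o_def)
    qed
    moreover have "integrable lborel (\<lambda>r. g' (r - z))"
      using lborel_integrable_real_affine[OF g', of 1 "-z"] by simp
    ultimately have "(LINT r:{a..b}|lborel. g' (r - z)) = g (b - z) - g (a - z)"
      using lborel_integral_FTC[OF \<open>a \<le> b\<close>, of "\<lambda>r. g' (r - z)" "\<lambda>r. g (r - z)"] by simp
    moreover have "(LINT r|lborel. f r z) = K z * (LINT r:{a..b}|lborel. g' (r - z))"
      by (simp add: f_def set_lebesgue_integral_def mult.left_commute)
    ultimately show ?thesis by (simp add: right_diff_distrib)
  qed
  ultimately have "(LINT r:{a..b}|lborel. conv K g' r) = (LINT z|lborel. K z * g (b - z) - K z * g (a - z))"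
    by (simp add: set_lebesgue_integral_def)
  then show ?thesis
    unfolding conv_alt using integrable_conv[OF g, of b] integrable_conv[OF g, of a] by simp
qed

lemma conv_lipschitz:
  assumes "integrable lborel g" "integrable lborel g'"
    and "\<And>x. (g has_vector_derivative g' x) (at x)"
  shows "\<bar>conv K g b - conv K g a\<bar> \<le> M * (LINT y|lborel. \<bar>g' y\<bar>) * \<bar>b - a\<bar>"
proof -
  let ?C = "M * (LINT y|lborel. \<bar>g' y\<bar>)"
  have *: "\<bar>conv K g b - conv K g a\<bar> \<le> ?C * (b - a)" if "a \<le> b" for a b
  proof -
    have "\<bar>LINT r:{a..b}|lborel. conv K g' r\<bar> \<le> (LINT r|lborel. \<bar>indicator {a..b} r *\<^sub>R conv K g' r\<bar>)"
      unfolding set_lebesgue_integral_def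
      using integral_norm_bound[of lborel "\<lambda>r. indicator {a..b} r *\<^sub>R conv K g' r"] by simp
    also have "\<dots> \<le> (LINT r|lborel. indicator {a..b} r * ?C)"
    proof (rule integral_mono')
      show "integrable lborel (\<lambda>r. indicator {a..b} r * ?C)"
        by (intro integrable_mult_left integrable_real_indicator) (auto simp: emeasure_lborel_Icc_eq)
    qed (use conv_bound[OF assms(2)] kernel_bound_nonneg in \<open>auto simp: indicator_def\<close>)
    also have "\<dots> = ?C * (b - a)" using that by simp
    finally show ?thesis using conv_FTC[OF that assms] by simp
  qed
  show ?thesis
  proof (cases "a \<le> b")
    case False
    then show ?thesis using *[of b a] by (simp add: abs_minus_commute)
  qed (use * in simp)
qed

text \<open>Differentiating the integrated identity requires continuity of \<open>conv K g'\<close>.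
  It is Lipschitz because the next derivative \<open>g''\<close> is integrable.\<close>

lemma conv_has_vector_derivative:
  assumes g: "integrable lborel g" and g': "integrable lborel g'" and g'': "integrable lborel g''"
    and d: "\<And>x. (g has_vector_derivative g' x) (at x)"
    and d': "\<And>x. (g' has_vector_derivative g'' x) (at x)"
  shows "(conv K g has_vector_derivative conv K g' x) (at x)"
proof -
  have "(M * (LINT y|lborel. \<bar>g'' y\<bar>))-lipschitz_on UNIV (conv K g')"
    using conv_lipschitz[OF g' g'' d'] kernel_bound_nonneg
    by (intro lipschitz_onI) (auto simp: dist_real_def)
  then have cont: "continuous_on S (conv K g')" for S
    using lipschitz_on_continuous_on continuous_on_subset by blast
  let ?I = "{x - 1..x + 1}"
  have int: "((\<lambda>u. integral {x - 1..u} (conv K g')) has_vector_derivative conv K g' x) (at x within ?I)"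
    by (rule integral_has_vector_derivative[OF cont]) auto
  have eq: "integral {x - 1..u} (conv K g') = conv K g u - conv K g (x - 1)" if "u \<in> ?I" for u
  proof -
    have "set_integrable lborel {x - 1..u} (conv K g')"
      by (rule borel_integrable_atLeastAtMost'[OF cont])
    from set_borel_integral_eq_integral(2)[OF this] show ?thesis
      using conv_FTC[OF _ g g' d, of "x - 1" u] that by simp
  qed
  have "((\<lambda>u. conv K g u - conv K g (x - 1)) has_vector_derivative conv K g' x) (at x within ?I)"
    by (rule has_vector_derivative_transform[OF _ eq[symmetric] int]) auto
  then have "((\<lambda>u. conv K g u - conv K g (x - 1)) has_vector_derivative conv K g' x) (at x)"
    by (simp add: at_within_Icc_at)
  from has_vector_derivative_add_const[THEN iffD2, OF this, of "conv K g (x - 1)"]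
  show ?thesis by simp
qed

lemma
  assumes "smooth g" and "\<And>k. integrable lborel (Dn k g)"
  shows smooth_conv: "smooth (conv K g)" and Dn_conv: "Dn k (conv K g) = conv K (Dn k g)"
proof -
  have "(conv K (Dn k g) has_vector_derivative conv K (Dn (Suc k) g) x) (at x)" for k x
    using assms by (intro conv_has_vector_derivative[where g'' = "Dn (Suc (Suc k)) g"]) (auto intro: smooth_deriv)
  from smooth_iterates[where F = "\<lambda>k. conv K (Dn k g)", OF _ this]
  show "smooth (conv K g)" "Dn k (conv K g) = conv K (Dn k g)" by simp_all
qed

end

text \<open>Equal to \<open>deriv (V \<kappa> \<epsilon>)\<close> away from \<open>0\<close>, and, since \<open>sgn 0 = 0\<close>, bounded at \<open>0\<close> as well.\<close>

definition V' :: "real \<Rightarrow> real \<Rightarrow> real \<Rightarrow> real" where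
  "V' \<kappa> \<epsilon> x = \<kappa> * (1/2) * sgn x * (1 - \<epsilon> * \<bar>x\<bar>) * exp (- \<epsilon> * \<bar>x\<bar>)"

lemma V_measurable [measurable]: "V \<kappa> \<epsilon> \<in> borel_measurable borel"
  unfolding V_def by measurable

lemma V'_measurable [measurable]: "V' \<kappa> \<epsilon> \<in> borel_measurable borel"
  unfolding V'_def sgn_real_def by measurable

section \<open>The screened one-dimensional Coulomb potential and its field kernel\<close>

context
  fixes \<kappa> \<epsilon> :: real
  assumes kappa: "\<kappa> = 1 \<or> \<kappa> = -1" and eps: "0 < \<epsilon>"
begin

text \<open>From s exp(-s) \<le> 1 with s = \<epsilon> |x|. The bound degenerates as \<epsilon>
  tends to 0, so it enters only statements for fixed parameters.\<close>

lemma V_bound: "\<bar>V \<kappa> \<epsilon> x\<bar> \<le> 1 / \<epsilon>"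
proof -
  have "\<epsilon> * \<bar>x\<bar> \<le> exp (\<epsilon> * \<bar>x\<bar>)" using exp_ge_add_one_self[of "\<epsilon> * \<bar>x\<bar>"] by linarith
  then have "\<epsilon> * \<bar>x\<bar> * exp (- (\<epsilon> * \<bar>x\<bar>)) \<le> 1"
    by (simp add: exp_minus field_simps)
  then have "\<bar>x\<bar> * exp (- (\<epsilon> * \<bar>x\<bar>)) \<le> 1 / \<epsilon>" using eps by (simp add: field_simps)
  moreover have "\<bar>V \<kappa> \<epsilon> x\<bar> = \<bar>x\<bar> * exp (- (\<epsilon> * \<bar>x\<bar>)) / 2" using kappa by (auto simp: V_def abs_mult)
  moreover have "0 \<le> \<bar>x\<bar> * exp (- (\<epsilon> * \<bar>x\<bar>))" by simp
  ultimately show ?thesis by linarith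
qed

lemma abs_one_minus_mult_exp: "0 \<le> s \<Longrightarrow> \<bar>(1 - s) * exp (- s)\<bar> \<le> (1::real)"
proof -
  assume "0 \<le> s"
  then have "\<bar>1 - s\<bar> \<le> exp s" using exp_ge_add_one_self[of s] by linarith
  then show ?thesis by (simp add: abs_mult exp_minus field_simps)
qed

text \<open>Apart from the sign, \<open>V'\<close> depends on x and \<epsilon> only through s =
  \<epsilon> |x|, and |1 - s| \<le> 1 + s \<le> exp s. This is the source of all uniformity in
  \<epsilon>.\<close>

lemma V'_bound: "\<bar>V' \<kappa> \<epsilon> x\<bar> \<le> 1"
proof -
  have "\<bar>V' \<kappa> \<epsilon> x\<bar> = \<bar>sgn x\<bar> * \<bar>(1 - \<epsilon> * \<bar>x\<bar>) * exp (- (\<epsilon> * \<bar>x\<bar>))\<bar> / 2"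
    using kappa by (auto simp: V'_def abs_mult)
  also have "\<dots> \<le> 1 * 1 / 2"
    using eps abs_one_minus_mult_exp[of "\<epsilon> * \<bar>x\<bar>"]
    by (intro divide_right_mono mult_mono) (auto simp: sgn_real_def)
  finally show ?thesis by simp
qed

lemma V_has_derivative: "x \<noteq> 0 \<Longrightarrow> (V \<kappa> \<epsilon> has_real_derivative V' \<kappa> \<epsilon> x) (at x)"
proof -
  assume "x \<noteq> 0"
  then have abs: "((\<lambda>x. \<bar>x\<bar>) has_real_derivative sgn x) (at x)"
  proof (cases "x > 0")
    case True
    show ?thesis
      by (rule has_field_derivative_transform_within_open[where f = "\<lambda>x. x" and S = "{0<..}"])
        (use True in \<open>auto intro!: derivative_eq_intros\<close>)
  next
    case False
    show ?thesis
      by (rule has_field_derivative_transform_within_open[where f = "\<lambda>x. - x" and S = "{..<0}"])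
        (use False \<open>x \<noteq> 0\<close> in \<open>auto intro!: derivative_eq_intros\<close>)
  qed
  have "((\<lambda>x. exp (- \<epsilon> * \<bar>x\<bar>)) has_real_derivative exp (- \<epsilon> * \<bar>x\<bar>) * (- \<epsilon> * sgn x)) (at x)"
    by (intro DERIV_fun_exp DERIV_cmult abs)
  from DERIV_mult[OF DERIV_cmult[OF abs, of "\<kappa> * (1/2)"] this] show ?thesis
    by (simp add: V_def[abs_def] V'_def algebra_simps diff_divide_distrib)
qed

lemma conv_deriv_V:
  assumes [measurable]: "g \<in> borel_measurable borel"
  shows "conv (deriv (V \<kappa> \<epsilon>)) g = conv (V' \<kappa> \<epsilon>) g"
proof
  fix x
  \<comment> \<open>Whatever value \<open>deriv\<close> takes at 0, changing a measurable function
    at one point keeps it measurable.\<close>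
  have "deriv (V \<kappa> \<epsilon>) = (\<lambda>z. if z = 0 then deriv (V \<kappa> \<epsilon>) 0 else V' \<kappa> \<epsilon> z)"
    using DERIV_imp_deriv[OF V_has_derivative] by auto
  moreover have "\<dots> \<in> borel_measurable borel" by measurable
  ultimately have [measurable]: "deriv (V \<kappa> \<epsilon>) \<in> borel_measurable borel" by simp
  have "AE y in lborel. (y::real) \<noteq> x" by (rule AE_lborel_singleton)
  then have "AE y in lborel. deriv (V \<kappa> \<epsilon>) (x - y) * g y = V' \<kappa> \<epsilon> (x - y) * g y"
  proof eventually_elim
    case (elim y)
    then show ?case using DERIV_imp_deriv[OF V_has_derivative, of "x - y"] by simp
  qed
  then show "conv (deriv (V \<kappa> \<epsilon>)) g x = conv (V' \<kappa> \<epsilon>) g x"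
    unfolding conv_def by (intro integral_cong_AE) auto
qed

text \<open>The mean value bound is applied to the profile r exp(-\<epsilon> r) on the closed half
  line, where it is smooth; the reverse triangle inequality for |a| and |b| takes care of the
  kink.\<close>

lemma V_lipschitz: "\<bar>V \<kappa> \<epsilon> a - V \<kappa> \<epsilon> b\<bar> \<le> \<bar>a - b\<bar>"
proof -
  define m where "m = (\<lambda>r. r * exp (- \<epsilon> * r))"
  have "norm (m r - m s) \<le> 1 * norm (r - s)" if "r \<in> {0..}" "s \<in> {0..}" for r s
  proof (rule field_differentiable_bound[where S = "{0..}" and f' = "\<lambda>r. (1 - \<epsilon> * r) * exp (- (\<epsilon> * r))"])
    fix z :: real assume "z \<in> {0..}"
    show "(m has_field_derivative (1 - \<epsilon> * z) * exp (- (\<epsilon> * z))) (at z within {0..})"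
      unfolding m_def by (auto intro!: derivative_eq_intros simp: algebra_simps)
    show "norm ((1 - \<epsilon> * z) * exp (- (\<epsilon> * z))) \<le> 1"
      using abs_one_minus_mult_exp[of "\<epsilon> * z"] \<open>z \<in> {0..}\<close> eps by simp
  qed (use that in auto)
  from this[of "\<bar>a\<bar>" "\<bar>b\<bar>"] have *: "\<bar>m \<bar>a\<bar> - m \<bar>b\<bar>\<bar> \<le> \<bar>a - b\<bar>"
    using abs_triangle_ineq3[of a b] by simp
  have "V \<kappa> \<epsilon> a - V \<kappa> \<epsilon> b = \<kappa> * (1/2) * (m \<bar>a\<bar> - m \<bar>b\<bar>)"
    by (simp add: V_def m_def algebra_simps)
  then have "\<bar>V \<kappa> \<epsilon> a - V \<kappa> \<epsilon> b\<bar> = \<bar>\<kappa> * (1/2) * (m \<bar>a\<bar> - m \<bar>b\<bar>)\<bar>"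
    by (rule arg_cong)
  also have "\<dots> = \<bar>m \<bar>a\<bar> - m \<bar>b\<bar>\<bar> / 2"
    using kappa by (auto simp: abs_mult)
  finally have "\<bar>V \<kappa> \<epsilon> a - V \<kappa> \<epsilon> b\<bar> = \<bar>m \<bar>a\<bar> - m \<bar>b\<bar>\<bar> / 2" .
  with * show ?thesis using abs_ge_zero[of "m \<bar>a\<bar> - m \<bar>b\<bar>"] by linarith
qed

text \<open>Here the derivative has to fall on the kernel: this replaces \<open>V\<close>, which has
  no uniform bound, by \<open>V'\<close>, and it leaves the order of differentiation of
  \<open>g\<close> unchanged. The Lipschitz bound of \<open>V\<close> provides the majorant |g|, and
  for fixed x the derivative fails at most at y = x.\<close>

lemma conv_V_has_derivative:
  assumes "integrable lborel g"
  shows "(conv (V \<kappa> \<epsilon>) g has_vector_derivative conv (V' \<kappa> \<epsilon>) g x) (at x)"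
proof -
  have [measurable]: "g \<in> borel_measurable borel"
    using borel_measurable_integrable[OF assms] by simp
  have "((\<lambda>s. LINT y|lborel. V \<kappa> \<epsilon> (s - y) * g y) has_vector_derivative
      (LINT y|lborel. V' \<kappa> \<epsilon> (x - y) * g y)) (at x)"
  proof (rule has_vector_derivative_integral[where g = "\<lambda>y. \<bar>g y\<bar>"])
    show "integrable lborel (\<lambda>y. V \<kappa> \<epsilon> (s - y) * g y)" for s
      using integrable_reflect[OF integrable_conv[OF V_measurable V_bound assms, of s], of s] by simp
    have "AE y in lborel. y \<noteq> x" by (rule AE_lborel_singleton)
    then show "AE y in lborel. ((\<lambda>s. V \<kappa> \<epsilon> (s - y) * g y) has_vector_derivative V' \<kappa> \<epsilon> (x - y) * g y) (at x)"
    proof eventually_elim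
      case (elim y)
      then have "((\<lambda>s. V \<kappa> \<epsilon> (s - y)) has_real_derivative V' \<kappa> \<epsilon> (x - y)) (at x)"
        using DERIV_shift[of "V \<kappa> \<epsilon>" _ x "-y"] V_has_derivative[of "x - y"] by simp
      then show ?case
        by (auto intro!: derivative_eq_intros simp: has_real_derivative_iff_has_vector_derivative[symmetric])
    qed
    show "norm (V \<kappa> \<epsilon> (s - y) * g y - V \<kappa> \<epsilon> (x - y) * g y) \<le> \<bar>s - x\<bar> * \<bar>g y\<bar>" for s y
      using mult_right_mono[OF V_lipschitz[of "s - y" "x - y"], of "\<bar>g y\<bar>"]
      by (simp add: abs_mult[symmetric] left_diff_distrib)
  qed (use assms in auto)
  then show ?thesis by (simp add: conv_def[abs_def])
qed

text \<open>The first derivative goes to the kernel and all later ones to \<open>g\<close>. The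
  resulting gain of one order on \<open>g\<close> is what offsets the factor 1/h of the
  equation.\<close>

lemma
  assumes g: "smooth g" "\<And>k. integrable lborel (Dn k g)"
  shows smooth_conv_V: "smooth (conv (V \<kappa> \<epsilon>) g)"
    and Dn_Suc_conv_V: "Dn (Suc k) (conv (V \<kappa> \<epsilon>) g) = conv (V' \<kappa> \<epsilon>) (Dn k g)"
proof -
  let ?F = "\<lambda>k. case k of 0 \<Rightarrow> conv (V \<kappa> \<epsilon>) g | Suc j \<Rightarrow> conv (V' \<kappa> \<epsilon>) (Dn j g)"
  have "(?F k has_vector_derivative ?F (Suc k) x) (at x)" for k x
  proof (cases k)
    case 0
    then show ?thesis using conv_V_has_derivative[of g x] g(2)[of 0] by simp
  next
    case (Suc j)
    have "(Dn j (conv (V' \<kappa> \<epsilon>) g) has_vector_derivative Dn (Suc j) (conv (V' \<kappa> \<epsilon>) g) x) (at x)"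
      by (intro smooth_deriv smooth_conv[OF V'_measurable V'_bound] g)
    then show ?thesis using Suc by (simp add: Dn_conv[OF V'_measurable V'_bound g])
  qed
  from smooth_iterates[where F = ?F, OF _ this]
  show "smooth (conv (V \<kappa> \<epsilon>) g)" "Dn (Suc k) (conv (V \<kappa> \<epsilon>) g) = conv (V' \<kappa> \<epsilon>) (Dn k g)"
    by (simp_all del: Dn_0)
qed

end

section \<open>Sobolev functions and their densities\<close>

lemma
  fixes f g :: "real \<Rightarrow> complex"
  assumes f: "square_integrable f" and g: "square_integrable g"
  shows integrable_mult_square_integrable: "integrable lborel (\<lambda>x. f x * g x)"
    and integral_norm_mult_le: "(LINT x|lborel. norm (f x * g x)) \<le> l2 f * l2 g"
proof -
  have [measurable]: "f \<in> borel_measurable borel" "g \<in> borel_measurable borel"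
    using f g by (auto simp: square_integrable_def)
  show "integrable lborel (\<lambda>x. f x * g x)"
    by (rule Bochner_Integration.integrable_bound[OF integrable_norm_mult[OF f g]]) (auto simp: norm_mult)
  show "(LINT x|lborel. norm (f x * g x)) \<le> l2 f * l2 g"
    using Cauchy_Schwarz_integral[OF f g] by (simp add: norm_mult)
qed

lemma square_integrable_cnj [simp]:
  assumes "square_integrable f" shows "square_integrable (\<lambda>x. cnj (f x))"
proof -
  have [measurable]: "f \<in> borel_measurable borel" using assms by (simp add: square_integrable_def)
  have "(\<lambda>x. cnj (f x)) \<in> borel_measurable borel"
    by (rule borel_measurable_continuous_on[OF continuous_on_cnj[OF continuous_on_id]]) simp
  then show ?thesis using assms by (simp add: square_integrable_def)
qed

lemma l2_cnj [simp]: "l2 (\<lambda>x. cnj (f x)) = l2 f"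
  by (simp add: l2_def)

lemma square_integrable_diff:
  fixes f :: "real \<Rightarrow> 'a::{banach, second_countable_topology}"
  assumes "square_integrable f" "square_integrable g"
  shows "square_integrable (\<lambda>x. f x - g x)"
  using square_integrable_add[OF assms(1) square_integrable_scaleR[OF assms(2), of "-1"]] by simp

lemma l2_minus_commute: "l2 (\<lambda>x. f x - g x) = l2 (\<lambda>x. g x - f x)"
  by (simp add: l2_def norm_minus_commute)

lemma l2_abs_diff_le:
  fixes f g :: "real \<Rightarrow> 'a::{banach, second_countable_topology}"
  assumes f: "square_integrable f" and g: "square_integrable g"
  shows "\<bar>l2 f - l2 g\<bar> \<le> l2 (\<lambda>x. f x - g x)"
  using l2_triangle[OF square_integrable_diff[OF f g] g] l2_triangle[OF square_integrable_diff[OF g f] f]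
    l2_minus_commute[of f g] by simp

definition H_infinity :: "(real \<Rightarrow> complex) \<Rightarrow> bool" where
  "H_infinity f \<longleftrightarrow> smooth f \<and> (\<forall>k. square_integrable (Dn k f))"

lemma H_infinity_smooth: "H_infinity f \<Longrightarrow> smooth f"
  by (simp add: H_infinity_def)

lemma H_infinity_square_integrable: "H_infinity f \<Longrightarrow> square_integrable (Dn k f)"
  by (simp add: H_infinity_def)

lemma has_vector_derivative_cnj':
  "(f has_vector_derivative f') F \<Longrightarrow> ((\<lambda>x. cnj (f x)) has_vector_derivative cnj f') F"
  by (rule bounded_linear.has_vector_derivative[OF bounded_linear_cnj])

text \<open>An Agmon inequality, from integrating the derivative of f times its conjugate and
  applying Cauchy-Schwarz. It turns \<open>L\<^sup>2\<close> control of consecutive derivatives into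
  uniform control.\<close>

lemma sup_norm_le:
  fixes f :: "real \<Rightarrow> complex"
  assumes f: "square_integrable f" and f': "square_integrable f'"
    and deriv: "\<And>x. (f has_vector_derivative f' x) (at x)"
  shows "(norm (f x))\<^sup>2 \<le> 2 * (l2 f * l2 f')"
proof -
  let ?F = "\<lambda>x. f x * cnj (f x)" and ?F' = "\<lambda>x. f x * cnj (f' x) + f' x * cnj (f x)"
  have F': "integrable lborel (\<lambda>x. f x * cnj (f' x))" "integrable lborel (\<lambda>x. f' x * cnj (f x))"
    using f f' by (auto intro!: integrable_mult_square_integrable)
  have "norm (?F x) \<le> (LINT x|lborel. norm (?F' x))"
    using f F' by (intro norm_le_integral_derivative)
      (auto intro!: integrable_mult_square_integrable has_vector_derivative_mult has_vector_derivative_cnj' deriv)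
  also have "\<dots> \<le> (LINT x|lborel. norm (f x * cnj (f' x)) + norm (f' x * cnj (f x)))"
    using F' by (intro integral_mono Bochner_Integration.integrable_add integrable_norm norm_triangle_ineq) auto
  also have "\<dots> = (LINT x|lborel. norm (f x * cnj (f' x))) + (LINT x|lborel. norm (f' x * cnj (f x)))"
    using F' by (intro Bochner_Integration.integral_add integrable_norm)
  also have "\<dots> \<le> l2 f * l2 f' + l2 f' * l2 f"
    using integral_norm_mult_le[OF f square_integrable_cnj[OF f']] integral_norm_mult_le[OF f' square_integrable_cnj[OF f]]
    unfolding l2_cnj by (rule add_mono)
  also have "\<dots> = 2 * (l2 f * l2 f')" by (simp add: mult.commute)
  finally show ?thesis by (simp add: norm_mult power2_eq_square)
qed

lemma
  assumes "smooth f"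
  shows smooth_density: "smooth (density_of f)"
    and Dn_density: "Dn k (density_of f) x = Re (\<Sum>j\<le>k. real (k choose j) *\<^sub>R (Dn j f x * cnj (Dn (k - j) f x)))"
proof -
  have eq: "density_of f = (\<lambda>x. Re (f x * cnj (f x)))"
    by (simp add: density_of_def fun_eq_iff complex_norm_square[symmetric])
  note c = smooth_cnj[OF assms]
  have m: "smooth (\<lambda>x. f x * cnj (f x))"
    by (rule smooth_mult[OF assms c(1)])
  show "smooth (density_of f)"
    unfolding eq by (rule smooth_bounded_linear[OF bounded_linear_Re m])
  show "Dn k (density_of f) x = Re (\<Sum>j\<le>k. real (k choose j) *\<^sub>R (Dn j f x * cnj (Dn (k - j) f x)))"
    unfolding eq Dn_bounded_linear[OF bounded_linear_Re m] Dn_mult[OF assms c(1)] c(2) ..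
qed

lemma
  assumes "H_infinity f"
  shows integrable_Dn_density: "integrable lborel (Dn k (density_of f))"
    and integral_Dn_density_le: "(LINT x|lborel. \<bar>Dn k (density_of f) x\<bar>) \<le>
      (\<Sum>j\<le>k. real (k choose j) * (l2 (Dn j f) * l2 (Dn (k - j) f)))"
proof -
  note sm = H_infinity_smooth[OF assms] and sq = H_infinity_square_integrable[OF assms]
  have int: "integrable lborel (\<lambda>x. Dn j f x * cnj (Dn (k - j) f x))" for j
    by (intro integrable_mult_square_integrable square_integrable_cnj sq)
  show i: "integrable lborel (Dn k (density_of f))"
    unfolding Dn_density[OF sm] by (intro integrable_Re Bochner_Integration.integrable_sum integrable_scaleR_right int)
  have "(LINT x|lborel. \<bar>Dn k (density_of f) x\<bar>) \<le>
      (LINT x|lborel. (\<Sum>j\<le>k. real (k choose j) * norm (Dn j f x * cnj (Dn (k - j) f x))))"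
  proof (rule integral_mono)
    show "\<bar>Dn k (density_of f) x\<bar> \<le> (\<Sum>j\<le>k. real (k choose j) * norm (Dn j f x * cnj (Dn (k - j) f x)))" for x
      unfolding Dn_density[OF sm]
      by (rule order_trans[OF abs_Re_le_cmod sum_norm_le]) simp
    show "integrable lborel (\<lambda>x. \<Sum>j\<le>k. real (k choose j) * norm (Dn j f x * cnj (Dn (k - j) f x)))"
      by (intro Bochner_Integration.integrable_sum integrable_mult_right integrable_norm int)
  qed (rule integrable_abs[OF i])
  also have "\<dots> = (\<Sum>j\<le>k. real (k choose j) * (LINT x|lborel. norm (Dn j f x * cnj (Dn (k - j) f x))))"
    using Bochner_Integration.integral_sum[of "{..k}" lborel
        "\<lambda>j x. real (k choose j) * norm (Dn j f x * cnj (Dn (k - j) f x))"] integrable_norm[OF int]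
    by (simp only: integral_mult_right_zero integrable_mult_right)
  also have "\<dots> \<le> (\<Sum>j\<le>k. real (k choose j) * (l2 (Dn j f) * l2 (Dn (k - j) f)))"
    using integral_norm_mult_le[OF sq square_integrable_cnj[OF sq]]
    by (intro sum_mono mult_left_mono) auto
  finally show "(LINT x|lborel. \<bar>Dn k (density_of f) x\<bar>) \<le>
      (\<Sum>j\<le>k. real (k choose j) * (l2 (Dn j f) * l2 (Dn (k - j) f)))" .
qed

text \<open>Each Leibniz term is split as u v - u' v' = (u - u') v + u' (v - v'), so that
  \<open>L\<^sup>2\<close> continuity in time of the wave function becomes \<open>L\<^sup>1\<close>
  continuity of its density.\<close>

lemma integral_Dn_density_diff_le:
  assumes "H_infinity f" "H_infinity g"
  shows "(LINT x|lborel. \<bar>Dn k (density_of f) x - Dn k (density_of g) x\<bar>) \<le>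
      (\<Sum>j\<le>k. real (k choose j) * (l2 (\<lambda>x. Dn j f x - Dn j g x) * l2 (Dn (k - j) f) +
        l2 (Dn j g) * l2 (\<lambda>x. Dn (k - j) f x - Dn (k - j) g x)))"
proof -
  note smf = H_infinity_smooth[OF assms(1)] and sqf = H_infinity_square_integrable[OF assms(1)]
  note smg = H_infinity_smooth[OF assms(2)] and sqg = H_infinity_square_integrable[OF assms(2)]
  let ?A = "\<lambda>j x. (Dn j f x - Dn j g x) * cnj (Dn (k - j) f x)"
  let ?B = "\<lambda>j x. Dn j g x * cnj (Dn (k - j) f x - Dn (k - j) g x)"
  have A: "integrable lborel (?A j)" for j
    by (intro integrable_mult_square_integrable square_integrable_cnj square_integrable_diff sqf sqg)
  have B: "integrable lborel (?B j)" for j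
    by (intro integrable_mult_square_integrable square_integrable_cnj square_integrable_diff sqf sqg)
  have "(LINT x|lborel. \<bar>Dn k (density_of f) x - Dn k (density_of g) x\<bar>) \<le>
      (LINT x|lborel. (\<Sum>j\<le>k. real (k choose j) * (norm (?A j x) + norm (?B j x))))"
  proof (rule integral_mono)
    fix x
    have eq: "Dn k (density_of f) x - Dn k (density_of g) x = Re (\<Sum>j\<le>k. real (k choose j) *\<^sub>R (?A j x + ?B j x))"
    proof -
      have "?A j x + ?B j x = Dn j f x * cnj (Dn (k - j) f x) - Dn j g x * cnj (Dn (k - j) g x)" for j
        by (simp add: algebra_simps)
      then show ?thesis
        unfolding Dn_density[OF smf] Dn_density[OF smg] by (simp only: scaleR_diff_right sum_subtractf minus_complex.sel)
    qed
    show "\<bar>Dn k (density_of f) x - Dn k (density_of g) x\<bar> \<le>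
        (\<Sum>j\<le>k. real (k choose j) * (norm (?A j x) + norm (?B j x)))"
      unfolding eq
    proof (rule order_trans[OF abs_Re_le_cmod sum_norm_le])
      show "norm (real (k choose j) *\<^sub>R (?A j x + ?B j x)) \<le> real (k choose j) * (norm (?A j x) + norm (?B j x))" for j
        unfolding norm_scaleR abs_of_nat by (intro mult_left_mono norm_triangle_ineq) simp
    qed
  next
    show "integrable lborel (\<lambda>x. \<bar>Dn k (density_of f) x - Dn k (density_of g) x\<bar>)"
      by (intro integrable_abs Bochner_Integration.integrable_diff integrable_Dn_density assms)
    show "integrable lborel (\<lambda>x. \<Sum>j\<le>k. real (k choose j) * (norm (?A j x) + norm (?B j x)))"
      by (intro Bochner_Integration.integrable_sum integrable_mult_right Bochner_Integration.integrable_add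
          integrable_norm A B)
  qed
  also have "\<dots> = (\<Sum>j\<le>k. real (k choose j) * ((LINT x|lborel. norm (?A j x)) + (LINT x|lborel. norm (?B j x))))"
    using Bochner_Integration.integral_sum[of "{..k}" lborel
        "\<lambda>j x. real (k choose j) * (norm (?A j x) + norm (?B j x))"] integrable_norm[OF A] integrable_norm[OF B]
    by (simp only: integral_mult_right_zero integrable_mult_right Bochner_Integration.integral_add
        Bochner_Integration.integrable_add)
  also have "\<dots> \<le> (\<Sum>j\<le>k. real (k choose j) * (l2 (\<lambda>x. Dn j f x - Dn j g x) * l2 (Dn (k - j) f) +
        l2 (Dn j g) * l2 (\<lambda>x. Dn (k - j) f x - Dn (k - j) g x)))"
    using integral_norm_mult_le[OF square_integrable_diff[OF sqf sqg] square_integrable_cnj[OF sqf]]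
      integral_norm_mult_le[OF sqg square_integrable_cnj[OF square_integrable_diff[OF sqf sqg]]]
    by (intro sum_mono mult_left_mono add_mono) (auto simp del: complex_cnj_diff)
  finally show ?thesis .
qed

text \<open>Joint continuity from continuity in x and a modulus \<open>d t s\<close> of continuity
  in time that is uniform in x. Applied to derivatives of the solution and to convolutions with its
  density.\<close>

lemma continuous_on_uniformly:
  fixes G :: "real \<Rightarrow> real \<Rightarrow> 'a::real_normed_vector"
  assumes cont: "\<And>t. t \<in> S \<Longrightarrow> continuous_on UNIV (G t)"
    and unif: "\<And>s t x. s \<in> S \<Longrightarrow> t \<in> S \<Longrightarrow> norm (G s x - G t x) \<le> d t s"
    and lim: "\<And>t. t \<in> S \<Longrightarrow> (d t \<longlongrightarrow> 0) (at t within S)"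
  shows "continuous_on (S \<times> UNIV) (\<lambda>(t, x). G t x)"
  unfolding continuous_on_iff
proof (intro ballI allI impI)
  fix p0 and e :: real assume p0: "p0 \<in> S \<times> (UNIV :: real set)" and e: "0 < e"
  obtain t x where [simp]: "p0 = (t, x)" by (cases p0)
  have t: "t \<in> S" using p0 by simp
  obtain d1 where d1: "0 < d1" "\<And>y. dist y x < d1 \<Longrightarrow> dist (G t y) (G t x) < e / 2"
    using cont[OF t] e unfolding continuous_on_iff by (metis UNIV_I half_gt_zero)
  have "\<forall>\<^sub>F s in at t within S. dist (d t s) 0 < e / 2"
    using tendstoD[OF lim[OF t], of "e / 2"] e by simp
  then obtain d2 where d2: "0 < d2" "\<And>s. s \<in> S \<Longrightarrow> s \<noteq> t \<Longrightarrow> dist s t < d2 \<Longrightarrow> \<bar>d t s\<bar> < e / 2"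
    unfolding eventually_at by (auto simp: dist_real_def)
  show "\<exists>r>0. \<forall>p\<in>S \<times> UNIV. dist p p0 < r \<longrightarrow>
      dist (case p of (t, x) \<Rightarrow> G t x) (case p0 of (t, x) \<Rightarrow> G t x) < e"
  proof (intro exI[of _ "min d1 d2"] conjI ballI impI)
    fix p assume p: "p \<in> S \<times> UNIV" "dist p p0 < min d1 d2"
    obtain s y where [simp]: "p = (s, y)" by (cases p)
    have "dist s t < d2" "dist y x < d1"
      using p(2) dist_fst_le[of p "(t, x)"] dist_snd_le[of p "(t, x)"] by auto
    then have "dist (G t y) (G t x) < e / 2" using d1 by blast
    moreover have "dist (G s y) (G t y) < e / 2"
      using d2(2)[of s] unif[of s t y] p(1) t e \<open>dist s t < d2\<close>
      by (cases "s = t") (auto simp: dist_norm)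
    ultimately show "dist (case p of (t, x) \<Rightarrow> G t x) (case p0 of (t, x) \<Rightarrow> G t x) < e"
      using dist_triangle[of "G s y" "G t x" "G t y"] by simp
  qed (use d1 d2 in auto)
qed

text \<open>Integrate the first hypothesis in time and differentiate under the integral sign.\<close>

lemma has_vector_derivative_mixed:
  fixes G H :: "real \<Rightarrow> real \<Rightarrow> 'a::banach"
  assumes GH: "\<And>t x. t \<in> {0..T} \<Longrightarrow> ((\<lambda>s. G s x) has_vector_derivative H t x) (at t within {0..T})"
    and G': "\<And>t x. t \<in> {0..T} \<Longrightarrow> (G t has_vector_derivative G' t x) (at x)"
    and H': "\<And>t x. t \<in> {0..T} \<Longrightarrow> (H t has_vector_derivative H' t x) (at x)"
    and contH: "continuous_on ({0..T} \<times> UNIV) (\<lambda>(t, x). H t x)"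
    and contH': "continuous_on ({0..T} \<times> UNIV) (\<lambda>(t, x). H' t x)"
    and t: "t \<in> {0..T}"
  shows "((\<lambda>s. G' s x) has_vector_derivative H' t x) (at t within {0..T})"
proof -
  have Hc: "continuous_on S (\<lambda>t. H t x)" if "S \<subseteq> {0..T}" for S x
    by (rule continuous_on_compose2[OF contH, of S "\<lambda>t. (t, x)", simplified]) (use that in \<open>auto intro!: continuous_intros\<close>)
  have H'c: "continuous_on S (\<lambda>t. H' t x)" if "S \<subseteq> {0..T}" for S x
    by (rule continuous_on_compose2[OF contH', of S "\<lambda>t. (t, x)", simplified]) (use that in \<open>auto intro!: continuous_intros\<close>)
  have eq: "G' s x = G' 0 x + integral {0..s} (\<lambda>r. H' r x)" if s: "s \<in> {0..T}" for s
  proof -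
    have sub: "{0..s} \<subseteq> {0..T}" using s by auto
    have "integral {0..s} (\<lambda>r. H r y) = G s y - G 0 y" for y
      using s by (intro integral_unique fundamental_theorem_of_calculus)
        (auto intro: has_vector_derivative_within_subset[OF GH])
    moreover have "((\<lambda>y. integral (cbox 0 s) (\<lambda>r. H r y)) has_vector_derivative integral (cbox 0 s) (\<lambda>r. H' r x)) (at x within UNIV)"
    proof (rule leibniz_rule_vector_derivative)
      show "continuous_on (UNIV \<times> cbox 0 s) (\<lambda>(x, t). H' t x)"
      proof -
        have "continuous_on (UNIV \<times> cbox 0 s) (\<lambda>p. (\<lambda>(t, x). H' t x) (snd p, fst p))"
          by (rule continuous_on_compose2[OF contH']) (use s in \<open>auto intro!: continuous_intros\<close>)
        then show ?thesis by (simp add: case_prod_unfold)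
      qed
    qed (use H' s sub in \<open>auto intro!: integrable_continuous_interval Hc\<close>)
    ultimately have "((\<lambda>y. G s y - G 0 y) has_vector_derivative integral {0..s} (\<lambda>r. H' r x)) (at x)"
      by simp
    moreover have "((\<lambda>y. G s y - G 0 y) has_vector_derivative G' s x - G' 0 x) (at x)"
      using s by (intro has_vector_derivative_diff G') auto
    ultimately have "integral {0..s} (\<lambda>r. H' r x) = G' s x - G' 0 x"
      by (rule vector_derivative_unique_at)
    then show ?thesis by simp
  qed
  have "((\<lambda>s. integral {0..s} (\<lambda>r. H' r x)) has_vector_derivative H' t x) (at t within {0..T})"
    by (rule integral_has_vector_derivative[OF H'c t]) simp
  then have "((\<lambda>s. G' 0 x + integral {0..s} (\<lambda>r. H' r x)) has_vector_derivative H' t x) (at t within {0..T})"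
    using has_vector_derivative_add[OF has_vector_derivative_const[of "G' 0 x"]] by fastforce
  then show ?thesis
    by (rule has_vector_derivative_transform[where g = "\<lambda>s. G' s x", OF t, rotated]) (rule eq)
qed

section \<open>Time regularity of solutions\<close>

text \<open>Formally the derivative of sqrt Y is Y' / (2 sqrt Y), bounded by B. As Y may vanish, the
  argument is run for sqrt (Y + e^2), which exceeds sqrt Y by at most e. Estimating the norm instead
  of its square is what makes the growth linear.\<close>

lemma sqrt_growth:
  fixes Y :: "real \<Rightarrow> real"
  assumes Y: "\<And>t. t \<in> {0..T} \<Longrightarrow> (Y has_real_derivative Y' t) (at t within {0..T})"
    and nonneg: "\<And>t. t \<in> {0..T} \<Longrightarrow> 0 \<le> Y t"
    and bound: "\<And>t. t \<in> {0..T} \<Longrightarrow> \<bar>Y' t\<bar> \<le> 2 * B * sqrt (Y t)"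
    and B: "0 \<le> B" and t: "t \<in> {0..T}"
  shows "sqrt (Y t) \<le> sqrt (Y 0) + B * t"
proof (rule field_le_epsilon)
  fix e :: real assume e: "0 < e"
  let ?g = "\<lambda>t. sqrt (Y t + e\<^sup>2)"
  have pos: "0 < Y s + e\<^sup>2" if "s \<in> {0..T}" for s
    using nonneg[OF that] e by (simp add: add_nonneg_pos)
  have "norm (?g t - ?g 0) \<le> B * norm (t - 0)"
  proof (rule field_differentiable_bound[where S = "{0..T}" and f' = "\<lambda>s. Y' s * (inverse (sqrt (Y s + e\<^sup>2)) / 2)"])
    fix s assume s: "s \<in> {0..T}"
    show "(?g has_field_derivative Y' s * (inverse (sqrt (Y s + e\<^sup>2)) / 2)) (at s within {0..T})"
      using Y[OF s] pos[OF s] by (auto intro!: derivative_eq_intros)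
    have "2 * B * sqrt (Y s) \<le> 2 * B * ?g s" using B by (intro mult_left_mono) auto
    with bound[OF s] have "\<bar>Y' s\<bar> \<le> 2 * B * ?g s" by linarith
    then show "norm (Y' s * (inverse (sqrt (Y s + e\<^sup>2)) / 2)) \<le> B"
      using pos[OF s] by (simp add: abs_mult field_simps)
  qed (use t in auto)
  then have "?g t \<le> ?g 0 + B * t" using t by auto
  moreover have "sqrt (Y t) \<le> ?g t" by simp
  moreover have "?g 0 \<le> sqrt (Y 0) + e"
    using sqrt_add_le_add_sqrt[of "Y 0" "e\<^sup>2"] nonneg[of 0] t e by auto
  ultimately show "sqrt (Y t) \<le> sqrt (Y 0) + B * t + e" by linarith
qed

locale nls =
  fixes \<kappa> h \<epsilon> T :: real and \<phi> :: "real \<Rightarrow> complex" and \<psi> :: "real \<Rightarrow> real \<Rightarrow> complex"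
  assumes kappa: "\<kappa> = 1 \<or> \<kappa> = -1" and h: "0 < h" "h \<le> 1" and eps: "0 < \<epsilon>" and T: "0 < T"
    and solution: "nls_solution \<kappa> h \<epsilon> T \<phi> \<psi>"
begin

abbreviation W :: "real \<Rightarrow> real \<Rightarrow> real" where
  "W t \<equiv> conv (V \<kappa> \<epsilon>) (density_of (\<psi> t))"

lemma initial: "\<psi> 0 = \<phi>"
  using solution by (simp add: nls_solution_def)

lemma H_infinity_solution: "t \<in> {0..T} \<Longrightarrow> H_infinity (\<psi> t)"
  using solution by (auto simp: nls_solution_def H_infinity_def intro: L2_norm_finite)

lemmas smooth_solution = H_infinity_solution[THEN H_infinity_smooth]
lemmas square_integrable_solution = H_infinity_solution[THEN H_infinity_square_integrable]

lemma l2_tendsto: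
  assumes t: "t \<in> {0..T}"
  shows "((\<lambda>s. l2 (\<lambda>x. Dn k (\<psi> s) x - Dn k (\<psi> t) x)) \<longlongrightarrow> 0) (at t within {0..T})"
proof -
  have "((\<lambda>s. L2_norm (\<lambda>x. Dn k (\<psi> s) x - Dn k (\<psi> t) x)) \<longlongrightarrow> 0) (at t within {0..T})"
    using solution t by (simp add: nls_solution_def)
  moreover have "\<forall>\<^sub>F s in at t within {0..T}. L2_norm (\<lambda>x. Dn k (\<psi> s) x - Dn k (\<psi> t) x) =
      ennreal (l2 (\<lambda>x. Dn k (\<psi> s) x - Dn k (\<psi> t) x))"
    using t by (auto simp: eventually_at_filter intro!: always_eventually L2_norm_eq
        square_integrable_diff square_integrable_solution)
  ultimately have "((\<lambda>s. ennreal (l2 (\<lambda>x. Dn k (\<psi> s) x - Dn k (\<psi> t) x))) \<longlongrightarrow> 0) (at t within {0..T})"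
    by (rule Lim_transform_eventually)
  from tendsto_enn2real[OF this[folded ennreal_0]] show ?thesis by simp
qed

lemma l2_continuous: "continuous_on {0..T} (\<lambda>t. l2 (Dn k (\<psi> t)))"
  unfolding continuous_on_def
proof
  fix t assume t: "t \<in> {0..T}"
  have "\<forall>\<^sub>F s in at t within {0..T}. norm (l2 (Dn k (\<psi> s)) - l2 (Dn k (\<psi> t))) \<le>
      l2 (\<lambda>x. Dn k (\<psi> s) x - Dn k (\<psi> t) x)"
    using t by (auto simp: eventually_at_filter intro!: always_eventually l2_abs_diff_le square_integrable_solution)
  then have "((\<lambda>s. l2 (Dn k (\<psi> s)) - l2 (Dn k (\<psi> t))) \<longlongrightarrow> 0) (at t within {0..T})"
    by (rule Lim_null_comparison[OF _ l2_tendsto[OF t]])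
  then show "((\<lambda>t. l2 (Dn k (\<psi> t))) \<longlongrightarrow> l2 (Dn k (\<psi> t))) (at t within {0..T})"
    by (simp add: LIM_zero_iff)
qed

text \<open>Compactness of the time interval. These bounds depend on h and \<epsilon>; they only
  justify limits.\<close>

lemma l2_bounded:
  obtains M where "\<And>k t. t \<in> {0..T} \<Longrightarrow> l2 (Dn k (\<psi> t)) \<le> M k" "\<And>k. 0 \<le> M k"
proof -
  have "\<exists>B\<ge>0. \<forall>t\<in>{0..T}. norm (l2 (Dn k (\<psi> t))) \<le> B" for k
    using continuous_on_compact_bound[OF compact_Icc l2_continuous] by metis
  then obtain M where "\<And>k. M k \<ge> 0 \<and> (\<forall>t\<in>{0..T}. norm (l2 (Dn k (\<psi> t))) \<le> M k)" by metis
  then show ?thesis by (intro that[of M]) auto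
qed

text \<open>Agmon's inequality for the difference of two times makes convergence in every Sobolev
  norm uniform in x.\<close>

lemma Dn_continuous: "continuous_on ({0..T} \<times> UNIV) (\<lambda>(t, x). Dn k (\<psi> t) x)"
proof (rule continuous_on_uniformly)
  let ?d = "\<lambda>k t s. l2 (\<lambda>x. Dn k (\<psi> s) x - Dn k (\<psi> t) x)"
  show "norm (Dn k (\<psi> s) x - Dn k (\<psi> t) x) \<le> sqrt (2 * (?d k t s * ?d (Suc k) t s))"
    if s: "s \<in> {0..T}" and t: "t \<in> {0..T}" for s t x
    by (intro real_le_rsqrt sup_norm_le square_integrable_diff square_integrable_solution
        has_vector_derivative_diff smooth_deriv smooth_solution s t)
  show "((\<lambda>s. sqrt (2 * (?d k t s * ?d (Suc k) t s))) \<longlongrightarrow> 0) (at t within {0..T})" if "t \<in> {0..T}" for t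
    by (auto intro!: tendsto_eq_intros l2_tendsto[OF that])
qed (intro smooth_continuous smooth_solution)

lemma Dn_bounded: "\<exists>B. \<forall>t\<in>{0..T}. \<forall>x. norm (Dn k (\<psi> t) x) \<le> B"
proof -
  obtain M where M: "\<And>k t. t \<in> {0..T} \<Longrightarrow> l2 (Dn k (\<psi> t)) \<le> M k" "\<And>k. 0 \<le> M k"
    using l2_bounded by blast
  have "norm (Dn k (\<psi> t) x) \<le> sqrt (2 * (M k * M (Suc k)))" if t: "t \<in> {0..T}" for t x
  proof (rule real_le_rsqrt)
    have "(norm (Dn k (\<psi> t) x))\<^sup>2 \<le> 2 * (l2 (Dn k (\<psi> t)) * l2 (Dn (Suc k) (\<psi> t)))"
      by (intro sup_norm_le square_integrable_solution smooth_deriv smooth_solution t)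
    also have "\<dots> \<le> 2 * (M k * M (Suc k))"
      using M t by (intro mult_left_mono mult_mono) auto
    finally show "(norm (Dn k (\<psi> t) x))\<^sup>2 \<le> 2 * (M k * M (Suc k))" .
  qed
  then show ?thesis by blast
qed

lemma smooth_density_solution: "t \<in> {0..T} \<Longrightarrow> smooth (density_of (\<psi> t))"
  by (intro smooth_density smooth_solution)

lemma integrable_Dn_density_solution: "t \<in> {0..T} \<Longrightarrow> integrable lborel (Dn k (density_of (\<psi> t)))"
  by (intro integrable_Dn_density H_infinity_solution)

text \<open>The map g \<mapsto> \<open>conv K g\<close> from \<open>L\<^sup>1\<close> to bounded
  functions transports time continuity and boundedness of the density derivatives. It is used with
  \<open>V\<close> for the potential itself and with \<open>V'\<close> for its derivatives.\<close>

lemma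
  assumes K [measurable]: "K \<in> borel_measurable borel" and M: "\<And>x. \<bar>K x\<bar> \<le> M"
  shows conv_density_continuous:
      "continuous_on ({0..T} \<times> UNIV) (\<lambda>(t, x). conv K (Dn k (density_of (\<psi> t))) x)" (is ?thesis1)
    and conv_density_bounded:
      "\<exists>B. \<forall>t\<in>{0..T}. \<forall>x. \<bar>conv K (Dn k (density_of (\<psi> t))) x\<bar> \<le> B" (is ?thesis2)
proof -
  have M0: "0 \<le> M" using M[of 0] by linarith
  let ?d = "\<lambda>t s k. l2 (\<lambda>x. Dn k (\<psi> s) x - Dn k (\<psi> t) x)"
  let ?D = "\<lambda>t s. M * (\<Sum>j\<le>k. real (k choose j) *
      (?d t s j * l2 (Dn (k - j) (\<psi> s)) + l2 (Dn j (\<psi> t)) * ?d t s (k - j)))"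
  show ?thesis1
  proof (rule continuous_on_uniformly)
    fix t assume t: "t \<in> {0..T}"
    have "smooth (conv K (density_of (\<psi> t)))" "Dn k (conv K (density_of (\<psi> t))) = conv K (Dn k (density_of (\<psi> t)))"
      using smooth_conv[OF K M] Dn_conv[OF K M] smooth_density_solution[OF t] integrable_Dn_density_solution[OF t]
      by blast+
    then show "continuous_on UNIV (conv K (Dn k (density_of (\<psi> t))))"
      using smooth_continuous[of "conv K (density_of (\<psi> t))" UNIV k] by simp
    have "((\<lambda>s. l2 (Dn j (\<psi> s))) \<longlongrightarrow> l2 (Dn j (\<psi> t))) (at t within {0..T})" for j
      using l2_continuous t by (auto simp: continuous_on_def)
    then show "(?D t \<longlongrightarrow> 0) (at t within {0..T})"
      by (auto intro!: tendsto_eq_intros l2_tendsto[OF t])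
    fix s x assume s: "s \<in> {0..T}"
    have "norm (conv K (Dn k (density_of (\<psi> s))) x - conv K (Dn k (density_of (\<psi> t))) x) \<le>
        M * (LINT x|lborel. \<bar>Dn k (density_of (\<psi> s)) x - Dn k (density_of (\<psi> t)) x\<bar>)"
      unfolding conv_diff[OF K M integrable_Dn_density_solution[OF s] integrable_Dn_density_solution[OF t]] real_norm_def
      by (intro conv_bound K M Bochner_Integration.integrable_diff integrable_Dn_density_solution s t)
    also have "\<dots> \<le> ?D t s"
      by (intro mult_left_mono integral_Dn_density_diff_le H_infinity_solution s t M0)
    finally show "norm (conv K (Dn k (density_of (\<psi> s))) x - conv K (Dn k (density_of (\<psi> t))) x) \<le> ?D t s" .
  qed
  obtain N where N: "\<And>k t. t \<in> {0..T} \<Longrightarrow> l2 (Dn k (\<psi> t)) \<le> N k" "\<And>k. 0 \<le> N k"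
    using l2_bounded by blast
  have "\<bar>conv K (Dn k (density_of (\<psi> t))) x\<bar> \<le> M * (\<Sum>j\<le>k. real (k choose j) * (N j * N (k - j)))"
    if t: "t \<in> {0..T}" for t x
  proof -
    have "\<bar>conv K (Dn k (density_of (\<psi> t))) x\<bar> \<le> M * (LINT x|lborel. \<bar>Dn k (density_of (\<psi> t)) x\<bar>)"
      by (intro conv_bound K M integrable_Dn_density_solution t)
    also have "\<dots> \<le> M * (\<Sum>j\<le>k. real (k choose j) * (l2 (Dn j (\<psi> t)) * l2 (Dn (k - j) (\<psi> t))))"
      by (intro mult_left_mono integral_Dn_density_le H_infinity_solution t M0)
    also have "\<dots> \<le> M * (\<Sum>j\<le>k. real (k choose j) * (N j * N (k - j)))"
      by (intro mult_left_mono sum_mono mult_mono N t M0) (auto simp: N)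
    finally show ?thesis .
  qed
  then show ?thesis2 by blast
qed

lemma
  assumes t: "t \<in> {0..T}"
  shows smooth_W: "smooth (W t)"
    and Dn_Suc_W: "Dn (Suc k) (W t) = conv (V' \<kappa> \<epsilon>) (Dn k (density_of (\<psi> t)))"
  using smooth_conv_V[OF kappa eps] Dn_Suc_conv_V[OF kappa eps] smooth_density_solution[OF t]
    integrable_Dn_density_solution[OF t] by blast+

lemma W_continuous: "continuous_on ({0..T} \<times> UNIV) (\<lambda>(t, x). Dn k (W t) x)"
proof (cases k)
  case 0
  then show ?thesis using conv_density_continuous[OF V_measurable V_bound[OF kappa eps], of 0] by simp
next
  case (Suc j)
  have "continuous_on ({0..T} \<times> UNIV) (\<lambda>(t, x). conv (V' \<kappa> \<epsilon>) (Dn j (density_of (\<psi> t))) x)"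
    by (rule conv_density_continuous[OF V'_measurable V'_bound[OF kappa eps]])
  then show ?thesis
    by (rule continuous_on_eq) (auto simp: Suc Dn_Suc_W)
qed

lemma W_bounded: "\<exists>B. \<forall>t\<in>{0..T}. \<forall>x. \<bar>Dn k (W t) x\<bar> \<le> B"
proof (cases k)
  case 0
  then show ?thesis using conv_density_bounded[OF V_measurable V_bound[OF kappa eps], of 0] by simp
next
  case (Suc j)
  then show ?thesis using conv_density_bounded[OF V'_measurable V'_bound[OF kappa eps], of j]
    by (simp add: Dn_Suc_W)
qed

text \<open>The right-hand side of the equation after division by i h, that is, the time derivative
  of the solution.\<close>

definition R :: "real \<Rightarrow> real \<Rightarrow> complex" where
  "R t x = (\<i> * complex_of_real (h / 2)) * Dn 2 (\<psi> t) x +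
     (- \<i> * complex_of_real (1 / h)) * (complex_of_real (W t x) * \<psi> t x)"

lemma
  assumes t: "t \<in> {0..T}"
  shows smooth_R: "smooth (R t)"
    and Dn_R: "Dn k (R t) x = (\<i> * complex_of_real (h / 2)) * Dn (k + 2) (\<psi> t) x +
      (- \<i> * complex_of_real (1 / h)) *
        (\<Sum>j\<le>k. real (k choose j) *\<^sub>R (complex_of_real (Dn j (W t) x) * Dn (k - j) (\<psi> t) x))"
proof -
  have sW: "smooth (\<lambda>x. complex_of_real (W t x))"
    and DW: "Dn k (\<lambda>x. complex_of_real (W t x)) = (\<lambda>x. complex_of_real (Dn k (W t) x))" for k
    using smooth_bounded_linear[OF bounded_linear_of_real smooth_W[OF t]]
      Dn_bounded_linear[OF bounded_linear_of_real smooth_W[OF t]] by auto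
  note mult = smooth_mult[OF sW smooth_solution[OF t]]
  note 1 = smooth_bounded_linear[OF bounded_linear_mult_right smooth_Dn[OF smooth_solution[OF t], of 2],
      of "\<i> * complex_of_real (h / 2)"]
  note 2 = smooth_bounded_linear[OF bounded_linear_mult_right mult, of "- \<i> * complex_of_real (1 / h)"]
  have eq: "R t = (\<lambda>x. (\<i> * complex_of_real (h / 2)) * Dn 2 (\<psi> t) x +
     (- \<i> * complex_of_real (1 / h)) * (complex_of_real (W t x) * \<psi> t x))"
    by (simp add: R_def fun_eq_iff)
  show "smooth (R t)" unfolding eq by (rule smooth_add[OF 1 2])
  show "Dn k (R t) x = (\<i> * complex_of_real (h / 2)) * Dn (k + 2) (\<psi> t) x +
      (- \<i> * complex_of_real (1 / h)) *
        (\<Sum>j\<le>k. real (k choose j) *\<^sub>R (complex_of_real (Dn j (W t) x) * Dn (k - j) (\<psi> t) x))"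
    unfolding eq Dn_add[OF 1 2] Dn_bounded_linear[OF bounded_linear_mult_right smooth_Dn[OF smooth_solution[OF t]]]
      Dn_bounded_linear[OF bounded_linear_mult_right mult] Dn_mult[OF sW smooth_solution[OF t]] DW Dn_Dn ..
qed

lemma R_continuous: "continuous_on ({0..T} \<times> UNIV) (\<lambda>(t, x). Dn k (R t) x)"
proof -
  have "continuous_on ({0..T} \<times> UNIV) (\<lambda>p. (\<i> * complex_of_real (h / 2)) * Dn (k + 2) (\<psi> (fst p)) (snd p) +
      (- \<i> * complex_of_real (1 / h)) *
        (\<Sum>j\<le>k. real (k choose j) *\<^sub>R (complex_of_real (Dn j (W (fst p)) (snd p)) * Dn (k - j) (\<psi> (fst p)) (snd p))))"
    by (intro continuous_intros Dn_continuous[unfolded case_prod_unfold] W_continuous[unfolded case_prod_unfold])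
  then show ?thesis
    by (rule continuous_on_eq) (auto simp: Dn_R)
qed

lemma R_bounded: "\<exists>B. \<forall>t\<in>{0..T}. \<forall>x. norm (Dn k (R t) x) \<le> B"
proof -
  obtain B where B: "\<And>k t x. t \<in> {0..T} \<Longrightarrow> norm (Dn k (\<psi> t) x) \<le> B k"
    using Dn_bounded by metis
  obtain C where C: "\<And>k t x. t \<in> {0..T} \<Longrightarrow> \<bar>Dn k (W t) x\<bar> \<le> C k"
    using W_bounded by metis
  have C0: "0 \<le> C k" for k using C[of 0 k 0] T by (smt (verit) atLeastAtMost_iff abs_ge_zero)
  have "norm (Dn k (R t) x) \<le> (h / 2) * B (k + 2) + (1 / h) * (\<Sum>j\<le>k. real (k choose j) * (C j * B (k - j)))"
    if t: "t \<in> {0..T}" for t x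
  proof -
    have "norm (\<Sum>j\<le>k. real (k choose j) *\<^sub>R (complex_of_real (Dn j (W t) x) * Dn (k - j) (\<psi> t) x)) \<le>
      (\<Sum>j\<le>k. real (k choose j) * (C j * B (k - j)))"
      by (rule sum_norm_le) (auto simp: norm_mult intro!: mult_left_mono mult_mono B C t C0)
    then show ?thesis
      unfolding Dn_R[OF t] using h B[OF t, of "k + 2" x]
      by (intro order_trans[OF norm_triangle_ineq] add_mono)
        (auto simp: norm_mult norm_divide intro!: mult_left_mono divide_right_mono)
  qed
  then show ?thesis by blast
qed

text \<open>The equation supplies a pointwise time derivative of the solution alone. Each further
  x-derivative is gained by exchanging the two differentiations, for which joint continuity of all
  derivatives of \<open>R\<close> is available.\<close>

lemma time_derivative:
  "t \<in> {0..T} \<Longrightarrow> ((\<lambda>s. Dn k (\<psi> s) x) has_vector_derivative Dn k (R t) x) (at t within {0..T})"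
proof (induction k arbitrary: t x)
  case 0
  obtain d where d: "((\<lambda>s. \<psi> s x) has_vector_derivative d) (at t within {0..T})"
    and eq: "\<i> * complex_of_real h * d =
          - complex_of_real (h\<^sup>2 / 2) * Dn 2 (\<psi> t) x + complex_of_real (W t x) * \<psi> t x"
    using solution 0 unfolding nls_solution_def by blast
  have "d = (- \<i> * complex_of_real (1 / h)) * (\<i> * complex_of_real h * d)"
    using h by simp
  also have "\<dots> = R t x"
    unfolding eq R_def using h by (simp add: field_simps power2_eq_square)
  finally show ?case using d by simp
next
  case (Suc k)
  show ?case
    by (rule has_vector_derivative_mixed[where G = "\<lambda>t. Dn k (\<psi> t)" and H = "\<lambda>t. Dn k (R t)" and T = T])
      (rule Suc.IH smooth_deriv smooth_solution smooth_R R_continuous Suc.prems | assumption)+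
qed

end

section \<open>The weighted energy estimate\<close>

lemma measurable_weight: "(\<And>x. (p has_real_derivative p' x) (at x)) \<Longrightarrow> p \<in> borel_measurable borel"
  by (intro borel_measurable_continuous_onI continuous_at_imp_continuous_on ballI DERIV_isCont)

lemma
  fixes f :: "real \<Rightarrow> 'a::{banach, second_countable_topology}"
  assumes "square_integrable f" and [measurable]: "p \<in> borel_measurable borel" and "\<And>x. \<bar>p x\<bar> \<le> P"
  shows square_integrable_weight: "square_integrable (\<lambda>x. p x *\<^sub>R f x)"
    and l2_weight_le: "l2 (\<lambda>x. p x *\<^sub>R f x) \<le> P * l2 f"
proof -
  have [measurable]: "f \<in> borel_measurable borel" using assms(1) by (rule square_integrable_measurable)
  have m: "(\<lambda>x. p x *\<^sub>R f x) \<in> borel_measurable borel" by measurable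
  have P: "0 \<le> P" using assms(3)[of 0] by linarith
  have le: "norm (p x *\<^sub>R f x) \<le> P * norm (f x)" for x
    using assms(3)[of x] by (simp add: mult_right_mono)
  show "square_integrable (\<lambda>x. p x *\<^sub>R f x)" "l2 (\<lambda>x. p x *\<^sub>R f x) \<le> P * l2 f"
    using square_integrable_mono[OF assms(1) m P le] l2_mono[OF assms(1) m P le] by auto
qed

text \<open>The integral of the derivative of p^2 times the conjugate of f times f' is 0. The term
  with |f'|^2 is real, and the two terms with p' coincide, whence the factor 2. The kinetic term
  thus contributes only where the weight varies.\<close>

lemma integral_Im_second_derivative:
  fixes f f' f'' :: "real \<Rightarrow> complex"
  assumes p: "\<And>x. (p has_real_derivative p' x) (at x)" "\<And>x. \<bar>p x\<bar> \<le> P"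
    and p': "p' \<in> borel_measurable borel" "\<And>x. \<bar>p' x\<bar> \<le> P'"
    and sq: "square_integrable f" "square_integrable f'" "square_integrable f''"
    and f: "\<And>x. (f has_vector_derivative f' x) (at x)" "\<And>x. (f' has_vector_derivative f'' x) (at x)"
  shows "(LINT x|lborel. Im (cnj (p x *\<^sub>R f x) * (p x *\<^sub>R f'' x))) =
    - 2 * (LINT x|lborel. Im (cnj (p x *\<^sub>R f x) * (p' x *\<^sub>R f' x)))"
proof -
  note pm = measurable_weight[OF p(1)]
  note wp = square_integrable_weight[OF _ pm p(2)] and wp' = square_integrable_weight[OF _ p'(1) p'(2)]
  have d: "((\<lambda>x. p x *\<^sub>R g x) has_vector_derivative p' x *\<^sub>R g x + p x *\<^sub>R g' x) (at x)"
    if "(g has_vector_derivative g' x) (at x)" for g g' :: "real \<Rightarrow> complex" and x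
    using has_vector_derivative_scaleR[OF p(1)[of x] that] by (simp add: add.commute)
  let ?F = "\<lambda>x. cnj (p x *\<^sub>R f x) * (p x *\<^sub>R f' x)"
  let ?A = "\<lambda>x. cnj (p x *\<^sub>R f x) * (p x *\<^sub>R f'' x)"
  let ?B = "\<lambda>x. cnj (p x *\<^sub>R f x) * (p' x *\<^sub>R f' x)"
  let ?C = "\<lambda>x. cnj (p x *\<^sub>R f' x) * (p x *\<^sub>R f' x)"
  let ?D = "\<lambda>x. cnj (p' x *\<^sub>R f x) * (p x *\<^sub>R f' x)"
  have int: "integrable lborel ?F" "integrable lborel ?A" "integrable lborel ?B" "integrable lborel ?C" "integrable lborel ?D"
    by (intro integrable_mult_square_integrable square_integrable_cnj wp wp' sq)+
  let ?F' = "\<lambda>x. ?B x + ?A x + (?D x + ?C x)"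
  have "(?F has_vector_derivative ?F' x) (at x)" for x
  proof -
    have "(?F has_vector_derivative cnj (p x *\<^sub>R f x) * (p' x *\<^sub>R f' x + p x *\<^sub>R f'' x) +
        cnj (p' x *\<^sub>R f x + p x *\<^sub>R f' x) * (p x *\<^sub>R f' x)) (at x)"
      by (intro has_vector_derivative_mult has_vector_derivative_cnj' d f)
    then show ?thesis by (simp add: algebra_simps)
  qed
  moreover have int': "integrable lborel ?F'" by (intro Bochner_Integration.integrable_add int)
  ultimately have "(LINT x|lborel. ?F' x) = 0"
    using integral_derivative_eq_0[OF int(1)] by blast
  then have "(LINT x|lborel. Im (?F' x)) = 0"
    by (simp only: integral_Im[OF int']) simp
  moreover have eq: "Im (?F' x) = Im (?A x) + 2 * Im (?B x)" for x
    by (simp add: algebra_simps)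
  ultimately have "(LINT x|lborel. Im (?A x) + 2 * Im (?B x)) = 0" by (simp only: eq)
  then show ?thesis
    using integrable_Im[OF int(2)] integrable_Im[OF int(3)] by (simp del: scaleR_conv_of_real)
qed

context nls
begin

text \<open>The square integrable weight \<open>p\<close> provides the majorant that allows differentiating the weighted norm
  in time: the time derivatives are only known to be bounded pointwise.
  The choice \<open>p = cutoff \<eta>\<close> recovers the norm as \<open>\<eta> \<rightarrow> 0\<close>, and \<open>p x = x * cutoff \<eta> x\<close> the norm of \<open>x \<psi>\<close>.\<close>

lemma energy_estimate:
  assumes p: "\<And>x. (p has_real_derivative p' x) (at x)" "\<And>x. \<bar>p x\<bar> \<le> P" "integrable lborel (\<lambda>x. (p x)\<^sup>2)"
    and p': "p' \<in> borel_measurable borel" "\<And>x. \<bar>p' x\<bar> \<le> P'"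
    and w: "\<And>j t x. j < k \<Longrightarrow> t \<in> {0..T} \<Longrightarrow> \<bar>Dn (Suc j) (W t) x\<bar> \<le> w j"
    and B: "\<And>t. t \<in> {0..T} \<Longrightarrow> h * l2 (\<lambda>x. p' x *\<^sub>R Dn (Suc k) (\<psi> t) x) +
      (1 / h) * (\<Sum>j<k. real (k choose Suc j) * w j * l2 (\<lambda>x. p x *\<^sub>R Dn (k - Suc j) (\<psi> t) x)) \<le> B"
    and t: "t \<in> {0..T}"
  shows "l2 (\<lambda>x. p x *\<^sub>R Dn k (\<psi> t) x) \<le> l2 (\<lambda>x. p x *\<^sub>R Dn k (\<psi> 0) x) + B * t"
proof -
  note pm [measurable] = measurable_weight[OF p(1)]
  define a where "a = (\<lambda>j t x. p x *\<^sub>R Dn j (\<psi> t) x)"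
  define b where "b = (\<lambda>t x. p' x *\<^sub>R Dn (Suc k) (\<psi> t) x)"
  have sqa: "square_integrable (a j t)" if "t \<in> {0..T}" for j t
    unfolding a_def by (rule square_integrable_weight[OF square_integrable_solution[OF that] pm p(2)])
  have sqb: "square_integrable (b t)" if "t \<in> {0..T}" for t
    unfolding b_def by (rule square_integrable_weight[OF square_integrable_solution[OF that] p'])
  have w0: "0 \<le> w j" if "j < k" for j
    using w[OF that, of 0 0] T by auto
  have B0: "0 \<le> B"
    using h w0 T by (intro order_trans[OF _ B[of 0]] add_nonneg_nonneg mult_nonneg_nonneg sum_nonneg) auto
  \<comment> \<open>\<open>q\<close> will be the time derivative of the squared modulus of
    \<open>Dn k (\<psi> t)\<close>.\<close>
  define q where "q = (\<lambda>t x. 2 * Re (cnj (Dn k (\<psi> t) x) * Dn k (R t) x))"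
  obtain Bu where Bu: "\<And>t x. t \<in> {0..T} \<Longrightarrow> norm (Dn k (\<psi> t) x) \<le> Bu" using Dn_bounded by metis
  obtain Br where Br: "\<And>t x. t \<in> {0..T} \<Longrightarrow> norm (Dn k (R t) x) \<le> Br" using R_bounded by metis
  have q_bound: "\<bar>q t x\<bar> \<le> 2 * (Bu * Br)" if t: "t \<in> {0..T}" for t x
  proof -
    have "0 \<le> Bu" using Bu[OF t, of 0] norm_ge_zero order_trans by blast
    have "\<bar>Re (cnj (Dn k (\<psi> t) x) * Dn k (R t) x)\<bar> \<le> norm (Dn k (\<psi> t) x) * norm (Dn k (R t) x)"
      using abs_Re_le_cmod[of "cnj (Dn k (\<psi> t) x) * Dn k (R t) x"] by (simp add: norm_mult)
    also have "\<dots> \<le> Bu * Br" using Bu[OF t] Br[OF t] \<open>0 \<le> Bu\<close> by (intro mult_mono) auto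
    finally show ?thesis by (simp add: q_def)
  qed
  have q_deriv: "((\<lambda>s. (norm (Dn k (\<psi> s) x))\<^sup>2) has_vector_derivative q t x) (at t within {0..T})"
    if t: "t \<in> {0..T}" for t x
  proof -
    have "((\<lambda>s. Re (Dn k (\<psi> s) x * cnj (Dn k (\<psi> s) x))) has_vector_derivative
        Re (Dn k (\<psi> t) x * cnj (Dn k (R t) x) + Dn k (R t) x * cnj (Dn k (\<psi> t) x))) (at t within {0..T})"
      by (intro bounded_linear.has_vector_derivative[OF bounded_linear_Re] has_vector_derivative_mult
          has_vector_derivative_cnj' time_derivative t)
    moreover have "Re (Dn k (\<psi> s) x * cnj (Dn k (\<psi> s) x)) = (norm (Dn k (\<psi> s) x))\<^sup>2" for s
      by (simp add: complex_norm_square[symmetric])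
    ultimately show ?thesis by (simp add: q_def algebra_simps)
  qed
  have q_meas: "(\<lambda>x. q t x) \<in> borel_measurable borel" if t: "t \<in> {0..T}" for t
    unfolding q_def
    by (intro borel_measurable_continuous_onI continuous_intros smooth_continuous smooth_solution smooth_R t)
  have Y: "((\<lambda>t. LINT x|lborel. (p x)\<^sup>2 * (norm (Dn k (\<psi> t) x))\<^sup>2) has_real_derivative
      (LINT x|lborel. (p x)\<^sup>2 * q t x)) (at t within {0..T})" if t: "t \<in> {0..T}" for t
    unfolding has_real_derivative_iff_has_vector_derivative
  proof (rule has_vector_derivative_integral[OF _ t, where g = "\<lambda>x. 2 * (Bu * Br) * (p x)\<^sup>2"])
    show "integrable lborel (\<lambda>x. (p x)\<^sup>2 * (norm (Dn k (\<psi> s) x))\<^sup>2)" if "s \<in> {0..T}" for s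
      using sqa[OF that, of k] by (simp add: square_integrable_def a_def power_mult_distrib)
    show "integrable lborel (\<lambda>x. 2 * (Bu * Br) * (p x)\<^sup>2)" using p(3) by simp
    show "(\<lambda>x. (p x)\<^sup>2 * q t x) \<in> borel_measurable lborel" using q_meas[OF t] by simp
    show "AE x in lborel. ((\<lambda>s. (p x)\<^sup>2 * (norm (Dn k (\<psi> s) x))\<^sup>2) has_vector_derivative (p x)\<^sup>2 * q t x) (at t within {0..T})"
      by (intro AE_I2 bounded_linear.has_vector_derivative[OF bounded_linear_mult_right] q_deriv t)
    fix s x assume s: "s \<in> {0..T}"
    \<comment> \<open>The mean value theorem in time turns the uniform bound on \<open>q\<close>
      into a Lipschitz bound; multiplied by p^2 it becomes an integrable majorant.\<close>
    have "norm ((norm (Dn k (\<psi> s) x))\<^sup>2 - (norm (Dn k (\<psi> t) x))\<^sup>2) \<le> 2 * (Bu * Br) * norm (s - t)"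
      by (rule field_differentiable_bound[where S = "{0..T}" and f' = "\<lambda>s. q s x"])
        (use q_deriv q_bound s t in \<open>auto simp: has_real_derivative_iff_has_vector_derivative\<close>)
    then have "(p x)\<^sup>2 * \<bar>(norm (Dn k (\<psi> s) x))\<^sup>2 - (norm (Dn k (\<psi> t) x))\<^sup>2\<bar> \<le> (p x)\<^sup>2 * (2 * (Bu * Br) * \<bar>s - t\<bar>)"
      by (intro mult_left_mono) auto
    then show "norm ((p x)\<^sup>2 * (norm (Dn k (\<psi> s) x))\<^sup>2 - (p x)\<^sup>2 * (norm (Dn k (\<psi> t) x))\<^sup>2) \<le>
        \<bar>s - t\<bar> * (2 * (Bu * Br) * (p x)\<^sup>2)"
      by (simp add: right_diff_distrib[symmetric] abs_mult mult_ac)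
  qed
  have Y_eq: "(LINT x|lborel. (p x)\<^sup>2 * (norm (Dn k (\<psi> t) x))\<^sup>2) = (l2 (a k t))\<^sup>2" for t
    by (simp add: l2_power2 a_def power_mult_distrib)
  have Y': "\<bar>LINT x|lborel. (p x)\<^sup>2 * q t x\<bar> \<le> 2 * B * sqrt ((l2 (a k t))\<^sup>2)" if t: "t \<in> {0..T}" for t
  proof -
    let ?A = "\<lambda>x. - h * Im (cnj (a k t x) * a (k + 2) t x)"
    let ?S = "\<lambda>x. (2 / h) * (\<Sum>j<k. real (k choose Suc j) * (Dn (Suc j) (W t) x * Im (cnj (a k t x) * a (k - Suc j) t x)))"
    let ?S' = "\<lambda>x. (2 / h) * (\<Sum>j<k. real (k choose Suc j) * (w j * norm (cnj (a k t x) * a (k - Suc j) t x)))"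
    have pointwise: "(p x)\<^sup>2 * q t x = ?A x + ?S x" for x
    proof -
      let ?u = "\<lambda>j. Dn j (\<psi> t) x" and ?W = "\<lambda>j. Dn j (W t) x"
      let ?sum = "\<Sum>j\<le>k. real (k choose j) *\<^sub>R (complex_of_real (?W j) * ?u (k - j))"
      have "Im (cnj (?u k) * ?sum) = (\<Sum>j\<le>k. real (k choose j) * (?W j * Im (cnj (?u k) * ?u (k - j))))"
        by (simp add: sum_distrib_left algebra_simps)
      \<comment> \<open>The omitted summand j = 0 is W times the squared modulus of
        \<open>Dn k (\<psi> t) x\<close>, hence has no imaginary part.\<close>
      also have "\<dots> = (\<Sum>j<k. real (k choose Suc j) * (?W (Suc j) * Im (cnj (?u k) * ?u (k - Suc j))))"
        by (subst sum.atMost_shift) simp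
      finally have s: "Im (cnj (?u k) * ?sum) = (\<Sum>j<k. real (k choose Suc j) * (?W (Suc j) * Im (cnj (?u k) * ?u (k - Suc j))))" .
      have "2 * Re (cnj u * ((\<i> * complex_of_real (h / 2)) * v + (- \<i> * complex_of_real (1 / h)) * z)) =
          - h * Im (cnj u * v) + (2 / h) * Im (cnj u * z)" for u v z
        using h by (simp add: field_simps)
      then have "q t x = - h * Im (cnj (?u k) * ?u (k + 2)) + (2 / h) * Im (cnj (?u k) * ?sum)"
        unfolding q_def Dn_R[OF t] by blast
      moreover have "r * (- h * X + c * Z) = - h * (r * X) + c * (r * Z)" for r X c Z :: real
        by (simp add: algebra_simps)
      ultimately have "(p x)\<^sup>2 * q t x = - h * ((p x)\<^sup>2 * Im (cnj (?u k) * ?u (k + 2))) +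
          (2 / h) * ((p x)\<^sup>2 * Im (cnj (?u k) * ?sum))"
        by metis
      moreover have "(p x)\<^sup>2 * Im (cnj (?u k) * ?sum) =
          (\<Sum>j<k. real (k choose Suc j) * (?W (Suc j) * ((p x)\<^sup>2 * Im (cnj (?u k) * ?u (k - Suc j)))))"
        unfolding s by (subst sum_distrib_left, intro sum.cong refl) (simp only: mult.left_commute)
      moreover have p2: "(p x)\<^sup>2 * Im (cnj (?u i) * ?u j) = Im (cnj (a i t x) * a j t x)" for i j
        by (simp add: a_def power2_eq_square algebra_simps)
      ultimately show ?thesis by (simp only: p2)
    qed
    have intA: "integrable lborel ?A"
      by (intro integrable_mult_right integrable_Im integrable_mult_square_integrable square_integrable_cnj sqa t)
    have "integrable lborel (\<lambda>x. (p x)\<^sup>2 * q t x)"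
    proof (rule Bochner_Integration.integrable_bound)
      show "integrable lborel (\<lambda>x. (p x)\<^sup>2 * (2 * (Bu * Br)))" using p(3) by simp
      show "(\<lambda>x. (p x)\<^sup>2 * q t x) \<in> borel_measurable lborel" using q_meas[OF t] by simp
      show "AE x in lborel. norm ((p x)\<^sup>2 * q t x) \<le> norm ((p x)\<^sup>2 * (2 * (Bu * Br)))"
      proof (rule AE_I2)
        fix x
        have "norm ((p x)\<^sup>2 * q t x) \<le> (p x)\<^sup>2 * (2 * (Bu * Br))"
          unfolding real_norm_def abs_mult abs_power2 by (intro mult_left_mono q_bound t) simp
        then show "norm ((p x)\<^sup>2 * q t x) \<le> norm ((p x)\<^sup>2 * (2 * (Bu * Br)))"
          unfolding real_norm_def by linarith
      qed
    qed
    then have "integrable lborel (\<lambda>x. ?A x + ?S x)" unfolding pointwise .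
    \<comment> \<open>Integrability of the potential part is read off from that of the total and of
      the kinetic part.\<close>
    from Bochner_Integration.integrable_diff[OF this intA] have intS: "integrable lborel ?S"
      by (simp only: add_diff_cancel_left')
    have intS': "integrable lborel (\<lambda>x. norm (cnj (a k t x) * a j t x))" for j
      by (intro integrable_norm integrable_mult_square_integrable square_integrable_cnj sqa t)
    have a_le: "(LINT x|lborel. norm (cnj (a k t x) * a j t x)) \<le> l2 (a k t) * l2 (a j t)" for j
      using integral_norm_mult_le[OF square_integrable_cnj[OF sqa[OF t]] sqa[OF t]] by simp
    have "(LINT x|lborel. ?A x) = 2 * h * (LINT x|lborel. Im (cnj (a k t x) * b t x))"
    proof -
      have "(LINT x|lborel. Im (cnj (a k t x) * a (k + 2) t x)) = - 2 * (LINT x|lborel. Im (cnj (a k t x) * b t x))"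
        unfolding a_def b_def
        using integral_Im_second_derivative[OF p(1,2) p', of "Dn k (\<psi> t)" "Dn (Suc k) (\<psi> t)" "Dn (k + 2) (\<psi> t)"]
          square_integrable_solution[OF t] smooth_deriv[OF smooth_solution[OF t]] by simp
      then show ?thesis by simp
    qed
    moreover have "\<bar>LINT x|lborel. Im (cnj (a k t x) * b t x)\<bar> \<le> l2 (a k t) * l2 (b t)"
    proof -
      have i: "integrable lborel (\<lambda>x. cnj (a k t x) * b t x)"
        by (intro integrable_mult_square_integrable square_integrable_cnj sqa sqb t)
      have "\<bar>LINT x|lborel. Im (cnj (a k t x) * b t x)\<bar> \<le> norm (LINT x|lborel. cnj (a k t x) * b t x)"
        unfolding integral_Im[OF i] by (rule abs_Im_le_cmod)
      also have "\<dots> \<le> (LINT x|lborel. norm (cnj (a k t x) * b t x))" by (rule integral_norm_bound)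
      also have "\<dots> \<le> l2 (a k t) * l2 (b t)"
        using integral_norm_mult_le[OF square_integrable_cnj[OF sqa[OF t]] sqb[OF t]] by simp
      finally show ?thesis .
    qed
    ultimately have A: "\<bar>LINT x|lborel. ?A x\<bar> \<le> 2 * h * (l2 (a k t) * l2 (b t))"
      using h by (simp add: abs_mult)
    have "\<bar>LINT x|lborel. ?S x\<bar> \<le> (LINT x|lborel. \<bar>?S x\<bar>)"
      by (rule integral_abs_bound)
    also have "\<dots> \<le> (LINT x|lborel. ?S' x)"
    proof (rule integral_mono)
      show "integrable lborel (\<lambda>x. \<bar>?S x\<bar>)" by (rule integrable_abs[OF intS])
      show "integrable lborel ?S'"
        by (intro integrable_mult_right Bochner_Integration.integrable_sum intS')
      show "\<bar>?S x\<bar> \<le> ?S' x" for x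
      proof -
        have "\<bar>\<Sum>j<k. real (k choose Suc j) * (Dn (Suc j) (W t) x * Im (cnj (a k t x) * a (k - Suc j) t x))\<bar> \<le>
          (\<Sum>j<k. real (k choose Suc j) * (w j * norm (cnj (a k t x) * a (k - Suc j) t x)))"
          unfolding real_norm_def[symmetric]
        proof (rule sum_norm_le)
          fix j assume "j \<in> {..<k}"
          then show "norm (real (k choose Suc j) * (Dn (Suc j) (W t) x * Im (cnj (a k t x) * a (k - Suc j) t x))) \<le>
              real (k choose Suc j) * (w j * norm (cnj (a k t x) * a (k - Suc j) t x))"
            using w[OF _ t, of j x] w0[of j] abs_Im_le_cmod[of "cnj (a k t x) * a (k - Suc j) t x"]
            unfolding real_norm_def abs_mult abs_of_nat by (intro mult_left_mono mult_mono) auto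
        qed
        then have "(2 / h) * \<bar>\<Sum>j<k. real (k choose Suc j) * (Dn (Suc j) (W t) x * Im (cnj (a k t x) * a (k - Suc j) t x))\<bar> \<le> ?S' x"
          using h by (intro mult_left_mono) auto
        then show ?thesis using h by (simp only: abs_mult) simp
      qed
    qed
    also have "\<dots> = (2 / h) * (\<Sum>j<k. real (k choose Suc j) * (w j * (LINT x|lborel. norm (cnj (a k t x) * a (k - Suc j) t x))))"
      using Bochner_Integration.integral_sum[of "{..<k}" lborel
          "\<lambda>j x. real (k choose Suc j) * (w j * norm (cnj (a k t x) * a (k - Suc j) t x))"] intS'
      by (simp only: integral_mult_right_zero integrable_mult_right)
    also have "\<dots> \<le> (2 / h) * (\<Sum>j<k. real (k choose Suc j) * (w j * (l2 (a k t) * l2 (a (k - Suc j) t))))"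
      using h w0 a_le by (intro mult_left_mono sum_mono) auto
    finally have S: "\<bar>LINT x|lborel. ?S x\<bar> \<le> (2 / h) * (\<Sum>j<k. real (k choose Suc j) * (w j * (l2 (a k t) * l2 (a (k - Suc j) t))))" .
    have "(LINT x|lborel. (p x)\<^sup>2 * q t x) = (LINT x|lborel. ?A x) + (LINT x|lborel. ?S x)"
      unfolding pointwise by (rule Bochner_Integration.integral_add[OF intA intS])
    then have "\<bar>LINT x|lborel. (p x)\<^sup>2 * q t x\<bar> \<le> 2 * h * (l2 (a k t) * l2 (b t)) +
        (2 / h) * (\<Sum>j<k. real (k choose Suc j) * (w j * (l2 (a k t) * l2 (a (k - Suc j) t))))"
      using A S by linarith
    \<comment> \<open>Every term contains the factor \<open>l2 (a k t)\<close>, the square root of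
      the quantity being differentiated; this is the shape required by
      \<open>sqrt_growth\<close>.\<close>
    also have "\<dots> = 2 * l2 (a k t) * (h * l2 (b t) + (1 / h) * (\<Sum>j<k. real (k choose Suc j) * w j * l2 (a (k - Suc j) t)))"
      by (simp add: sum_distrib_left algebra_simps)
    also have "\<dots> \<le> 2 * l2 (a k t) * B"
      using B[OF t] by (intro mult_left_mono) (auto simp: a_def b_def)
    finally show ?thesis by (simp add: mult_ac)
  qed
  have "sqrt ((l2 (a k t))\<^sup>2) \<le> sqrt ((l2 (a k 0))\<^sup>2) + B * t"
    by (rule sqrt_growth[OF Y[unfolded Y_eq] _ Y' B0 t]) auto
  then show ?thesis by (simp add: a_def)
qed

end

section \<open>Bounds uniform in the parameters\<close>

text \<open>Fatou's lemma yields integrability of the limit together with its bound, neither being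
  known beforehand. It removes all cutoffs below.\<close>

lemma
  fixes g :: "nat \<Rightarrow> real \<Rightarrow> real"
  assumes g: "\<And>n. integrable lborel (g n)" "\<And>n x. 0 \<le> g n x" "\<And>n. (LINT x|lborel. g n x) \<le> C"
    and lim: "\<And>x. (\<lambda>n. g n x) \<longlonglongrightarrow> G x"
  shows integrable_Fatou: "integrable lborel G" and integral_Fatou: "(LINT x|lborel. G x) \<le> C"
proof -
  have [measurable]: "g n \<in> borel_measurable borel" for n
    using borel_measurable_integrable[OF g(1)] by simp
  have Gm [measurable]: "G \<in> borel_measurable borel"
    by (rule borel_measurable_LIMSEQ_real[OF lim]) simp
  have G0: "0 \<le> G x" for x
    using lim[of x] g(2) by (intro LIMSEQ_le_const) auto
  have "0 \<le> (LINT x|lborel. g 0 x)" using g(2) by (intro integral_nonneg_AE) auto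
  then have C: "0 \<le> C" using g(3)[of 0] by linarith
  have "(\<integral>\<^sup>+x. ennreal (G x) \<partial>lborel) = (\<integral>\<^sup>+x. liminf (\<lambda>n. ennreal (g n x)) \<partial>lborel)"
    using lim by (intro nn_integral_cong lim_imp_Liminf[symmetric] tendsto_ennrealI) auto
  also have "\<dots> \<le> liminf (\<lambda>n. \<integral>\<^sup>+x. ennreal (g n x) \<partial>lborel)"
    by (rule nn_integral_liminf) measurable
  also have "\<dots> \<le> ennreal C"
  proof (intro Liminf_le always_eventually allI)
    show "(\<integral>\<^sup>+x. ennreal (g n x) \<partial>lborel) \<le> ennreal C" for n
      using nn_integral_eq_integral[OF g(1), of n] g(2,3) by (simp add: ennreal_leI)
  qed simp
  finally have fin: "(\<integral>\<^sup>+x. ennreal (G x) \<partial>lborel) \<le> ennreal C" .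
  then show int: "integrable lborel G"
    using G0 by (intro integrableI_nonneg) (auto simp: top_unique le_less_trans)
  have "ennreal (LINT x|lborel. G x) \<le> ennreal C"
    using nn_integral_eq_integral[OF int] G0 fin by simp
  then show "(LINT x|lborel. G x) \<le> C" using C by (simp add: ennreal_le_iff)
qed

lemma
  fixes f :: "real \<Rightarrow> 'a::{banach, second_countable_topology}"
  assumes [measurable]: "f \<in> borel_measurable borel" "p \<in> borel_measurable borel"
    and sq: "\<And>n. square_integrable (\<lambda>x. q n x *\<^sub>R f x)" and C: "\<And>n::nat. l2 (\<lambda>x. q n x *\<^sub>R f x) \<le> C"
    and lim: "\<And>x. (\<lambda>n. q n x) \<longlonglongrightarrow> p x"
  shows square_integrable_Fatou: "square_integrable (\<lambda>x. p x *\<^sub>R f x)"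
    and l2_Fatou: "l2 (\<lambda>x. p x *\<^sub>R f x) \<le> C"
proof -
  have C0: "0 \<le> C" using C[of 0] l2_nonneg order_trans by blast
  have *: "integrable lborel (\<lambda>x. (norm (q n x *\<^sub>R f x))\<^sup>2)" "0 \<le> (norm (q n x *\<^sub>R f x))\<^sup>2"
    "(LINT x|lborel. (norm (q n x *\<^sub>R f x))\<^sup>2) \<le> C\<^sup>2"
    "(\<lambda>n. (norm (q n x *\<^sub>R f x))\<^sup>2) \<longlonglongrightarrow> (norm (p x *\<^sub>R f x))\<^sup>2" for n x
    using sq[of n] power_mono[OF C[of n] l2_nonneg, of 2] lim[of x]
    by (auto simp: square_integrable_def l2_power2 simp del: norm_scaleR intro!: tendsto_intros)
  show "square_integrable (\<lambda>x. p x *\<^sub>R f x)"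
    using integrable_Fatou[OF *] by (simp add: square_integrable_def)
  have "(l2 (\<lambda>x. p x *\<^sub>R f x))\<^sup>2 \<le> C\<^sup>2"
    using integral_Fatou[OF *] by (simp add: l2_power2)
  then show "l2 (\<lambda>x. p x *\<^sub>R f x) \<le> C" by (rule power2_le_imp_le) (rule C0)
qed

section \<open>A rational cutoff\<close>

lemma integrable_inverse_1_plus_power2:
  assumes "\<eta> \<noteq> 0"
  shows "integrable lborel (\<lambda>x::real. inverse (1 + (\<eta> * x)\<^sup>2))"
proof -
  have "integrable lborel (\<lambda>x::real. inverse (1 + x\<^sup>2))"
    using integrable_inverse_1_plus_square by (simp add: set_integrable_def)
  from lborel_integrable_real_affine[OF this assms, of 0] show ?thesis by simp
qed

text \<open>Decay of order 1/x^2 is fast enough for both \<open>cutoff \<eta> x\<close> and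
  \<open>x * cutoff \<eta> x\<close> to be bounded and square integrable, and the explicit form
  keeps the derivative bounds elementary.\<close>

definition cutoff :: "real \<Rightarrow> real \<Rightarrow> real" where
  "cutoff \<eta> x = inverse (1 + (\<eta> * x)\<^sup>2)"

definition cutoff' :: "real \<Rightarrow> real \<Rightarrow> real" where
  "cutoff' \<eta> x = - 2 * \<eta>\<^sup>2 * x * (cutoff \<eta> x)\<^sup>2"

lemma one_plus_power2_pos: "0 < 1 + (y::real)\<^sup>2"
  by (simp add: add_pos_nonneg)

lemma cutoff_bounds: "0 \<le> cutoff \<eta> x" "cutoff \<eta> x \<le> 1"
  using one_plus_power2_pos[of "\<eta> * x"] by (auto simp: cutoff_def inverse_le_1_iff)

lemma cutoff_deriv: "(cutoff \<eta> has_real_derivative cutoff' \<eta> x) (at x)"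
proof -
  have "1 + (\<eta> * x)\<^sup>2 \<noteq> 0" using one_plus_power2_pos[of "\<eta> * x"] by simp
  then show ?thesis unfolding cutoff'_def cutoff_def[abs_def]
    by (auto intro!: derivative_eq_intros simp: power2_eq_square)
qed

lemma abs_mult_cutoff_le: "\<bar>\<eta> * x\<bar> * cutoff \<eta> x \<le> 1"
proof -
  have "0 \<le> (\<bar>\<eta> * x\<bar> - 1)\<^sup>2" by simp
  then have "2 * \<bar>\<eta> * x\<bar> \<le> 1 + (\<eta> * x)\<^sup>2" by (simp add: power2_diff)
  moreover have "0 \<le> \<bar>\<eta> * x\<bar>" by simp
  ultimately have "\<bar>\<eta> * x\<bar> \<le> 1 + (\<eta> * x)\<^sup>2" by linarith
  then show ?thesis using one_plus_power2_pos[of "\<eta> * x"] by (simp add: cutoff_def field_simps)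
qed

text \<open>The derivative is small with \<eta>, so the kinetic contribution caused by the cutoff
  disappears in the limit.\<close>

lemma cutoff'_bound: "0 < \<eta> \<Longrightarrow> \<bar>cutoff' \<eta> x\<bar> \<le> 2 * \<eta>"
proof -
  assume \<eta>: "0 < \<eta>"
  have "\<bar>cutoff' \<eta> x\<bar> = 2 * \<eta> * (\<bar>\<eta> * x\<bar> * cutoff \<eta> x) * cutoff \<eta> x"
    using \<eta> cutoff_bounds[of \<eta> x] by (simp add: cutoff'_def abs_mult power2_eq_square)
  also have "\<dots> \<le> 2 * \<eta> * 1 * 1"
    using \<eta> abs_mult_cutoff_le[of \<eta> x] cutoff_bounds[of \<eta> x] by (intro mult_mono) auto
  finally show ?thesis by simp
qed

lemma cutoff_measurable [measurable]: "cutoff \<eta> \<in> borel_measurable borel" "cutoff' \<eta> \<in> borel_measurable borel"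
  unfolding cutoff'_def[abs_def] cutoff_def[abs_def] by measurable

lemma integrable_cutoff: "\<eta> \<noteq> 0 \<Longrightarrow> integrable lborel (cutoff \<eta>)"
  using integrable_inverse_1_plus_power2 by (simp add: cutoff_def[abs_def])

lemma integrable_cutoff_power2:
  assumes "\<eta> \<noteq> 0"
  shows "integrable lborel (\<lambda>x. (cutoff \<eta> x)\<^sup>2)"
proof (rule Bochner_Integration.integrable_bound[OF integrable_cutoff[OF assms]])
  have "(cutoff \<eta> x)\<^sup>2 \<le> cutoff \<eta> x" for x
    using cutoff_bounds[of \<eta> x] by (simp add: power2_eq_square mult_left_le)
  then show "AE x in lborel. norm ((cutoff \<eta> x)\<^sup>2) \<le> norm (cutoff \<eta> x)"
    using cutoff_bounds by simp
qed simp

lemma integrable_moment_cutoff_power2: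
  assumes "\<eta> \<noteq> 0"
  shows "integrable lborel (\<lambda>x. (x * cutoff \<eta> x)\<^sup>2)"
proof (rule Bochner_Integration.integrable_bound[OF integrable_mult_right[OF integrable_cutoff[OF assms], of "inverse (\<eta>\<^sup>2)"]])
  have "(x * cutoff \<eta> x)\<^sup>2 \<le> inverse (\<eta>\<^sup>2) * cutoff \<eta> x" for x
  proof -
    have "(\<eta> * x)\<^sup>2 * cutoff \<eta> x \<le> 1"
      using one_plus_power2_pos[of "\<eta> * x"] by (simp add: cutoff_def field_simps)
    then have "(\<eta> * x)\<^sup>2 * cutoff \<eta> x * cutoff \<eta> x \<le> 1 * cutoff \<eta> x"
      using cutoff_bounds by (intro mult_right_mono) auto
    then have "(x * cutoff \<eta> x)\<^sup>2 * \<eta>\<^sup>2 \<le> cutoff \<eta> x"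
      by (simp add: power2_eq_square mult_ac)
    then have "(x * cutoff \<eta> x)\<^sup>2 \<le> cutoff \<eta> x / \<eta>\<^sup>2"
      using assms by (subst pos_le_divide_eq) auto
    then show ?thesis by (simp add: divide_inverse mult.commute)
  qed
  then show "AE x in lborel. norm ((x * cutoff \<eta> x)\<^sup>2) \<le> norm (inverse (\<eta>\<^sup>2) * cutoff \<eta> x)"
    using cutoff_bounds by (simp add: abs_mult)
qed simp

lemma moment_cutoff_deriv:
  "((\<lambda>x. x * cutoff \<eta> x) has_real_derivative cutoff \<eta> x + x * cutoff' \<eta> x) (at x)"
  using DERIV_mult[OF DERIV_ident cutoff_deriv[of \<eta> x]] by (simp add: mult.commute add.commute)

text \<open>With z = (\<eta> x)^2 \<open>cutoff \<eta> x\<close> in [0,1] the derivative is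
  \<open>cutoff \<eta> x\<close> times 1 - 2 z. Unlike for the plain cutoff it does not become
  small, since the limiting weight x has derivative 1; this leaves the momentum term in the growth
  of the moment.\<close>

lemma moment_cutoff'_bound: "\<bar>cutoff \<eta> x + x * cutoff' \<eta> x\<bar> \<le> 1"
proof -
  let ?z = "(\<eta> * x)\<^sup>2 * cutoff \<eta> x"
  have "?z \<le> 1"
    using one_plus_power2_pos[of "\<eta> * x"] by (simp add: cutoff_def field_simps)
  moreover have "0 \<le> ?z" using cutoff_bounds(1) by simp
  ultimately have "\<bar>1 - 2 * ?z\<bar> \<le> 1" by linarith
  then have "cutoff \<eta> x * \<bar>1 - 2 * ?z\<bar> \<le> 1 * 1"
    using cutoff_bounds[of \<eta> x] by (intro mult_mono) auto
  moreover have "cutoff \<eta> x + x * cutoff' \<eta> x = cutoff \<eta> x * (1 - 2 * ?z)"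
    by (simp add: cutoff'_def power2_eq_square algebra_simps)
  ultimately show ?thesis using cutoff_bounds(1)[of \<eta> x] by (simp add: abs_mult)
qed

lemma cutoff_tendsto: "(\<lambda>n. cutoff (\<delta> / real (Suc n)) x) \<longlonglongrightarrow> 1"
proof -
  have "(\<lambda>n. \<delta> / real (Suc n)) \<longlonglongrightarrow> 0"
    using tendsto_mult[OF tendsto_const[of \<delta>] LIMSEQ_inverse_real_of_nat] by (simp add: divide_inverse)
  then have "(\<lambda>n. inverse (1 + (\<delta> / real (Suc n) * x)\<^sup>2)) \<longlonglongrightarrow> inverse (1 + (0 * x)\<^sup>2)"
    by (intro tendsto_intros) auto
  then show ?thesis by (simp add: cutoff_def)
qed

context nls
begin

lemma Dn_Suc_W_bound:
  assumes t: "t \<in> {0..T}" and N: "\<And>i. i \<le> j \<Longrightarrow> l2 (Dn i (\<psi> t)) \<le> N i"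
  shows "\<bar>Dn (Suc j) (W t) x\<bar> \<le> (\<Sum>i\<le>j. real (j choose i) * (N i * N (j - i)))"
proof -
  have N0: "0 \<le> N i" if "i \<le> j" for i using N[OF that] l2_nonneg order_trans by blast
  have "\<bar>Dn (Suc j) (W t) x\<bar> \<le> 1 * (LINT x|lborel. \<bar>Dn j (density_of (\<psi> t)) x\<bar>)"
    unfolding Dn_Suc_W[OF t]
    by (rule conv_bound[OF V'_measurable V'_bound[OF kappa eps] integrable_Dn_density_solution[OF t]])
  also have "\<dots> \<le> (\<Sum>i\<le>j. real (j choose i) * (l2 (Dn i (\<psi> t)) * l2 (Dn (j - i) (\<psi> t))))"
    using integral_Dn_density_le[OF H_infinity_solution[OF t]] by simp
  also have "\<dots> \<le> (\<Sum>i\<le>j. real (j choose i) * (N i * N (j - i)))"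
    using N N0 by (intro sum_mono mult_left_mono mult_mono) auto
  finally show ?thesis .
qed

text \<open>The energy estimate with a cutoff weight, whose parameter is then sent to 0. Every
  factor in the sum has order below k because the summand with undifferentiated potential is gone;
  for k = 0 the sum is empty, and the norm does not exceed its initial value.\<close>

lemma l2_Dn_step:
  assumes M: "\<And>i t. i < k \<Longrightarrow> t \<in> {0..T} \<Longrightarrow> h ^ i * l2 (Dn i (\<psi> t)) \<le> M i"
    and t: "t \<in> {0..T}"
  shows "h ^ k * l2 (Dn k (\<psi> t)) \<le> h ^ k * l2 (Dn k \<phi>) +
    (\<Sum>j<k. real (k choose Suc j) * (\<Sum>i\<le>j. real (j choose i) * (M i * M (j - i))) * M (k - Suc j)) * T"
proof -
  define Q where "Q = (\<lambda>j. \<Sum>i\<le>j. real (j choose i) * (M i * M (j - i)))"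
  define S where "S = (\<Sum>j<k. real (k choose Suc j) * Q j * M (k - Suc j))"
  have M0: "0 \<le> M i" if "i < k" for i
    using M[OF that, of 0] T h by (intro order_trans[OF _ M[OF that, of 0]]) auto
  have Q0: "0 \<le> Q j" if "j < k" for j
    unfolding Q_def using that by (intro sum_nonneg mult_nonneg_nonneg M0) auto
  have S0: "0 \<le> S"
    unfolding S_def by (intro sum_nonneg mult_nonneg_nonneg M0 Q0) auto
  have N: "l2 (Dn i (\<psi> t)) \<le> M i / h ^ i" if "i < k" "t \<in> {0..T}" for i t
    using M[OF that] h by (simp add: field_simps)
  have w: "\<bar>Dn (Suc j) (W t) x\<bar> \<le> Q j / h ^ j" if "j < k" "t \<in> {0..T}" for j t x
  proof -
    have "\<bar>Dn (Suc j) (W t) x\<bar> \<le> (\<Sum>i\<le>j. real (j choose i) * ((M i / h ^ i) * (M (j - i) / h ^ (j - i))))"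
      using that by (intro Dn_Suc_W_bound N) auto
    also have "\<dots> = Q j / h ^ j"
      unfolding Q_def sum_divide_distrib
    proof (intro sum.cong refl)
      fix i assume "i \<in> {..j}"
      then have "h ^ j = h ^ i * h ^ (j - i)" by (simp add: power_add[symmetric])
      then show "real (j choose i) * ((M i / h ^ i) * (M (j - i) / h ^ (j - i))) =
          real (j choose i) * (M i * M (j - i)) / h ^ j" by simp
    qed
    finally show ?thesis .
  qed
  \<comment> \<open>\<open>N'\<close> depends on h and \<epsilon>, but it occurs only multiplied by
    the cutoff parameter \<eta>.\<close>
  obtain N' where N': "\<And>k t. t \<in> {0..T} \<Longrightarrow> l2 (Dn k (\<psi> t)) \<le> N' k" "\<And>k. 0 \<le> N' k"
    using l2_bounded by blast
  have estimate: "l2 (\<lambda>x. cutoff \<eta> x *\<^sub>R Dn k (\<psi> t) x) \<le> l2 (Dn k \<phi>) + (2 * \<eta> * N' (Suc k) + S / h ^ k) * T"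
    if \<eta>: "0 < \<eta>" for \<eta>
  proof -
    have wle: "l2 (\<lambda>x. cutoff \<eta> x *\<^sub>R Dn j (\<psi> s) x) \<le> l2 (Dn j (\<psi> s))" if "s \<in> {0..T}" for j s
      using l2_weight_le[OF square_integrable_solution[OF that] cutoff_measurable(1), of \<eta> 1] cutoff_bounds[of \<eta>]
      by simp
    have "l2 (\<lambda>x. cutoff \<eta> x *\<^sub>R Dn k (\<psi> t) x) \<le>
        l2 (\<lambda>x. cutoff \<eta> x *\<^sub>R Dn k (\<psi> 0) x) + (2 * \<eta> * N' (Suc k) + S / h ^ k) * t"
    proof (rule energy_estimate[OF cutoff_deriv _ _ _ cutoff'_bound[OF \<eta>] w _ t])
      show "\<bar>cutoff \<eta> x\<bar> \<le> 1" for x using cutoff_bounds[of \<eta> x] by simp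
      fix s assume s: "s \<in> {0..T}"
      have "l2 (\<lambda>x. cutoff' \<eta> x *\<^sub>R Dn (Suc k) (\<psi> s) x) \<le> 2 * \<eta> * l2 (Dn (Suc k) (\<psi> s))"
        by (rule l2_weight_le[OF square_integrable_solution[OF s] _ cutoff'_bound[OF \<eta>]]) simp
      also have "\<dots> \<le> 2 * \<eta> * N' (Suc k)" using \<eta> N'(1)[OF s] by (intro mult_left_mono) auto
      finally have 1: "h * l2 (\<lambda>x. cutoff' \<eta> x *\<^sub>R Dn (Suc k) (\<psi> s) x) \<le> 2 * \<eta> * N' (Suc k)"
        using h mult_mono[of h 1 "l2 (\<lambda>x. cutoff' \<eta> x *\<^sub>R Dn (Suc k) (\<psi> s) x)" "2 * \<eta> * N' (Suc k)"] by simp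
      have "(1 / h) * (\<Sum>j<k. real (k choose Suc j) * (Q j / h ^ j) * l2 (\<lambda>x. cutoff \<eta> x *\<^sub>R Dn (k - Suc j) (\<psi> s) x)) \<le>
          (1 / h) * (\<Sum>j<k. real (k choose Suc j) * (Q j / h ^ j) * (M (k - Suc j) / h ^ (k - Suc j)))"
      proof (intro mult_left_mono sum_mono)
        fix j assume "j \<in> {..<k}"
        then show "l2 (\<lambda>x. cutoff \<eta> x *\<^sub>R Dn (k - Suc j) (\<psi> s) x) \<le> M (k - Suc j) / h ^ (k - Suc j)"
          "0 \<le> real (k choose Suc j) * (Q j / h ^ j)"
          using order_trans[OF wle[OF s] N[OF _ s]] Q0[of j] h by auto
      qed (use h in auto)
      also have "\<dots> = S / h ^ k"
        unfolding S_def sum_divide_distrib sum_distrib_left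
      proof (intro sum.cong refl)
        fix j assume "j \<in> {..<k}"
        \<comment> \<open>The field contributes h^j, the lower derivative h^(k - j - 1), and the
          factor 1/h of the equation exactly the missing power.\<close>
        then have "h ^ k = h * h ^ j * h ^ (k - Suc j)"
          by (simp add: power_add[symmetric] power_Suc[symmetric] del: power_Suc)
        then show "(1 / h) * (real (k choose Suc j) * (Q j / h ^ j) * (M (k - Suc j) / h ^ (k - Suc j))) =
            real (k choose Suc j) * Q j * M (k - Suc j) / h ^ k" by simp
      qed
      finally show "h * l2 (\<lambda>x. cutoff' \<eta> x *\<^sub>R Dn (Suc k) (\<psi> s) x) +
          (1 / h) * (\<Sum>j<k. real (k choose Suc j) * (Q j / h ^ j) * l2 (\<lambda>x. cutoff \<eta> x *\<^sub>R Dn (k - Suc j) (\<psi> s) x)) \<le>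
          2 * \<eta> * N' (Suc k) + S / h ^ k"
        using 1 by linarith
    qed (use \<eta> in \<open>auto intro: integrable_cutoff_power2\<close>)
    also have "\<dots> \<le> l2 (Dn k \<phi>) + (2 * \<eta> * N' (Suc k) + S / h ^ k) * T"
      using wle[of 0 k] T t \<eta> N'(2) S0 h unfolding initial
      by (intro add_mono mult_left_mono add_nonneg_nonneg) auto
    finally show ?thesis .
  qed
  have "l2 (Dn k (\<psi> t)) \<le> l2 (Dn k \<phi>) + S / h ^ k * T"
  proof (rule field_le_epsilon)
    fix e :: real assume e: "0 < e"
    \<comment> \<open>With this \<delta> the cutoff error 2 \<delta> \<open>N' (Suc k)\<close> T is
      at most e; the added 1 keeps \<open>D\<close> positive. All parameters \<delta>/(n+1) lie
      below \<delta>, so the same bound holds along the whole sequence.\<close>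
    define D where "D = N' (Suc k) * T + 1"
    define \<delta> where "\<delta> = e / (2 * D)"
    have D: "0 < D" using N'(2)[of "Suc k"] T by (simp add: D_def add_nonneg_pos)
    have \<delta>: "0 < \<delta>" using e D by (simp add: \<delta>_def)
    have "2 * \<delta> * (N' (Suc k) * T) \<le> 2 * \<delta> * D" using \<delta> by (simp add: D_def)
    also have "\<dots> = e" using D by (simp add: \<delta>_def)
    finally have \<delta>e: "2 * \<delta> * (N' (Suc k) * T) \<le> e" .
    have C: "l2 (\<lambda>x. cutoff (\<delta> / real (Suc n)) x *\<^sub>R Dn k (\<psi> t) x) \<le> l2 (Dn k \<phi>) + S / h ^ k * T + e" for n
    proof -
      have le: "\<delta> / real (Suc n) \<le> \<delta>" using \<delta> by (simp add: divide_le_eq mult_left_le)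
      have "l2 (\<lambda>x. cutoff (\<delta> / real (Suc n)) x *\<^sub>R Dn k (\<psi> t) x) \<le>
          l2 (Dn k \<phi>) + (2 * (\<delta> / real (Suc n)) * N' (Suc k) + S / h ^ k) * T"
        using \<delta> by (intro estimate) simp
      also have "\<dots> \<le> l2 (Dn k \<phi>) + (2 * \<delta> * N' (Suc k) + S / h ^ k) * T"
        using le N'(2)[of "Suc k"] T by (intro add_left_mono mult_right_mono add_right_mono mult_left_mono) auto
      also have "\<dots> \<le> l2 (Dn k \<phi>) + S / h ^ k * T + e" using \<delta>e by (simp add: algebra_simps)
      finally show ?thesis .
    qed
    have "l2 (\<lambda>x. 1 *\<^sub>R Dn k (\<psi> t) x) \<le> l2 (Dn k \<phi>) + S / h ^ k * T + e"
    proof (rule l2_Fatou[OF _ _ _ C cutoff_tendsto])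
      show "square_integrable (\<lambda>x. cutoff (\<delta> / real (Suc n)) x *\<^sub>R Dn k (\<psi> t) x)" for n
        by (rule square_integrable_weight[OF square_integrable_solution[OF t] cutoff_measurable(1), where P = 1])
          (use cutoff_bounds in simp)
    qed (use square_integrable_solution[OF t] in auto)
    then show "l2 (Dn k (\<psi> t)) \<le> l2 (Dn k \<phi>) + S / h ^ k * T + e" by simp
  qed
  then have "h ^ k * l2 (Dn k (\<psi> t)) \<le> h ^ k * (l2 (Dn k \<phi>) + S / h ^ k * T)"
    using h by (intro mult_left_mono) auto
  also have "\<dots> = h ^ k * l2 (Dn k \<phi>) + S * T" using h by (simp add: field_simps)
  finally show ?thesis by (simp add: S_def Q_def)
qed

text \<open>The energy estimate at k = 0 with a truncation of x as weight: multiplication by the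
  potential does not change the modulus, so the moment grows only through the momentum h times the
  first derivative.\<close>

lemma
  assumes M: "\<And>t. t \<in> {0..T} \<Longrightarrow> h * l2 (Dn 1 (\<psi> t)) \<le> M"
    and sq: "square_integrable (\<lambda>x. \<bar>x\<bar> *\<^sub>R \<phi> x)" and t: "t \<in> {0..T}"
  shows square_integrable_moment: "square_integrable (\<lambda>x. x *\<^sub>R \<psi> t x)"
    and l2_moment_le: "l2 (\<lambda>x. x *\<^sub>R \<psi> t x) \<le> l2 (\<lambda>x. \<bar>x\<bar> *\<^sub>R \<phi> x) + M * T"
proof -
  have M0: "0 \<le> M" using h T by (intro order_trans[OF _ M[of 0]]) auto
  have bound: "\<bar>x * cutoff \<eta> x\<bar> \<le> 1 / \<eta>" if "0 < \<eta>" for \<eta> x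
    using abs_mult_cutoff_le[of \<eta> x] cutoff_bounds[of \<eta> x] that by (simp add: abs_mult field_simps)
  have C: "l2 (\<lambda>x. (x * cutoff \<eta> x) *\<^sub>R \<psi> t x) \<le> l2 (\<lambda>x. \<bar>x\<bar> *\<^sub>R \<phi> x) + M * T" if \<eta>: "0 < \<eta>" for \<eta>
  proof -
    have "l2 (\<lambda>x. (x * cutoff \<eta> x) *\<^sub>R Dn 0 (\<psi> t) x) \<le> l2 (\<lambda>x. (x * cutoff \<eta> x) *\<^sub>R Dn 0 (\<psi> 0) x) + M * t"
    proof (rule energy_estimate[OF moment_cutoff_deriv bound[OF \<eta>] integrable_moment_cutoff_power2 _ moment_cutoff'_bound _ _ t])
      fix s assume s: "s \<in> {0..T}"
      have "l2 (\<lambda>x. (cutoff \<eta> x + x * cutoff' \<eta> x) *\<^sub>R Dn (Suc 0) (\<psi> s) x) \<le> 1 * l2 (Dn (Suc 0) (\<psi> s))"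
        by (rule l2_weight_le[OF square_integrable_solution[OF s] _ moment_cutoff'_bound]) simp
      then have "h * l2 (\<lambda>x. (cutoff \<eta> x + x * cutoff' \<eta> x) *\<^sub>R Dn (Suc 0) (\<psi> s) x) \<le> h * (1 * l2 (Dn 1 (\<psi> s)))"
        using h by (intro mult_left_mono) auto
      \<comment> \<open>At k = 0 the potential sum is empty, so the zero function serves as the
        bound \<open>w\<close>.\<close>
      then show "h * l2 (\<lambda>x. (cutoff \<eta> x + x * cutoff' \<eta> x) *\<^sub>R Dn (Suc 0) (\<psi> s) x) +
        (1 / h) * (\<Sum>j<0. real (0 choose Suc j) * (\<lambda>_. 0) j * l2 (\<lambda>x. (x * cutoff \<eta> x) *\<^sub>R Dn (0 - Suc j) (\<psi> s) x)) \<le> M"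
        using M[OF s] by simp
    qed (use \<eta> in auto)
    also have "l2 (\<lambda>x. (x * cutoff \<eta> x) *\<^sub>R Dn 0 (\<psi> 0) x) \<le> 1 * l2 (\<lambda>x. \<bar>x\<bar> *\<^sub>R \<phi> x)"
    proof (rule l2_mono[OF sq])
      have [measurable]: "\<phi> \<in> borel_measurable borel"
        using square_integrable_solution[of 0 0] T by (simp add: initial square_integrable_def)
      show "(\<lambda>x. (x * cutoff \<eta> x) *\<^sub>R Dn 0 (\<psi> 0) x) \<in> borel_measurable borel"
        unfolding initial Dn_0 by measurable
      show "norm ((x * cutoff \<eta> x) *\<^sub>R Dn 0 (\<psi> 0) x) \<le> 1 * norm (\<bar>x\<bar> *\<^sub>R \<phi> x)" for x
      proof -
        have "\<bar>x\<bar> * cutoff \<eta> x * norm (\<phi> x) \<le> \<bar>x\<bar> * 1 * norm (\<phi> x)"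
          using cutoff_bounds by (intro mult_right_mono mult_left_mono) auto
        then show ?thesis using cutoff_bounds[of \<eta> x] by (simp add: initial abs_mult)
      qed
    qed simp
    also have "M * t \<le> M * T" using M0 t by (intro mult_left_mono) auto
    finally show ?thesis by simp
  qed
  have sqn: "square_integrable (\<lambda>x. (x * cutoff (1 / real (Suc n)) x) *\<^sub>R \<psi> t x)" for n
    by (rule square_integrable_weight[OF square_integrable_solution[OF t, of 0, unfolded Dn_0] _ bound]) auto
  have lim: "(\<lambda>n. x * cutoff (1 / real (Suc n)) x) \<longlonglongrightarrow> x" for x
    using tendsto_mult[OF tendsto_const[of x] cutoff_tendsto[of 1 x]] by simp
  have Cn: "l2 (\<lambda>x. (x * cutoff (1 / real (Suc n)) x) *\<^sub>R \<psi> t x) \<le> l2 (\<lambda>x. \<bar>x\<bar> *\<^sub>R \<phi> x) + M * T" for n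
    by (rule C) simp
  have m: "\<psi> t \<in> borel_measurable borel" using square_integrable_solution[OF t, of 0] by (simp add: square_integrable_def)
  show "square_integrable (\<lambda>x. x *\<^sub>R \<psi> t x)"
    by (rule square_integrable_Fatou[OF m _ sqn Cn lim]) simp
  show "l2 (\<lambda>x. x *\<^sub>R \<psi> t x) \<le> l2 (\<lambda>x. \<bar>x\<bar> *\<^sub>R \<phi> x) + M * T"
    by (rule l2_Fatou[OF m _ sqn Cn lim]) simp
qed

end

section \<open>Weighted bounds for products of derivatives\<close>

lemma japanese_ge_1: "1 \<le> japanese x"
  by (simp add: japanese_def)

lemma japanese_measurable [measurable]: "japanese \<in> borel_measurable borel"
  unfolding japanese_def[abs_def] by measurable

lemma japanese_le: "japanese x \<le> 1 + \<bar>x\<bar>"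
  unfolding japanese_def by (rule real_le_lsqrt) (simp_all add: power2_sum)

lemma japanese_deriv: "(japanese has_real_derivative x / japanese x) (at x)"
proof -
  have "0 < 1 + x\<^sup>2" by (rule one_plus_power2_pos)
  moreover have "((\<lambda>x. 1 + x\<^sup>2) has_real_derivative 2 * x) (at x)"
    by (auto intro!: derivative_eq_intros)
  ultimately have "(japanese has_real_derivative inverse (japanese x) / 2 * (2 * x)) (at x)"
    unfolding japanese_def[abs_def] by (rule DERIV_chain2[OF DERIV_real_sqrt])
  moreover have "inverse j / 2 * (2 * x) = x / j" for j :: real
    by (simp add: inverse_eq_divide)
  ultimately show ?thesis by (simp only:)
qed

lemma japanese_deriv_bound: "\<bar>x / japanese x\<bar> \<le> 1"
proof -
  have "\<bar>x\<bar> \<le> japanese x" unfolding japanese_def by (rule real_le_rsqrt) simp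
  then show ?thesis using japanese_ge_1[of x] by (simp add: abs_divide)
qed

text \<open>A regularization of the Japanese bracket that is bounded by 1/\<delta>, converges to it
  from below, and has slope at most 1 for every \<delta>. Boundedness makes the integrations by
  parts legitimate before any weighted integral is known to be finite.\<close>

definition weight :: "real \<Rightarrow> real \<Rightarrow> real" where
  "weight \<delta> x = japanese x / (1 + \<delta> * japanese x)"

definition weight' :: "real \<Rightarrow> real \<Rightarrow> real" where
  "weight' \<delta> x = (x / japanese x) / (1 + \<delta> * japanese x)\<^sup>2"

context
  fixes \<delta> :: real
  assumes \<delta>: "0 < \<delta>"
begin

lemma weight_denominator_pos: "1 \<le> 1 + \<delta> * japanese x"
  using mult_nonneg_nonneg[of \<delta> "japanese x"] \<delta> japanese_ge_1[of x] by linarith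

lemma weight_nonneg: "0 \<le> weight \<delta> x"
  unfolding weight_def
  by (rule divide_nonneg_nonneg) (use weight_denominator_pos[of x] japanese_ge_1[of x] in linarith)+

lemma weight_le_japanese: "weight \<delta> x \<le> japanese x"
proof -
  have "japanese x * 1 \<le> japanese x * (1 + \<delta> * japanese x)"
    by (rule mult_left_mono[OF weight_denominator_pos]) (use japanese_ge_1[of x] in linarith)
  moreover have "0 < 1 + \<delta> * japanese x" using weight_denominator_pos[of x] by linarith
  ultimately show ?thesis
    unfolding weight_def by (simp only: pos_divide_le_eq mult_1_right)
qed

lemma weight_le: "weight \<delta> x \<le> 1 / \<delta>"
proof -
  have eq: "(1 / \<delta>) * (1 + \<delta> * japanese x) = 1 / \<delta> + japanese x"
    using \<delta> unfolding distrib_left by simp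
  have "japanese x \<le> (1 / \<delta>) * (1 + \<delta> * japanese x)"
    unfolding eq using \<delta> by simp
  moreover have "0 < 1 + \<delta> * japanese x" using weight_denominator_pos[of x] by linarith
  ultimately show ?thesis
    unfolding weight_def by (simp only: pos_divide_le_eq)
qed

lemma weight_deriv: "(weight \<delta> has_real_derivative weight' \<delta> x) (at x)"
proof -
  have nz: "1 + \<delta> * japanese x \<noteq> 0" using weight_denominator_pos[of x] by simp
  have "((\<lambda>x. 1 + \<delta> * japanese x) has_real_derivative \<delta> * (x / japanese x)) (at x)"
    using DERIV_add[OF DERIV_const[of 1] DERIV_cmult[OF japanese_deriv[of x], of \<delta>]] by simp
  from DERIV_divide[OF japanese_deriv[of x] this nz]
  have "((\<lambda>x. japanese x / (1 + \<delta> * japanese x)) has_real_derivative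
      (x / japanese x * (1 + \<delta> * japanese x) - japanese x * (\<delta> * (x / japanese x))) /
      ((1 + \<delta> * japanese x) * (1 + \<delta> * japanese x))) (at x)" .
  moreover have "a * (1 + \<delta> * j) - j * (\<delta> * a) = a" for a j :: real
    by (simp add: algebra_simps)
  ultimately show ?thesis
    unfolding weight_def[abs_def] weight'_def power2_eq_square by (simp only:)
qed

lemma weight'_bound: "\<bar>weight' \<delta> x\<bar> \<le> 1"
proof -
  have "1 \<le> (1 + \<delta> * japanese x)\<^sup>2" using weight_denominator_pos[of x] by (rule one_le_power)
  then have "\<bar>x / japanese x\<bar> / (1 + \<delta> * japanese x)\<^sup>2 \<le> 1"
    using japanese_deriv_bound[of x] by (subst pos_divide_le_eq) linarith+
  then show ?thesis
    unfolding weight'_def by (subst abs_divide) (simp only: abs_power2)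
qed

lemma weight_measurable [measurable]: "weight \<delta> \<in> borel_measurable borel" "weight' \<delta> \<in> borel_measurable borel"
  unfolding weight_def[abs_def] weight'_def[abs_def] by measurable

end

text \<open>One function at one time, without dynamics. Constants built from \<open>M\<close> and
  \<open>X\<close> alone are uniform over all \<open>h\<close> and \<open>u\<close> that satisfy
  these assumptions.\<close>

locale scaled_moment_bounds =
  fixes h :: real and u :: "real \<Rightarrow> complex" and M :: "nat \<Rightarrow> real" and X :: real
  assumes h: "0 < h" "h \<le> 1" and u: "H_infinity u"
    and M: "\<And>k. h ^ k * l2 (Dn k u) \<le> M k"
    and moment: "square_integrable (\<lambda>x. x *\<^sub>R u x)" "l2 (\<lambda>x. x *\<^sub>R u x) \<le> X"
begin

definition D :: "nat \<Rightarrow> real \<Rightarrow> complex" where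
  "D k x = h ^ k *\<^sub>R Dn k u x"

lemma square_integrable_D: "square_integrable (D k)"
  unfolding D_def[abs_def] by (intro square_integrable_scaleR H_infinity_square_integrable u)

lemma D_measurable [measurable]: "D k \<in> borel_measurable borel"
  using square_integrable_D by (simp add: square_integrable_def)

lemma l2_D: "l2 (D k) \<le> M k"
  unfolding D_def[abs_def] l2_scaleR[OF H_infinity_square_integrable[OF u]] using h M[of k] by simp

lemma M_nonneg: "0 \<le> M k"
  using l2_D[of k] l2_nonneg order_trans by blast

lemma D_deriv: "(D k has_vector_derivative (1 / h) *\<^sub>R D (Suc k) x) (at x)"
proof -
  have "(D k has_vector_derivative h ^ k *\<^sub>R Dn (Suc k) u x) (at x)"
    unfolding D_def[abs_def]
    by (intro bounded_linear.has_vector_derivative[OF bounded_linear_scaleR_right] smooth_deriv H_infinity_smooth u)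
  then show ?thesis using h by (simp add: D_def)
qed

lemma integral_D_mult_le:
  shows "integrable lborel (\<lambda>x. D a x * cnj (D b x))"
    and "(LINT x|lborel. norm (D a x * cnj (D b x))) \<le> M a * M b"
proof -
  show "integrable lborel (\<lambda>x. D a x * cnj (D b x))"
    by (intro integrable_mult_square_integrable square_integrable_cnj square_integrable_D)
  have "(LINT x|lborel. norm (D a x * cnj (D b x))) \<le> l2 (D a) * l2 (D b)"
    using integral_norm_mult_le[OF square_integrable_D[of a] square_integrable_cnj[OF square_integrable_D[of b]]] by simp
  also have "\<dots> \<le> M a * M b" by (intro mult_mono l2_D M_nonneg l2_nonneg)
  finally show "(LINT x|lborel. norm (D a x * cnj (D b x))) \<le> M a * M b" .
qed

lemma l2_weighted:
  assumes \<delta>: "0 < \<delta>"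
  shows "l2 (\<lambda>x. weight \<delta> x *\<^sub>R u x) \<le> M 0 + X"
proof -
  have sq: "square_integrable u" using square_integrable_D[of 0] by (simp add: D_def[abs_def])
  then have [measurable]: "u \<in> borel_measurable borel" by (simp add: square_integrable_def)
  have n: "square_integrable (\<lambda>x. norm (f x))" "l2 (\<lambda>x. norm (f x)) = l2 f"
    if "square_integrable f" for f :: "real \<Rightarrow> complex"
    using that by (auto simp: square_integrable_def l2_def)
  have "l2 (\<lambda>x. weight \<delta> x *\<^sub>R u x) \<le> 1 * l2 (\<lambda>x. norm (u x) + norm (x *\<^sub>R u x))"
  proof (rule l2_mono[OF square_integrable_add[OF n(1)[OF sq] n(1)[OF moment(1)]]])
    show "norm (weight \<delta> x *\<^sub>R u x) \<le> 1 * norm (norm (u x) + norm (x *\<^sub>R u x))" for x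
    proof -
      have "weight \<delta> x * norm (u x) \<le> (1 + \<bar>x\<bar>) * norm (u x)"
        using weight_le_japanese[OF \<delta>, of x] japanese_le[of x] by (intro mult_right_mono) auto
      then show ?thesis using weight_nonneg[OF \<delta>, of x] by (simp add: algebra_simps)
    qed
    show "(\<lambda>x. weight \<delta> x *\<^sub>R u x) \<in> borel_measurable borel"
      using weight_measurable[OF \<delta>] by measurable
  qed simp
  also have "\<dots> \<le> l2 u + l2 (\<lambda>x. x *\<^sub>R u x)"
    using l2_triangle[OF n(1)[OF sq] n(1)[OF moment(1)]] unfolding n(2)[OF sq] n(2)[OF moment(1)] by simp
  also have "\<dots> \<le> M 0 + X" using M[of 0] moment(2) by simp
  finally show ?thesis .
qed

text \<open>The bound of \<open>weighted_product_bound\<close> at b = a: the first term has all 2a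
  derivatives on one factor and the weight on \<open>u\<close>, the sum collects the derivatives of
  the weight.\<close>

definition C :: "nat \<Rightarrow> real" where
  "C a = M (2 * a) * (M 0 + X) + (\<Sum>i<a. M (a + i) * M (a - Suc i))"

text \<open>By induction on \<open>b\<close>, integration by parts trades one derivative on \<open>D b\<close> for one on \<open>D a\<close>.\<close>

lemma weighted_product_bound:
  assumes \<delta>: "0 < \<delta>"
  shows "norm (LINT x|lborel. weight \<delta> x *\<^sub>R (D a x * cnj (D b x))) \<le>
    M (a + b) * (M 0 + X) + (\<Sum>i<b. M (a + i) * M (b - Suc i))"
proof (induction b arbitrary: a)
  case 0
  have [measurable]: "u \<in> borel_measurable borel" using D_measurable[of 0] by (simp add: D_def[abs_def])
  have sqw: "square_integrable (\<lambda>x. weight \<delta> x *\<^sub>R u x)"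
    using square_integrable_weight[OF square_integrable_D[of 0] weight_measurable(1)[OF \<delta>], of "1 / \<delta>"]
      weight_nonneg[OF \<delta>] weight_le[OF \<delta>] by (simp add: D_def)
  have "norm (LINT x|lborel. weight \<delta> x *\<^sub>R (D a x * cnj (D 0 x))) =
      norm (LINT x|lborel. D a x * cnj (weight \<delta> x *\<^sub>R u x))"
    by (simp add: D_def mult.left_commute mult.commute)
  also have "\<dots> \<le> (LINT x|lborel. norm (D a x * cnj (weight \<delta> x *\<^sub>R u x)))"
    by (rule integral_norm_bound)
  also have "\<dots> \<le> l2 (D a) * l2 (\<lambda>x. weight \<delta> x *\<^sub>R u x)"
    using integral_norm_mult_le[OF square_integrable_D square_integrable_cnj[OF sqw]] unfolding l2_cnj .
  also have "\<dots> \<le> M a * (M 0 + X)"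
    by (intro mult_mono l2_D l2_weighted \<delta> M_nonneg l2_nonneg)
  finally show ?case by simp
next
  case (Suc b)
  let ?J = "\<lambda>a b. LINT x|lborel. weight \<delta> x *\<^sub>R (D a x * cnj (D b x))"
  let ?L = "LINT x|lborel. weight' \<delta> x *\<^sub>R (D a x * cnj (D b x))"
  have bounded: "integrable lborel (\<lambda>x. w x *\<^sub>R (D a x * cnj (D b x)))"
    if [measurable]: "w \<in> borel_measurable borel" and "\<And>x. \<bar>w x\<bar> \<le> B" for w B a b
  proof -
    have "integrable lborel (\<lambda>x. (w x *\<^sub>R D a x) * cnj (D b x))"
      by (intro integrable_mult_square_integrable square_integrable_cnj square_integrable_D
          square_integrable_weight[OF _ that])
    then show ?thesis by simp
  qed
  have iw: "integrable lborel (\<lambda>x. weight \<delta> x *\<^sub>R (D a x * cnj (D b x)))" for a b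
    using weight_nonneg[OF \<delta>] weight_le[OF \<delta>] by (intro bounded[of _ "1 / \<delta>"] weight_measurable \<delta>) simp
  have iw': "integrable lborel (\<lambda>x. weight' \<delta> x *\<^sub>R (D a x * cnj (D b x)))" for a b
    by (intro bounded[of _ 1] weight_measurable weight'_bound \<delta>)
  let ?F' = "\<lambda>x. weight' \<delta> x *\<^sub>R (D a x * cnj (D b x)) + (1 / h) *\<^sub>R (weight \<delta> x *\<^sub>R (D (Suc a) x * cnj (D b x)) +
      weight \<delta> x *\<^sub>R (D a x * cnj (D (Suc b) x)))"
  have deriv: "((\<lambda>x. weight \<delta> x *\<^sub>R (D a x * cnj (D b x))) has_vector_derivative ?F' x) (at x)" for x
  proof -
    have "((\<lambda>x. D a x * cnj (D b x)) has_vector_derivative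
        D a x * cnj ((1 / h) *\<^sub>R D (Suc b) x) + (1 / h) *\<^sub>R D (Suc a) x * cnj (D b x)) (at x)"
      by (intro has_vector_derivative_mult has_vector_derivative_cnj' D_deriv)
    from has_vector_derivative_scaleR[OF weight_deriv[OF \<delta>] this] show ?thesis
      by (simp add: algebra_simps)
  qed
  have "(LINT x|lborel. ?F' x) = 0"
    by (rule integral_derivative_eq_0[OF iw _ deriv])
      (intro Bochner_Integration.integrable_add integrable_scaleR_right iw iw')
  moreover have "(LINT x|lborel. ?F' x) = ?L + (1 / h) *\<^sub>R (?J (Suc a) b + ?J a (Suc b))"
    using iw iw' by (simp del: scaleR_conv_of_real real_scaleR_def)
  ultimately have zero: "?L + (1 / h) *\<^sub>R (?J (Suc a) b + ?J a (Suc b)) = 0" by simp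
  \<comment> \<open>Multiplication by h clears the 1/h of the scaled derivatives, so the term with
    the differentiated weight retains a harmless factor h \<le> 1.\<close>
  have solve: "z = - (h *\<^sub>R l) - y" if "l + (1 / h) *\<^sub>R (y + z) = 0" for l y z :: complex
  proof -
    have "h *\<^sub>R (l + (1 / h) *\<^sub>R (y + z)) = 0" unfolding that by simp
    then have "h *\<^sub>R l + (y + z) = 0" using h by (simp only: scaleR_add_right scaleR_scaleR) simp
    moreover have "z = (h *\<^sub>R l + (y + z)) - h *\<^sub>R l - y" by simp
    ultimately show ?thesis by simp
  qed
  from solve[OF zero] have "norm (?J a (Suc b)) \<le> h * norm ?L + norm (?J (Suc a) b)"
    using norm_triangle_ineq4[of "- (h *\<^sub>R ?L)" "?J (Suc a) b"] h by (simp only: norm_minus_cancel norm_scaleR abs_of_pos)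
  moreover have "norm ?L \<le> M a * M b"
  proof -
    have "norm ?L \<le> (LINT x|lborel. norm (weight' \<delta> x *\<^sub>R (D a x * cnj (D b x))))"
      by (rule integral_norm_bound)
    also have "\<dots> \<le> (LINT x|lborel. norm (D a x * cnj (D b x)))"
    proof (rule integral_mono[OF integrable_norm[OF iw'] integrable_norm[OF integral_D_mult_le(1)]])
      show "norm (weight' \<delta> x *\<^sub>R (D a x * cnj (D b x))) \<le> norm (D a x * cnj (D b x))" for x
        using mult_right_mono[OF weight'_bound[OF \<delta>, of x], of "norm (D a x * cnj (D b x))"] by simp
    qed
    finally show ?thesis using integral_D_mult_le(2)[of a b] by linarith
  qed
  then have "h * norm ?L \<le> 1 * (M a * M b)" using h by (intro mult_mono) auto
  moreover have "norm (?J (Suc a) b) \<le> M (Suc a + b) * (M 0 + X) + (\<Sum>i<b. M (Suc a + i) * M (b - Suc i))"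
    by (rule Suc)
  moreover have "(\<Sum>i<Suc b. M (a + i) * M (Suc b - Suc i)) = M a * M b + (\<Sum>i<b. M (Suc a + i) * M (b - Suc i))"
    by (subst sum.lessThan_Suc_shift) simp
  ultimately show ?case by simp
qed

text \<open>The bound for the regularized weight does not involve \<delta>, so \<delta> = 1/(n+1)
  may tend to 0 by Fatou's lemma.\<close>

lemma
  shows integrable_japanese_D_power2: "integrable lborel (\<lambda>x. japanese x * (norm (D a x))\<^sup>2)"
    and integral_japanese_D_power2_le: "(LINT x|lborel. japanese x * (norm (D a x))\<^sup>2) \<le> C a"
proof -
  let ?w = "\<lambda>n. weight (1 / real (Suc n))"
  have pos: "0 < 1 / real (Suc n)" for n by simp
  have sq: "integrable lborel (\<lambda>x. (norm (D a x))\<^sup>2)"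
    using square_integrable_D[of a] by (simp add: square_integrable_def)
  have 1: "integrable lborel (\<lambda>x. ?w n x * (norm (D a x))\<^sup>2)" for n
  proof (rule Bochner_Integration.integrable_bound[OF integrable_mult_right[OF sq, of "real (Suc n)"]])
    show "(\<lambda>x. ?w n x * (norm (D a x))\<^sup>2) \<in> borel_measurable lborel"
      using weight_measurable(1)[OF pos[of n]] by measurable
    have "?w n x * (norm (D a x))\<^sup>2 \<le> real (Suc n) * (norm (D a x))\<^sup>2" for x
      using weight_le[OF pos[of n], of x] by (intro mult_right_mono) auto
    then show "AE x in lborel. norm (?w n x * (norm (D a x))\<^sup>2) \<le> norm (real (Suc n) * (norm (D a x))\<^sup>2)"
      using weight_nonneg[OF pos[of n]] by (simp add: abs_mult)
  qed
  have 2: "0 \<le> ?w n x * (norm (D a x))\<^sup>2" for n x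
    using weight_nonneg[OF pos[of n], of x] by simp
  have 3: "(LINT x|lborel. ?w n x * (norm (D a x))\<^sup>2) \<le> C a" for n
  proof -
    have "complex_of_real (LINT x|lborel. ?w n x * (norm (D a x))\<^sup>2) =
        (LINT x|lborel. complex_of_real (?w n x * (norm (D a x))\<^sup>2))"
      by (rule integral_of_real[OF 1, symmetric])
    also have "\<dots> = (LINT x|lborel. ?w n x *\<^sub>R (D a x * cnj (D a x)))"
      by (simp add: complex_norm_square scaleR_conv_of_real del: of_real_power)
    finally have "norm (complex_of_real (LINT x|lborel. ?w n x * (norm (D a x))\<^sup>2)) \<le> C a"
      using weighted_product_bound[OF pos[of n], of a a] by (simp add: C_def mult_2)
    then show ?thesis by simp
  qed
  have 4: "(\<lambda>n. ?w n x * (norm (D a x))\<^sup>2) \<longlonglongrightarrow> japanese x * (norm (D a x))\<^sup>2" for x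
  proof -
    have "(\<lambda>n. japanese x / (1 + 1 / real (Suc n) * japanese x)) \<longlonglongrightarrow> japanese x / (1 + 0 * japanese x)"
      using LIMSEQ_inverse_real_of_nat by (intro tendsto_intros) (auto simp: divide_inverse)
    then have "(\<lambda>n. ?w n x) \<longlonglongrightarrow> japanese x" by (simp add: weight_def)
    then show ?thesis by (rule tendsto_mult[OF _ tendsto_const])
  qed
  show "integrable lborel (\<lambda>x. japanese x * (norm (D a x))\<^sup>2)"
    "(LINT x|lborel. japanese x * (norm (D a x))\<^sup>2) \<le> C a"
    using integrable_Fatou[OF 1 2 3 4] integral_Fatou[OF 1 2 3 4] by auto
qed

text \<open>The product of two moduli is at most the sum of their squares, so the diagonal estimates
  suffice.\<close>

lemma
  shows integrable_japanese_D: "integrable lborel (\<lambda>x. japanese x * norm (D a x * cnj (D b x)))"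
    and integral_japanese_D_le: "(LINT x|lborel. japanese x * norm (D a x * cnj (D b x))) \<le> C a + C b"
proof -
  let ?b = "\<lambda>x. japanese x * (norm (D a x))\<^sup>2 + japanese x * (norm (D b x))\<^sup>2"
  have b: "integrable lborel ?b"
    by (intro Bochner_Integration.integrable_add integrable_japanese_D_power2)
  have le: "japanese x * norm (D a x * cnj (D b x)) \<le> ?b x" for x
  proof -
    have "0 \<le> norm (D a x) * norm (D b x)" by simp
    then have "norm (D a x) * norm (D b x) \<le> (norm (D a x))\<^sup>2 + (norm (D b x))\<^sup>2"
      using sum_squares_bound[of "norm (D a x)" "norm (D b x)"] by linarith
    then have "japanese x * (norm (D a x) * norm (D b x)) \<le> japanese x * ((norm (D a x))\<^sup>2 + (norm (D b x))\<^sup>2)"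
      using japanese_ge_1[of x] by (intro mult_left_mono) auto
    then show ?thesis by (simp add: norm_mult distrib_left)
  qed
  have m: "(\<lambda>x. D a x * cnj (D b x)) \<in> borel_measurable borel"
    using borel_measurable_integrable[OF integral_D_mult_le(1)[of a b]] by simp
  show i: "integrable lborel (\<lambda>x. japanese x * norm (D a x * cnj (D b x)))"
  proof (rule Bochner_Integration.integrable_bound[OF b])
    show "(\<lambda>x. japanese x * norm (D a x * cnj (D b x))) \<in> borel_measurable lborel"
      using m by measurable
    show "AE x in lborel. norm (japanese x * norm (D a x * cnj (D b x))) \<le> norm (?b x)"
    proof (rule AE_I2)
      fix x
      have "norm (japanese x * norm (D a x * cnj (D b x))) = japanese x * norm (D a x * cnj (D b x))"
        using japanese_ge_1[of x] by (simp add: abs_mult)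
      then show "norm (japanese x * norm (D a x * cnj (D b x))) \<le> norm (?b x)"
        using le[of x] unfolding real_norm_def by linarith
    qed
  qed
  have "(LINT x|lborel. japanese x * norm (D a x * cnj (D b x))) \<le> (LINT x|lborel. ?b x)"
    by (rule integral_mono[OF i b le])
  also have "\<dots> = (LINT x|lborel. japanese x * (norm (D a x))\<^sup>2) + (LINT x|lborel. japanese x * (norm (D b x))\<^sup>2)"
    by (intro Bochner_Integration.integral_add integrable_japanese_D_power2)
  also have "\<dots> \<le> C a + C b" by (intro add_mono integral_japanese_D_power2_le)
  finally show "(LINT x|lborel. japanese x * norm (D a x * cnj (D b x))) \<le> C a + C b" .
qed

end

section \<open>Moments of the Wigner transform and the field\<close>

text \<open>Leibniz coefficients of the k-th y-derivative of the kernel at y = 0. The shifts by + h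
  y/2 and - h y/2 produce k powers of h in total, one for each derivative of the wave
  function.\<close>

definition moment_coeff :: "real \<Rightarrow> nat \<Rightarrow> nat \<Rightarrow> complex" where
  "moment_coeff h k j = (- \<i>) ^ k * complex_of_real (real (k choose j) * ((h / 2) ^ j * (- h / 2) ^ (k - j)))"

lemma wigner_moment_eq:
  assumes u: "smooth u"
  shows "wigner_moment k h u = (\<lambda>x. \<Sum>j\<le>k. moment_coeff h k j * (Dn j u x * cnj (Dn (k - j) u x)))"
proof
  fix x
  have eq: "wigner_kernel h u x = (\<lambda>y. u (x + (h / 2) * y) * cnj (u (x + (- h / 2) * y)))"
    by (simp add: wigner_kernel_def fun_eq_iff)
  note s1 = smooth_affine[OF u, of x "h / 2"] and s2 = smooth_affine[OF u, of x "- h / 2"]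
  have "Dn k (wigner_kernel h u x) 0 = (\<Sum>j\<le>k. real (k choose j) *\<^sub>R
      (((h / 2) ^ j *\<^sub>R Dn j u x) * cnj ((- h / 2) ^ (k - j) *\<^sub>R Dn (k - j) u x)))"
    unfolding eq Dn_mult[OF s1 smooth_cnj(1)[OF s2]] smooth_cnj(2)[OF s2] Dn_affine[OF u] by simp
  also have "(- \<i>) ^ k * \<dots> = (\<Sum>j\<le>k. moment_coeff h k j * (Dn j u x * cnj (Dn (k - j) u x)))"
    unfolding sum_distrib_left
    by (intro sum.cong refl) (simp add: moment_coeff_def scaleR_conv_of_real mult_ac)
  finally show "wigner_moment k h u x = (\<Sum>j\<le>k. moment_coeff h k j * (Dn j u x * cnj (Dn (k - j) u x)))"
    by (simp only: wigner_moment_def)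
qed

lemma
  assumes u: "smooth u"
  shows smooth_wigner_moment: "smooth (wigner_moment k h u)"
    and Dn_wigner_moment: "Dn \<alpha> (wigner_moment k h u) x = (\<Sum>j\<le>k. moment_coeff h k j *
      (\<Sum>i\<le>\<alpha>. real (\<alpha> choose i) *\<^sub>R (Dn (i + j) u x * cnj (Dn (\<alpha> - i + (k - j)) u x))))"
proof -
  have c: "smooth (\<lambda>x. cnj (Dn (k - j) u x))" for j
    by (rule smooth_cnj(1)[OF smooth_Dn[OF u]])
  have m: "smooth (\<lambda>x. Dn j u x * cnj (Dn (k - j) u x))" for j
    by (rule smooth_mult[OF smooth_Dn[OF u] c])
  have s: "smooth (\<lambda>x. moment_coeff h k j * (Dn j u x * cnj (Dn (k - j) u x)))" for j
    by (rule smooth_bounded_linear[OF bounded_linear_mult_right m])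
  show "smooth (wigner_moment k h u)"
    unfolding wigner_moment_eq[OF u] by (rule smooth_sum[OF s])
  show "Dn \<alpha> (wigner_moment k h u) x = (\<Sum>j\<le>k. moment_coeff h k j *
      (\<Sum>i\<le>\<alpha>. real (\<alpha> choose i) *\<^sub>R (Dn (i + j) u x * cnj (Dn (\<alpha> - i + (k - j)) u x))))"
    unfolding wigner_moment_eq[OF u] Dn_sum[OF s] Dn_bounded_linear[OF bounded_linear_mult_right m]
      Dn_mult[OF smooth_Dn[OF u] c] smooth_cnj(2)[OF smooth_Dn[OF u]] Dn_Dn ..
qed

context scaled_moment_bounds
begin

text \<open>Of the locale parameters only \<open>M\<close> and \<open>X\<close> enter, which is what
  makes this constant uniform.\<close>

definition K :: "nat \<Rightarrow> nat \<Rightarrow> real" where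
  "K k \<alpha> = (\<Sum>j\<le>k. \<Sum>i\<le>\<alpha>. real (k choose j) * real (\<alpha> choose i) * (C (i + j) + C (\<alpha> - i + (k - j))))"

text \<open>The \<alpha> powers of h in front and the k powers in \<open>moment_coeff\<close> match
  the total order \<alpha> + k of each product, so every derivative becomes a scaled one. The factor
  2^(-k) is dropped.\<close>

lemma norm_Dn_wigner_moment_le:
  "h ^ \<alpha> * norm (Dn \<alpha> (wigner_moment k h u) x) \<le>
    (\<Sum>j\<le>k. \<Sum>i\<le>\<alpha>. real (k choose j) * real (\<alpha> choose i) * norm (D (i + j) x * cnj (D (\<alpha> - i + (k - j)) x)))"
proof -
  note sm = H_infinity_smooth[OF u]
  have "h ^ \<alpha> * norm (Dn \<alpha> (wigner_moment k h u) x) =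
      norm (\<Sum>j\<le>k. h ^ \<alpha> *\<^sub>R (moment_coeff h k j *
      (\<Sum>i\<le>\<alpha>. real (\<alpha> choose i) *\<^sub>R (Dn (i + j) u x * cnj (Dn (\<alpha> - i + (k - j)) u x)))))"
    unfolding Dn_wigner_moment[OF sm] scaleR_right.sum[symmetric] using h by simp
  also have "\<dots> \<le> (\<Sum>j\<le>k. \<Sum>i\<le>\<alpha>. real (k choose j) * real (\<alpha> choose i) * norm (D (i + j) x * cnj (D (\<alpha> - i + (k - j)) x)))"
  proof (rule sum_norm_le)
    fix j assume j: "j \<in> {..k}"
    let ?f = "\<lambda>i. Dn (i + j) u x * cnj (Dn (\<alpha> - i + (k - j)) u x)"
    have "norm (moment_coeff h k j) = real (k choose j) * ((h / 2) ^ j * (h / 2) ^ (k - j))"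
      using h by (simp add: moment_coeff_def norm_mult norm_power abs_mult power_abs norm_divide)
    also have "\<dots> = real (k choose j) * (h / 2) ^ k"
      using j by (simp add: power_add[symmetric])
    also have "\<dots> \<le> real (k choose j) * h ^ k"
      using h by (intro mult_left_mono power_mono) auto
    finally have coeff: "norm (moment_coeff h k j) \<le> real (k choose j) * h ^ k" .
    have "norm (h ^ \<alpha> *\<^sub>R (moment_coeff h k j * (\<Sum>i\<le>\<alpha>. real (\<alpha> choose i) *\<^sub>R ?f i))) =
        h ^ \<alpha> * (norm (moment_coeff h k j) * norm (\<Sum>i\<le>\<alpha>. real (\<alpha> choose i) *\<^sub>R ?f i))"
      using h by (simp add: norm_mult)
    also have "\<dots> \<le> h ^ \<alpha> * ((real (k choose j) * h ^ k) * (\<Sum>i\<le>\<alpha>. real (\<alpha> choose i) * norm (?f i)))"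
    proof (intro mult_left_mono mult_mono coeff)
      show "norm (\<Sum>i\<le>\<alpha>. real (\<alpha> choose i) *\<^sub>R ?f i) \<le> (\<Sum>i\<le>\<alpha>. real (\<alpha> choose i) * norm (?f i))"
        by (rule sum_norm_le) simp
    qed (use h in auto)
    also have "\<dots> = (\<Sum>i\<le>\<alpha>. real (k choose j) * real (\<alpha> choose i) * (h ^ \<alpha> * h ^ k * norm (?f i)))"
      by (simp add: sum_distrib_left mult_ac)
    also have "\<dots> = (\<Sum>i\<le>\<alpha>. real (k choose j) * real (\<alpha> choose i) * norm (D (i + j) x * cnj (D (\<alpha> - i + (k - j)) x)))"
    proof (intro sum.cong refl)
      fix i assume "i \<in> {..\<alpha>}"
      then have "h ^ \<alpha> * h ^ k = h ^ (i + j) * h ^ (\<alpha> - i + (k - j))"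
        using j by (simp add: power_add[symmetric])
      then show "real (k choose j) * real (\<alpha> choose i) * (h ^ \<alpha> * h ^ k * norm (?f i)) =
          real (k choose j) * real (\<alpha> choose i) * norm (D (i + j) x * cnj (D (\<alpha> - i + (k - j)) x))"
        using h by (simp add: D_def norm_mult)
    qed
    finally show "norm (h ^ \<alpha> *\<^sub>R (moment_coeff h k j * (\<Sum>i\<le>\<alpha>. real (\<alpha> choose i) *\<^sub>R ?f i))) \<le>
        (\<Sum>i\<le>\<alpha>. real (k choose j) * real (\<alpha> choose i) * norm (D (i + j) x * cnj (D (\<alpha> - i + (k - j)) x)))" .
  qed
  finally show ?thesis .
qed

lemma wigner_moment_measurable [measurable]: "Dn \<alpha> (wigner_moment k h u) \<in> borel_measurable borel"
  by (rule smooth_measurable[OF smooth_wigner_moment[OF H_infinity_smooth[OF u]]])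

lemma
  shows integrable_wigner_moment: "integrable lborel (\<lambda>x. (japanese x * h ^ \<alpha>) *\<^sub>R Dn \<alpha> (wigner_moment k h u) x)"
    and integral_wigner_moment_le:
      "(LINT x|lborel. norm ((japanese x * h ^ \<alpha>) *\<^sub>R Dn \<alpha> (wigner_moment k h u) x)) \<le> K k \<alpha>"
proof -
  let ?c = "\<lambda>j i. real (k choose j) * real (\<alpha> choose i)"
  let ?n = "\<lambda>j i x. japanese x * norm (D (i + j) x * cnj (D (\<alpha> - i + (k - j)) x))"
  let ?S = "\<lambda>x. \<Sum>j\<le>k. \<Sum>i\<le>\<alpha>. ?c j i * ?n j i x"
  have S: "integrable lborel ?S"
    by (intro Bochner_Integration.integrable_sum integrable_mult_right integrable_japanese_D)
  have le: "norm ((japanese x * h ^ \<alpha>) *\<^sub>R Dn \<alpha> (wigner_moment k h u) x) \<le> ?S x" for x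
  proof -
    have j: "0 \<le> japanese x" using japanese_ge_1[of x] by linarith
    have "norm ((japanese x * h ^ \<alpha>) *\<^sub>R Dn \<alpha> (wigner_moment k h u) x) =
        japanese x * (h ^ \<alpha> * norm (Dn \<alpha> (wigner_moment k h u) x))"
      using j h by (simp add: abs_mult)
    also have "\<dots> \<le> japanese x * (\<Sum>j\<le>k. \<Sum>i\<le>\<alpha>. ?c j i * norm (D (i + j) x * cnj (D (\<alpha> - i + (k - j)) x)))"
      by (rule mult_left_mono[OF norm_Dn_wigner_moment_le j])
    also have "\<dots> = ?S x"
      unfolding sum_distrib_left by (intro sum.cong refl) (simp only: mult_ac)
    finally show ?thesis .
  qed
  show int: "integrable lborel (\<lambda>x. (japanese x * h ^ \<alpha>) *\<^sub>R Dn \<alpha> (wigner_moment k h u) x)"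
  proof (rule Bochner_Integration.integrable_bound[OF S])
    show "AE x in lborel. norm ((japanese x * h ^ \<alpha>) *\<^sub>R Dn \<alpha> (wigner_moment k h u) x) \<le> norm (?S x)"
      by (rule AE_I2, rule order_trans[OF le]) simp
  qed measurable
  have "(LINT x|lborel. norm ((japanese x * h ^ \<alpha>) *\<^sub>R Dn \<alpha> (wigner_moment k h u) x)) \<le> (LINT x|lborel. ?S x)"
    by (rule integral_mono[OF integrable_norm[OF int] S le])
  also have "\<dots> = (\<Sum>j\<le>k. \<Sum>i\<le>\<alpha>. ?c j i * (LINT x|lborel. ?n j i x))"
  proof -
    have "(LINT x|lborel. ?S x) = (\<Sum>j\<le>k. LINT x|lborel. (\<Sum>i\<le>\<alpha>. ?c j i * ?n j i x))"
      by (rule Bochner_Integration.integral_sum)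
        (intro Bochner_Integration.integrable_sum integrable_mult_right integrable_japanese_D)
    also have "\<dots> = (\<Sum>j\<le>k. \<Sum>i\<le>\<alpha>. LINT x|lborel. ?c j i * ?n j i x)"
      by (intro sum.cong refl Bochner_Integration.integral_sum integrable_mult_right integrable_japanese_D)
    finally show ?thesis by (simp only: integral_mult_right_zero)
  qed
  also have "\<dots> \<le> K k \<alpha>"
    unfolding K_def by (intro sum_mono mult_left_mono integral_japanese_D_le) simp
  finally show "(LINT x|lborel. norm ((japanese x * h ^ \<alpha>) *\<^sub>R Dn \<alpha> (wigner_moment k h u) x)) \<le> K k \<alpha>" .
qed

lemma L1_norm_wigner_moment:
  "L1_norm (\<lambda>x. (japanese x * h ^ \<alpha>) *\<^sub>R Dn \<alpha> (wigner_moment k h u) x) \<le> ennreal (K k \<alpha>)"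
  unfolding L1_norm_def if_P[OF integrable_wigner_moment] by (rule ennreal_leI[OF integral_wigner_moment_le])

text \<open>The function is bounded by the integral of its derivative. Differentiating the moment
  raises the order to \<alpha> + 1 and consumes the extra power of h; differentiating the weight
  leaves order \<alpha>, where the spare h is at most 1 and the slope of the weight is at most the
  weight itself.\<close>

lemma Linf_norm_wigner_moment:
  "Linf_norm (\<lambda>x. (japanese x * h ^ (\<alpha> + 1)) *\<^sub>R Dn \<alpha> (wigner_moment k h u) x) \<le> ennreal (K k \<alpha> + K k (Suc \<alpha>))"
proof -
  let ?m = "\<lambda>\<alpha>. Dn \<alpha> (wigner_moment k h u)"
  let ?G = "\<lambda>\<alpha> x. (japanese x * h ^ \<alpha>) *\<^sub>R ?m \<alpha> x"
  let ?F = "\<lambda>x. (japanese x * h ^ (\<alpha> + 1)) *\<^sub>R ?m \<alpha> x"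
  let ?P = "\<lambda>x. (x / japanese x * h ^ (\<alpha> + 1)) *\<^sub>R ?m \<alpha> x"
  have P_le: "norm (?P x) \<le> norm (?G \<alpha> x)" for x
  proof -
    have "\<bar>x / japanese x\<bar> * h \<le> japanese x * 1"
      using japanese_deriv_bound[of x] japanese_ge_1[of x] h by (intro mult_mono) linarith+
    then have "\<bar>x / japanese x\<bar> * h * (h ^ \<alpha> * norm (?m \<alpha> x)) \<le> japanese x * 1 * (h ^ \<alpha> * norm (?m \<alpha> x))"
      using h by (intro mult_right_mono) auto
    moreover have "norm (?P x) = \<bar>x / japanese x\<bar> * h * (h ^ \<alpha> * norm (?m \<alpha> x))"
      unfolding norm_scaleR abs_mult using h by simp
    moreover have "norm (?G \<alpha> x) = japanese x * 1 * (h ^ \<alpha> * norm (?m \<alpha> x))"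
      unfolding norm_scaleR abs_mult using h japanese_ge_1[of x] by simp
    ultimately show ?thesis by linarith
  qed
  have P: "integrable lborel ?P"
  proof (rule Bochner_Integration.integrable_bound[OF integrable_wigner_moment[of \<alpha> k]])
    show "AE x in lborel. norm (?P x) \<le> norm (?G \<alpha> x)"
      by (rule AE_I2) (rule P_le)
  qed measurable
  have F: "integrable lborel ?F"
    using integrable_scaleR_right[OF integrable_wigner_moment[of \<alpha> k], of h] by (simp add: mult_ac)
  have deriv: "(?F has_vector_derivative ?P x + ?G (Suc \<alpha>) x) (at x)" for x
  proof -
    have "((\<lambda>x. japanese x * h ^ (\<alpha> + 1)) has_real_derivative x / japanese x * h ^ (\<alpha> + 1)) (at x)"
      by (rule DERIV_cmult_right[OF japanese_deriv])
    from has_vector_derivative_scaleR[OF this smooth_deriv[OF smooth_wigner_moment[OF H_infinity_smooth[OF u]]]]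
    show ?thesis by (simp add: add.commute)
  qed
  have "norm (?F x) \<le> K k \<alpha> + K k (Suc \<alpha>)" for x
  proof -
    have "norm (?F x) \<le> (LINT x|lborel. norm (?P x + ?G (Suc \<alpha>) x))"
      by (rule norm_le_integral_derivative[OF F _ deriv])
        (intro Bochner_Integration.integrable_add P integrable_wigner_moment)
    also have "\<dots> \<le> (LINT x|lborel. norm (?G \<alpha> x) + norm (?G (Suc \<alpha>) x))"
    proof (rule integral_mono)
      show "norm (?P x + ?G (Suc \<alpha>) x) \<le> norm (?G \<alpha> x) + norm (?G (Suc \<alpha>) x)" for x
        using norm_triangle_ineq[of "?P x" "?G (Suc \<alpha>) x"] P_le[of x] by linarith
    qed (intro integrable_norm Bochner_Integration.integrable_add P integrable_wigner_moment)+
    also have "\<dots> = (LINT x|lborel. norm (?G \<alpha> x)) + (LINT x|lborel. norm (?G (Suc \<alpha>) x))"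
      by (intro Bochner_Integration.integral_add integrable_norm integrable_wigner_moment)
    also have "\<dots> \<le> K k \<alpha> + K k (Suc \<alpha>)" by (intro add_mono integral_wigner_moment_le)
    finally show ?thesis .
  qed
  then show ?thesis
    unfolding Linf_norm_def by (intro esssup_I AE_I2 ennreal_leI) measurable
qed

end

context nls
begin

lemma
  assumes t: "t \<in> {0..T}"
  shows smooth_E_field: "smooth (E_field \<kappa> \<epsilon> (\<psi> t))"
    and Dn_E_field: "Dn k (E_field \<kappa> \<epsilon> (\<psi> t)) = Dn (Suc k) (W t)"
proof -
  have eq: "E_field \<kappa> \<epsilon> (\<psi> t) = conv (V' \<kappa> \<epsilon>) (density_of (\<psi> t))"
    unfolding E_field_def
    by (rule conv_deriv_V[OF kappa eps smooth_measurable0[OF smooth_density_solution[OF t]]])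
  show "smooth (E_field \<kappa> \<epsilon> (\<psi> t))"
    unfolding eq by (rule smooth_conv[OF V'_measurable V'_bound[OF kappa eps] smooth_density_solution[OF t]
        integrable_Dn_density_solution[OF t]])
  show "Dn k (E_field \<kappa> \<epsilon> (\<psi> t)) = Dn (Suc k) (W t)"
    unfolding eq Dn_Suc_W[OF t]
    by (rule Dn_conv[OF V'_measurable V'_bound[OF kappa eps] smooth_density_solution[OF t]
        integrable_Dn_density_solution[OF t]])
qed

text \<open>The field is the first derivative of W, so the bound that drives the energy estimate
  gives the claim after rescaling.\<close>

lemma Linf_norm_E_field:
  assumes t: "t \<in> {0..T}" and M: "\<And>i. h ^ i * l2 (Dn i (\<psi> t)) \<le> M i"
  shows "Linf_norm (\<lambda>x. h ^ k *\<^sub>R Dn k (E_field \<kappa> \<epsilon> (\<psi> t)) x) \<le>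
    ennreal (\<Sum>i\<le>k. real (k choose i) * (M i * M (k - i)))"
proof -
  have "\<bar>h ^ k *\<^sub>R Dn k (E_field \<kappa> \<epsilon> (\<psi> t)) x\<bar> \<le> (\<Sum>i\<le>k. real (k choose i) * (M i * M (k - i)))" for x
  proof -
    have "l2 (Dn i (\<psi> t)) \<le> M i / h ^ i" for i
      using M[of i] h by (simp add: field_simps)
    then have "\<bar>Dn (Suc k) (W t) x\<bar> \<le> (\<Sum>i\<le>k. real (k choose i) * ((M i / h ^ i) * (M (k - i) / h ^ (k - i))))"
      by (rule Dn_Suc_W_bound[OF t])
    then have "h ^ k * \<bar>Dn (Suc k) (W t) x\<bar> \<le>
        h ^ k * (\<Sum>i\<le>k. real (k choose i) * ((M i / h ^ i) * (M (k - i) / h ^ (k - i))))"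
      using h by (intro mult_left_mono) auto
    also have "\<dots> = (\<Sum>i\<le>k. real (k choose i) * (M i * M (k - i)))"
      unfolding sum_distrib_left
    proof (intro sum.cong refl)
      fix i assume "i \<in> {..k}"
      then have "h ^ k = h ^ i * h ^ (k - i)" by (simp add: power_add[symmetric])
      then show "h ^ k * (real (k choose i) * ((M i / h ^ i) * (M (k - i) / h ^ (k - i)))) =
          real (k choose i) * (M i * M (k - i))" using h by simp
    qed
    finally show ?thesis unfolding Dn_E_field[OF t] using h by (simp add: abs_mult)
  qed
  moreover have "Dn k (E_field \<kappa> \<epsilon> (\<psi> t)) \<in> borel_measurable borel"
    by (rule smooth_measurable[OF smooth_E_field[OF t]])
  ultimately show ?thesis
    unfolding Linf_norm_def real_norm_def by (intro esssup_I AE_I2 ennreal_leI) auto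
qed

end

text \<open>\<open>ennreal\<close> sends negative numbers to 0, so passing to the absolute value
  covers either sign of \<open>C\<^sub>0\<close>.\<close>

lemma L2_norm_le_abs:
  assumes "L2_norm f \<le> ennreal c"
  shows "square_integrable f" "l2 f \<le> \<bar>c\<bar>"
proof -
  have "L2_norm f \<le> ennreal \<bar>c\<bar>" using assms by (rule order_trans) (simp add: ennreal_leI)
  then show "square_integrable f" "l2 f \<le> \<bar>c\<bar>"
    by (rule L2_norm_le_square_integrable L2_norm_le_l2[OF _ abs_ge_zero])+
qed

text \<open>The order of quantifiers is the point: \<open>m\<close> is chosen before h, \<epsilon>
  and t. In the induction step it is assembled from \<open>C\<^sub>0\<close>, k, T and the bounds
  already chosen for lower orders.\<close>

lemma uniform_l2_bound:
  fixes \<kappa> C\<^sub>0 T :: real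
  assumes datum: "\<And>h. h \<in> {0<..1} \<Longrightarrow> admissible_datum C\<^sub>0 h (\<psi>in h)"
    and nls: "\<And>h \<epsilon>. h \<in> {0<..1} \<Longrightarrow> \<epsilon> \<in> {0<..1} \<Longrightarrow> nls \<kappa> h \<epsilon> T (\<psi>in h) (\<psi> h \<epsilon>)"
  shows "\<exists>m. \<forall>h\<in>{0<..1}. \<forall>\<epsilon>\<in>{0<..1}. \<forall>t\<in>{0..T}. h ^ k * l2 (Dn k (\<psi> h \<epsilon> t)) \<le> m"
proof (induction k rule: less_induct)
  case (less k)
  then obtain M where M: "\<And>i h \<epsilon> t. i < k \<Longrightarrow> h \<in> {0<..1} \<Longrightarrow> \<epsilon> \<in> {0<..1} \<Longrightarrow> t \<in> {0..T} \<Longrightarrow>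
      h ^ i * l2 (Dn i (\<psi> h \<epsilon> t)) \<le> M i"
    by metis
  let ?S = "\<Sum>j<k. real (k choose Suc j) * (\<Sum>i\<le>j. real (j choose i) * (M i * M (j - i))) * M (k - Suc j)"
  show ?case
  proof (intro exI ballI)
    fix h \<epsilon> t assume h01: "h \<in> {0<..1::real}" and \<epsilon>: "\<epsilon> \<in> {0<..1::real}" and t: "t \<in> {0..T}"
    interpret nls \<kappa> h \<epsilon> T "\<psi>in h" "\<psi> h \<epsilon>" by (rule nls[OF h01 \<epsilon>])
    have "L2_norm (\<lambda>x. h ^ k *\<^sub>R Dn k (\<psi>in h) x) \<le> ennreal (C\<^sub>0 ^ k * real k ^ k)"
      using datum[OF h01] by (simp add: admissible_datum_def)
    then have "l2 (\<lambda>x. h ^ k *\<^sub>R Dn k (\<psi>in h) x) \<le> \<bar>C\<^sub>0 ^ k * real k ^ k\<bar>" by (rule L2_norm_le_abs)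
    moreover have "square_integrable (Dn k (\<psi>in h))"
      using square_integrable_solution[of 0 k] T by (simp add: initial)
    ultimately have "h ^ k * l2 (Dn k (\<psi>in h)) \<le> \<bar>C\<^sub>0 ^ k * real k ^ k\<bar>"
      using h by (simp add: l2_scaleR)
    then show "h ^ k * l2 (Dn k (\<psi> h \<epsilon> t)) \<le> \<bar>C\<^sub>0 ^ k * real k ^ k\<bar> + ?S * T"
      using l2_Dn_step[where k = k and M = M, OF M[OF _ h01 \<epsilon>] t] by simp
  qed
qed

theorem lemma3p2:
  fixes \<kappa> C\<^sub>0 T :: real
    and \<psi>in :: "real \<Rightarrow> real \<Rightarrow> complex"
    and \<psi> :: "real \<Rightarrow> real \<Rightarrow> real \<Rightarrow> real \<Rightarrow> complex"
  assumes "\<kappa> = 1 \<or> \<kappa> = -1"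
    and "T > 0"
    and "\<And>h. h \<in> {0<..1} \<Longrightarrow> admissible_datum C\<^sub>0 h (\<psi>in h)"
    and "\<And>h \<epsilon>. h \<in> {0<..1} \<Longrightarrow> \<epsilon> \<in> {0<..1} \<Longrightarrow> nls_solution \<kappa> h \<epsilon> T (\<psi>in h) (\<psi> h \<epsilon>)"
  shows "(\<forall>h\<in>{0<..1}. \<forall>\<epsilon>\<in>{0<..1}. \<forall>t\<in>{0..T}.
           (\<forall>k. smooth (wigner_moment k h (\<psi> h \<epsilon> t))) \<and> smooth (E_field \<kappa> \<epsilon> (\<psi> h \<epsilon> t)))
          \<and> (\<exists>C :: nat \<Rightarrow> nat \<Rightarrow> real \<Rightarrow> real.
           \<forall>k \<alpha>. \<forall>t\<in>{0..T}. \<forall>h\<in>{0<..1}. \<forall>\<epsilon>\<in>{0<..1}.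
             Linf_norm (\<lambda>x. (japanese x * h ^ (\<alpha> + 1)) *\<^sub>R
                 Dn \<alpha> (wigner_moment k h (\<psi> h \<epsilon> t)) x) \<le> ennreal (C k \<alpha> t))
          \<and> (\<exists>C :: nat \<Rightarrow> nat \<Rightarrow> real \<Rightarrow> real.
           \<forall>k \<alpha>. \<forall>t\<in>{0..T}. \<forall>h\<in>{0<..1}. \<forall>\<epsilon>\<in>{0<..1}.
             L1_norm (\<lambda>x. (japanese x * h ^ \<alpha>) *\<^sub>R
                 Dn \<alpha> (wigner_moment k h (\<psi> h \<epsilon> t)) x) \<le> ennreal (C k \<alpha> t))
          \<and> (\<exists>C :: nat \<Rightarrow> real \<Rightarrow> real.
           \<forall>k. \<forall>t\<in>{0..T}. \<forall>h\<in>{0<..1}. \<forall>\<epsilon>\<in>{0<..1}.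
             Linf_norm (\<lambda>x. h ^ k *\<^sub>R Dn k (E_field \<kappa> \<epsilon> (\<psi> h \<epsilon> t)) x) \<le> ennreal (C k t))"
proof -
  have nls: "nls \<kappa> h \<epsilon> T (\<psi>in h) (\<psi> h \<epsilon>)" if "h \<in> {0<..1}" "\<epsilon> \<in> {0<..1}" for h \<epsilon>
    using assms(1,2) assms(4)[OF that] that by (intro nls.intro) auto
  obtain M where M: "\<And>k h \<epsilon> t. h \<in> {0<..1} \<Longrightarrow> \<epsilon> \<in> {0<..1} \<Longrightarrow> t \<in> {0..T} \<Longrightarrow>
      h ^ k * l2 (Dn k (\<psi> h \<epsilon> t)) \<le> M k"
    using uniform_l2_bound[OF assms(3) nls] by metis
  \<comment> \<open>The initial first moment plus transport for time T at a rate of at most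
    \<open>M 1\<close>.\<close>
  define X where "X = \<bar>C\<^sub>0\<bar> + M 1 * T"
  have bounds: "scaled_moment_bounds h (\<psi> h \<epsilon> t) M X"
    if h01: "h \<in> {0<..1}" and \<epsilon>: "\<epsilon> \<in> {0<..1}" and t: "t \<in> {0..T}" for h \<epsilon> t
  proof -
    interpret nls \<kappa> h \<epsilon> T "\<psi>in h" "\<psi> h \<epsilon>" by (rule nls[OF h01 \<epsilon>])
    have "L2_norm (\<lambda>x. \<bar>x\<bar> *\<^sub>R \<psi>in h x) \<le> ennreal C\<^sub>0"
      using assms(3)[OF h01] by (simp add: admissible_datum_def)
    note x = L2_norm_le_abs[OF this]
    have M1: "h * l2 (Dn 1 (\<psi> h \<epsilon> s)) \<le> M 1" if "s \<in> {0..T}" for s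
      using M[OF h01 \<epsilon> that, of 1] by simp
    show ?thesis
    proof
      show "0 < h" "h \<le> 1" using h by auto
      show "H_infinity (\<psi> h \<epsilon> t)" by (rule H_infinity_solution[OF t])
      show "h ^ k * l2 (Dn k (\<psi> h \<epsilon> t)) \<le> M k" for k by (rule M[OF h01 \<epsilon> t])
      show "square_integrable (\<lambda>x. x *\<^sub>R \<psi> h \<epsilon> t x)" by (rule square_integrable_moment[OF M1 x(1) t])
      show "l2 (\<lambda>x. x *\<^sub>R \<psi> h \<epsilon> t x) \<le> X"
        using l2_moment_le[OF M1 x(1) t] x(2) by (simp add: X_def)
    qed
  qed
  \<comment> \<open>Outside its locale \<open>K\<close> takes only \<open>M\<close> and
    \<open>X\<close> as parameters, so the witness can be named before h, \<epsilon> and t are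
    fixed.\<close>
  let ?K = "scaled_moment_bounds.K M X"
  show ?thesis
  proof (intro conjI)
    show "\<forall>h\<in>{0<..1}. \<forall>\<epsilon>\<in>{0<..1}. \<forall>t\<in>{0..T}.
        (\<forall>k. smooth (wigner_moment k h (\<psi> h \<epsilon> t))) \<and> smooth (E_field \<kappa> \<epsilon> (\<psi> h \<epsilon> t))"
      using smooth_wigner_moment[OF nls.smooth_solution[OF nls]] nls.smooth_E_field[OF nls] by blast
    show "\<exists>C :: nat \<Rightarrow> nat \<Rightarrow> real \<Rightarrow> real. \<forall>k \<alpha>. \<forall>t\<in>{0..T}. \<forall>h\<in>{0<..1}. \<forall>\<epsilon>\<in>{0<..1}.
        Linf_norm (\<lambda>x. (japanese x * h ^ (\<alpha> + 1)) *\<^sub>R Dn \<alpha> (wigner_moment k h (\<psi> h \<epsilon> t)) x) \<le> ennreal (C k \<alpha> t)"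
      using scaled_moment_bounds.Linf_norm_wigner_moment[OF bounds]
      by (intro exI[of _ "\<lambda>k \<alpha> t. ?K k \<alpha> + ?K k (Suc \<alpha>)"]) blast
    show "\<exists>C :: nat \<Rightarrow> nat \<Rightarrow> real \<Rightarrow> real. \<forall>k \<alpha>. \<forall>t\<in>{0..T}. \<forall>h\<in>{0<..1}. \<forall>\<epsilon>\<in>{0<..1}.
        L1_norm (\<lambda>x. (japanese x * h ^ \<alpha>) *\<^sub>R Dn \<alpha> (wigner_moment k h (\<psi> h \<epsilon> t)) x) \<le> ennreal (C k \<alpha> t)"
      using scaled_moment_bounds.L1_norm_wigner_moment[OF bounds]
      by (intro exI[of _ "\<lambda>k \<alpha> t. ?K k \<alpha>"]) blast
    show "\<exists>C :: nat \<Rightarrow> real \<Rightarrow> real. \<forall>k. \<forall>t\<in>{0..T}. \<forall>h\<in>{0<..1}. \<forall>\<epsilon>\<in>{0<..1}.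
        Linf_norm (\<lambda>x. h ^ k *\<^sub>R Dn k (E_field \<kappa> \<epsilon> (\<psi> h \<epsilon> t)) x) \<le> ennreal (C k t)"
    proof (intro exI[of _ "\<lambda>k t. \<Sum>i\<le>k. real (k choose i) * (M i * M (k - i))"] allI ballI)
      fix k t h \<epsilon>
      assume t: "t \<in> {0..T}" and h: "h \<in> {0<..1::real}" and \<epsilon>: "\<epsilon> \<in> {0<..1::real}"
      show "Linf_norm (\<lambda>x. h ^ k *\<^sub>R Dn k (E_field \<kappa> \<epsilon> (\<psi> h \<epsilon> t)) x) \<le>
          ennreal (\<Sum>i\<le>k. real (k choose i) * (M i * M (k - i)))"
        by (rule nls.Linf_norm_E_field[OF nls[OF h \<epsilon>] t M[OF h \<epsilon> t]])
    qed
  qed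
qed

end
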